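(* Let $\Bbbk$ be a field of characteristic different from $2$. With $A$, $\mathcal{J}$, $s$, $C$, $A_s$, $\mathcal{J}_s$ and $\mathcal{A}$ as defined in the context, there are algebra isomorphisms $$A_s \cong \Bbbk[C^{\pm 1}] \otimes \mathcal{J}_s\cong\Bbbk[C^{\pm 1}] \otimes M_2(\mathcal{A}) \cong M_2(\Bbbk[C^{\pm 1}]\otimes \mathcal{A}).$$
   Context: $\mathcal{J}$ (the super Jordan plane) is the $\Bbbk$-algebra generated by $x,y$ with relations $x^2=0$ and $ys-sy-xs=0$, where $s:=xy+yx$. $A$ (its bosonization) is the $\Bbbk$-algebra generated by $x,y,g,g^{-1}$ with relations $x^2=0$, $ys-sy-xs=0$ (where $s:=xy+yx$), $gg^{-1}=g^{-1}g=1$, $gxg^{-1}=-x$, $gyg^{-1}=-y+x$; equivalently $A=\mathcal{J}[g^{\pm1};\sigma]$ is the skew Laurent polynomial algebra with $\sigma(x)=-x$, $\sigma(y)=-y+x$. The element $s$ is normal and regular in $\mathcal{J}$ and in $A$; $\mathcal{J}_s$ and $A_s$ denote the localizations of $\mathcal{J}$ and $A$ at the powers of $s$. The element $C:=(2yx-s)g^{-1}\in A$ is central in $A$ and invertible in $A_s$, and $\Bbbk[C^{\pm1}]$ is the subalgebra of $A_s$ generated by $C^{\pm1}$. Put $y':=ys^{-1}\in\mathcal{J}_s$; $\mathcal{A}$ is the subalgebra of $\mathcal{J}_s$ generated by $y'^2$ and $s^{\pm1}$ (one has $y'^2s-sy'^2=1$, and $\mathcal{A}$ is the localization at the powers of $s$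 of the first Weyl algebra generated by $y'^2$ and $s$). Tensor products are over $\Bbbk$. *)

theory Defs
  imports
    "HOL-Algebra.Algebra"
    "HOL-Library.Poly_Mapping"
    "HOL-Library.Numeral_Type"
    "HOL-Analysis.Finite_Cartesian_Product"
begin

section \<open>Associative unital algebras over a field\<close>

text \<open>The ground field is a type of class \<^class>\<open>field\<close>; the algebras over it are
  HOL-Algebra records, because subalgebras, quotients and several structures at once are needed.
  The locale \<^locale>\<open>algebra\<close> of HOL-Algebra is not used: it requires commutativity.\<close>

definition field_ring :: "'k::field ring" where
  "field_ring = \<lparr>carrier = UNIV, monoid.mult = (*), monoid.one = 1, ring.zero = 0, ring.add = (+)\<rparr>"

locale k_algebra = module field_ring A + ring A
  for A :: "('k::field, 'a) module" (structure) +
  assumes smult_mult_left: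
      "\<lbrakk>x \<in> carrier A; y \<in> carrier A\<rbrakk> \<Longrightarrow> (k \<odot> x) \<otimes> y = k \<odot> (x \<otimes> y)"
    and smult_mult_right:
      "\<lbrakk>x \<in> carrier A; y \<in> carrier A\<rbrakk> \<Longrightarrow> x \<otimes> (k \<odot> y) = k \<odot> (x \<otimes> y)"

definition alg_hom :: "('k::field, 'a) module \<Rightarrow> ('k, 'b) module \<Rightarrow> ('a \<Rightarrow> 'b) set" where
  "alg_hom A B =
     {h \<in> ring_hom A B. \<forall>k. \<forall>x\<in>carrier A. h (k \<odot>\<^bsub>A\<^esub> x) = k \<odot>\<^bsub>B\<^esub> h x}"

definition alg_iso :: "('k::field, 'a) module \<Rightarrow> ('k, 'b) module \<Rightarrow> bool"
    (infix \<open>\<cong>\<^sub>a\<close> 50) where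
  "A \<cong>\<^sub>a B \<longleftrightarrow> (\<exists>h\<in>alg_hom A B. bij_betw h (carrier A) (carrier B))"

definition generated_subalgebra ::
    "('k::field, 'a) module \<Rightarrow> 'a set \<Rightarrow> ('k, 'a) module" where
  "generated_subalgebra A S =
     A\<lparr>carrier := \<Inter>{B. subring B A \<and> (\<forall>k. \<forall>b\<in>B. k \<odot>\<^bsub>A\<^esub> b \<in> B) \<and> S \<subseteq> B}\<rparr>"

text \<open>The quotient ring of HOL-Algebra, with the induced scalar multiplication.\<close>

definition quotient_algebra ::
    "('k::field, 'a) module \<Rightarrow> 'a set \<Rightarrow> ('k, 'a set) module" where
  "quotient_algebra A I =
     ring.extend (A Quot I) (module.fields (\<lambda>k Q. \<Union>x\<in>Q. I +>\<^bsub>A\<^esub> (k \<odot>\<^bsub>A\<^esub> x)))"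


section \<open>Matrix algebras and tensor products\<close>

definition M2 :: "('k::field, 'a) module \<Rightarrow> ('k, 'a^2^2) module" where
  "M2 A = \<lparr>carrier = {M. \<forall>i j. M $ i $ j \<in> carrier A},
     monoid.mult = (\<lambda>M N. \<chi> i j. \<Oplus>\<^bsub>A\<^esub>l\<in>UNIV. M $ i $ l \<otimes>\<^bsub>A\<^esub> N $ l $ j),
     monoid.one = (\<chi> i j. if i = j then \<one>\<^bsub>A\<^esub> else \<zero>\<^bsub>A\<^esub>),
     ring.zero = (\<chi> i j. \<zero>\<^bsub>A\<^esub>),
     ring.add = (\<lambda>M N. \<chi> i j. M $ i $ j \<oplus>\<^bsub>A\<^esub> N $ i $ j),
     smult = (\<lambda>k M. \<chi> i j. k \<odot>\<^bsub>A\<^esub> M $ i $ j)\<rparr>"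

abbreviation pm_scale :: "'k::field \<Rightarrow> ('a \<Rightarrow>\<^sub>0 'k) \<Rightarrow> ('a \<Rightarrow>\<^sub>0 'k)" where
  "pm_scale k \<equiv> Poly_Mapping.map ((*) k)"

text \<open>\<open>A \<otimes> B\<close> is the vector space with basis \<open>carrier A \<times> carrier B\<close>, with the multiplication
  \<open>(a, b) (a', b') = (a a', b b')\<close>, modulo the span of the bilinearity relators
  (this span is a two-sided ideal).\<close>

definition pair_algebra ::
    "('k::field, 'a) module \<Rightarrow> ('k, 'b) module \<Rightarrow> ('k, 'a \<times> 'b \<Rightarrow>\<^sub>0 'k) module" where
  "pair_algebra A B = \<lparr>carrier = {p. Poly_Mapping.keys p \<subseteq> carrier A \<times> carrier B},
     monoid.mult = (\<lambda>p q. \<Sum>(a, b)\<in>Poly_Mapping.keys p. \<Sum>(a', b')\<in>Poly_Mapping.keys q.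
        Poly_Mapping.single (a \<otimes>\<^bsub>A\<^esub> a', b \<otimes>\<^bsub>B\<^esub> b')
          (Poly_Mapping.lookup p (a, b) * Poly_Mapping.lookup q (a', b'))),
     monoid.one = Poly_Mapping.single (\<one>\<^bsub>A\<^esub>, \<one>\<^bsub>B\<^esub>) 1,
     ring.zero = 0, ring.add = (+), smult = pm_scale\<rparr>"

definition bilinearity_relators ::
    "('k::field, 'a) module \<Rightarrow> ('k, 'b) module \<Rightarrow> ('a \<times> 'b \<Rightarrow>\<^sub>0 'k) set" where
  "bilinearity_relators A B =
     (let e = (\<lambda>a b. Poly_Mapping.single (a, b) (1::'k)) in
        {e (a \<oplus>\<^bsub>A\<^esub> a') b - e a b - e a' b | a a' b.
           a \<in> carrier A \<and> a' \<in> carrier A \<and> b \<in> carrier B}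
      \<union> {e a (b \<oplus>\<^bsub>B\<^esub> b') - e a b - e a b' | a b b'.
           a \<in> carrier A \<and> b \<in> carrier B \<and> b' \<in> carrier B}
      \<union> {e (k \<odot>\<^bsub>A\<^esub> a) b - pm_scale k (e a b) | k a b. a \<in> carrier A \<and> b \<in> carrier B}
      \<union> {e a (k \<odot>\<^bsub>B\<^esub> b) - pm_scale k (e a b) | k a b. a \<in> carrier A \<and> b \<in> carrier B})"

definition tensor_algebra ::
    "('k::field, 'a) module \<Rightarrow> ('k, 'b) module \<Rightarrow> ('k, ('a \<times> 'b \<Rightarrow>\<^sub>0 'k) set) module"
    (infixr \<open>\<otimes>\<^sub>a\<close> 70) where
  "A \<otimes>\<^sub>a B =
     quotient_algebra (pair_algebra A B) (module.span pm_scale (bilinearity_relators A B))"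


section \<open>Localization\<close>

text \<open>\<open>L\<close>, with the structure map \<open>\<iota>\<close>, is the ring of left fractions \<open>t\<^sup>-\<^sup>1 r\<close> (\<open>t \<in> S\<close>) of \<open>R\<close>.
  This determines \<open>(L, \<iota>)\<close> up to a unique isomorphism over \<open>R\<close>; if the elements of \<open>S\<close> are
  regular, the last condition says that \<open>\<iota>\<close> is injective.\<close>

definition is_localization ::
    "('k::field, 'a) module \<Rightarrow> 'a set \<Rightarrow> ('k, 'b) module \<Rightarrow> ('a \<Rightarrow> 'b) \<Rightarrow> bool" where
  "is_localization R S L \<iota> \<longleftrightarrow>
     k_algebra L \<and> \<iota> \<in> alg_hom R L \<and>
     (\<forall>t\<in>S. \<iota> t \<in> Units L) \<and>
     (\<forall>z\<in>carrier L. \<exists>t\<in>S. \<exists>r\<in>carrier R. z = inv\<^bsub>L\<^esub> (\<iota> t) \<otimes>\<^bsub>L\<^esub> \<iota> r) \<and>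
     (\<forall>r\<in>carrier R. \<iota> r = \<zero>\<^bsub>L\<^esub> \<longleftrightarrow> (\<exists>t\<in>S. t \<otimes>\<^bsub>R\<^esub> r = \<zero>\<^bsub>R\<^esub>))"

definition powers :: "('k::field, 'a) module \<Rightarrow> 'a \<Rightarrow> 'a set" where
  "powers R s = {s [^]\<^bsub>R\<^esub> n | n::nat. True}"


section \<open>Algebras given by generators and relations\<close>

text \<open>With lists as the free monoid (written additively), the library's convolution product
  makes \<open>'g list \<Rightarrow>\<^sub>0 'k\<close> the free algebra on \<open>'g\<close>.\<close>

instantiation list :: (type) monoid_add
begin

definition zero_list :: "'a list" where "zero_list = []"
definition plus_list :: "'a list \<Rightarrow> 'a list \<Rightarrow> 'a list" where "plus_list = (@)"

instance
  by standard (simp_all add: zero_list_def plus_list_def)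

end

definition free_algebra :: "('k::field, 'g list \<Rightarrow>\<^sub>0 'k) module" where
  "free_algebra =
     \<lparr>carrier = UNIV, monoid.mult = (*), monoid.one = 1, ring.zero = 0, ring.add = (+), smult = pm_scale\<rparr>"

definition free_gen :: "'g \<Rightarrow> ('g list \<Rightarrow>\<^sub>0 'k::field)" where
  "free_gen g = Poly_Mapping.single [g] 1"

definition presented_algebra ::
    "('g list \<Rightarrow>\<^sub>0 'k::field) set \<Rightarrow> ('k, ('g list \<Rightarrow>\<^sub>0 'k) set) module" where
  "presented_algebra rels = quotient_algebra free_algebra (Idl\<^bsub>free_algebra\<^esub> rels)"

definition presented_class ::
    "('g list \<Rightarrow>\<^sub>0 'k::field) set \<Rightarrow> ('g list \<Rightarrow>\<^sub>0 'k) \<Rightarrow> ('g list \<Rightarrow>\<^sub>0 'k) set" where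
  "presented_class rels p = (Idl\<^bsub>free_algebra\<^esub> rels) +>\<^bsub>free_algebra\<^esub> p"


section \<open>The super Jordan plane\<close>

datatype sj_gen = SJ_x | SJ_y

definition sj_relators :: "(sj_gen list \<Rightarrow>\<^sub>0 'k::field) set" where
  "sj_relators =
     (let x = free_gen SJ_x; y = free_gen SJ_y; s = x * y + y * x in
      {x * x, y * s - s * y - x * s})"

definition super_jordan :: "('k::field, (sj_gen list \<Rightarrow>\<^sub>0 'k) set) module" where
  "super_jordan = presented_algebra sj_relators"

definition sj_y :: "(sj_gen list \<Rightarrow>\<^sub>0 'k::field) set" where
  "sj_y = presented_class sj_relators (free_gen SJ_y)"

definition sj_s :: "(sj_gen list \<Rightarrow>\<^sub>0 'k::field) set" where
  "sj_s = presented_class sj_relators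
     (free_gen SJ_x * free_gen SJ_y + free_gen SJ_y * free_gen SJ_x)"

text \<open>For a localization \<open>(L, \<iota>)\<close> of the super Jordan plane at the powers of \<open>s\<close>:
  the subalgebra of \<open>L\<close> generated by \<open>y'\<^sup>2\<close>, \<open>s\<close> and \<open>s\<^sup>-\<^sup>1\<close>, where \<open>y' = y s\<^sup>-\<^sup>1\<close>.\<close>

definition localized_weyl ::
    "('k::field, 'b) module \<Rightarrow> ((sj_gen list \<Rightarrow>\<^sub>0 'k) set \<Rightarrow> 'b) \<Rightarrow> ('k, 'b) module" where
  "localized_weyl L \<iota> =
     (let y' = \<iota> sj_y \<otimes>\<^bsub>L\<^esub> inv\<^bsub>L\<^esub> (\<iota> sj_s) in
      generated_subalgebra L {y' \<otimes>\<^bsub>L\<^esub> y', \<iota> sj_s, inv\<^bsub>L\<^esub> (\<iota> sj_s)})"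


section \<open>The bosonization of the super Jordan plane\<close>

text \<open>\<open>Bos_gi\<close> stands for the generator \<open>g\<^sup>-\<^sup>1\<close>.\<close>

datatype bos_gen = Bos_x | Bos_y | Bos_g | Bos_gi

definition bos_relators :: "(bos_gen list \<Rightarrow>\<^sub>0 'k::field) set" where
  "bos_relators =
     (let x = free_gen Bos_x; y = free_gen Bos_y; g = free_gen Bos_g; gi = free_gen Bos_gi;
          s = x * y + y * x in
      {x * x, y * s - s * y - x * s, g * gi - 1, gi * g - 1,
       g * x * gi - (- x), g * y * gi - (- y + x)})"

definition bosonization :: "('k::field, (bos_gen list \<Rightarrow>\<^sub>0 'k) set) module" where
  "bosonization = presented_algebra bos_relators"

definition bos_s :: "(bos_gen list \<Rightarrow>\<^sub>0 'k::field) set" where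
  "bos_s = presented_class bos_relators
     (free_gen Bos_x * free_gen Bos_y + free_gen Bos_y * free_gen Bos_x)"

definition bos_C :: "(bos_gen list \<Rightarrow>\<^sub>0 'k::field) set" where
  "bos_C = presented_class bos_relators
     (let x = free_gen Bos_x; y = free_gen Bos_y; s = x * y + y * x in
      (2 * y * x - s) * free_gen Bos_gi)"

text \<open>For a localization \<open>(L, \<kappa>)\<close> of the bosonization at the powers of \<open>s\<close>:
  the subalgebra \<open>k[C\<^sup>\<plusminus>\<^sup>1]\<close> of \<open>L\<close>.\<close>

definition laurent_C ::
    "('k::field, 'c) module \<Rightarrow> ((bos_gen list \<Rightarrow>\<^sub>0 'k) set \<Rightarrow> 'c) \<Rightarrow> ('k, 'c) module" where
  "laurent_C L \<kappa> = generated_subalgebra L {\<kappa> bos_C, inv\<^bsub>L\<^esub> (\<kappa> bos_C)}"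

end

theory Submission
  imports Defs "HOL-Analysis.Cartesian_Space"
begin

text \<open>Both isomorphisms are written down on generators; all maps come from universal properties, so
  no basis of \<open>J\<close> or \<open>A\<close> is needed.

  Put \<open>d = yx - xy\<close>. Then \<open>dx = -xd\<close>, \<open>dy = (-y + x)d\<close> and \<open>d\<^sup>2 = s\<^sup>2\<close>, so \<open>d\<close> is invertible in \<open>J\<^sub>s\<close>
  and induces the automorphism \<open>\<sigma>\<close> there. As \<open>C = d g\<^sup>-\<^sup>1\<close>, the assignments \<open>x \<mapsto> 1 \<otimes> x\<close>, \<open>y \<mapsto> 1 \<otimes> y\<close>,
  \<open>g \<mapsto> C\<^sup>-\<^sup>1 \<otimes> d\<close> define a map from \<open>A\<^sub>s\<close> to \<open>k[C\<^sup>\<plusminus>\<^sup>1] \<otimes> J\<^sub>s\<close>, inverse to multiplication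
  \<open>c \<otimes> z \<mapsto> cz\<close>.

  In \<open>J\<^sub>s\<close> one has \<open>x\<^sup>2 = 0\<close> and \<open>xy' + y'x = 1\<close>, so \<open>xy'\<close>, \<open>x\<close>, \<open>y'xy'\<close>, \<open>y'x\<close> are \<open>2 \<times> 2\<close> matrix
  units. They commute with \<open>y'\<^sup>2\<close> and \<open>s\<close>, and together with these generate \<open>J\<^sub>s\<close>, whence
  \<open>J\<^sub>s\<close> is the algebra of \<open>2 \<times> 2\<close> matrices over the subalgebra generated by \<open>y'\<^sup>2\<close> and \<open>s\<^sup>\<plusminus>\<^sup>1\<close>.\<close>

section \<open>Algebras, subalgebras and homomorphisms\<close>

text \<open>Why such a \<open>d\<close> exists: centrality of \<open>C\<close> amounts to
  \<open>2yx - s\<close> and \<open>g\<close> inducing the same automorphism on \<open>x\<close> and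
  \<open>y\<close>. A skew Laurent extension by an inner automorphism can be untwisted by changing
  the variable, here from \<open>g\<close> to \<open>C\<close>. Localizing at \<open>s\<close> makes
  the automorphism inner.

  The obstacle is that the localizations are arbitrary pairs of an algebra and a structure map,
  known only through units, left fractions and kernel. Before a map out of them can be written down,
  their universal property has to be proved. The Ore condition behind it is not assumed but
  extracted from the fact that every element is a left fraction.

  Bijectivity rests on two devices. Homomorphisms agreeing on generators are equal, since the set
  where they agree is a subalgebra; and each entry of a combination of matrix units can be recovered
  from it.

  The matrix units commute with \<open>y'^2\<close> and \<open>s\<close> for two reasons. As
  \<open>y'\<close> commutes with \<open>1 = xy' + y'x\<close>, its square commutes with
  \<open>x\<close>. And \<open>y's - sy' = x\<close>, a defect that vanishes next to a factor
  \<open>x\<close>.\<close>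

lemma field_ring_simps [simp]:
  "carrier field_ring = UNIV" "a \<otimes>\<^bsub>field_ring\<^esub> b = a * b" "a \<oplus>\<^bsub>field_ring\<^esub> b = a + b"
  "\<one>\<^bsub>field_ring\<^esub> = 1" "\<zero>\<^bsub>field_ring\<^esub> = 0"
  by (simp_all add: field_ring_def)

lemma cring_field_ring: "cring (field_ring :: 'k::field ring)"
proof (rule cringI)
  show "abelian_group (field_ring :: 'k ring)"
    by (rule abelian_groupI) (auto simp: algebra_simps intro: exI[of _ "- x" for x] left_minus)
  show "Group.comm_monoid (field_ring :: 'k ring)"
    by (rule comm_monoidI) (auto simp: algebra_simps)
qed (simp add: algebra_simps)

lemma k_algebraI:
  fixes A (structure)
  assumes "ring A"
    and "\<And>k x. x \<in> carrier A \<Longrightarrow> k \<odot> x \<in> carrier A"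
    and "\<And>k l x. x \<in> carrier A \<Longrightarrow> (k + l) \<odot> x = k \<odot> x \<oplus> l \<odot> x"
    and "\<And>k x y. \<lbrakk>x \<in> carrier A; y \<in> carrier A\<rbrakk> \<Longrightarrow> k \<odot> (x \<oplus> y) = k \<odot> x \<oplus> k \<odot> y"
    and "\<And>k l x. x \<in> carrier A \<Longrightarrow> (k * l) \<odot> x = k \<odot> (l \<odot> x)"
    and "\<And>x. x \<in> carrier A \<Longrightarrow> 1 \<odot> x = x"
    and "\<And>k x y. \<lbrakk>x \<in> carrier A; y \<in> carrier A\<rbrakk> \<Longrightarrow> (k \<odot> x) \<otimes> y = k \<odot> (x \<otimes> y)"
    and "\<And>k x y. \<lbrakk>x \<in> carrier A; y \<in> carrier A\<rbrakk> \<Longrightarrow> x \<otimes> (k \<odot> y) = k \<odot> (x \<otimes> y)"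
  shows "k_algebra A"
  by (intro k_algebra.intro moduleI k_algebra_axioms.intro)
     (use assms in \<open>auto intro: cring_field_ring ring.is_abelian_group\<close>)

lemma k_algebra_ring: "k_algebra A \<Longrightarrow> ring A"
  by (simp add: k_algebra_def)

context k_algebra
begin

lemma smult_carrier [simp, intro]: "x \<in> carrier A \<Longrightarrow> k \<odot> x \<in> carrier A"
  using smult_closed[of k x] by simp

lemma smult_add_left: "x \<in> carrier A \<Longrightarrow> (k + l) \<odot> x = k \<odot> x \<oplus> l \<odot> x"
  using smult_l_distr[of k l x] by simp

lemma smult_add_right:
  "\<lbrakk>x \<in> carrier A; y \<in> carrier A\<rbrakk> \<Longrightarrow> k \<odot> (x \<oplus> y) = k \<odot> x \<oplus> k \<odot> y"
  using smult_r_distr[of k x y] by simp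

lemma smult_smult: "x \<in> carrier A \<Longrightarrow> k \<odot> (l \<odot> x) = (k * l) \<odot> x"
  using smult_assoc1[of k l x] by simp

lemma smult_1 [simp]: "x \<in> carrier A \<Longrightarrow> 1 \<odot> x = x"
  using smult_one[of x] by simp

lemma smult_0 [simp]: "x \<in> carrier A \<Longrightarrow> 0 \<odot> x = \<zero>"
  using smult_l_null[of x] by simp

lemma smult_zero [simp]: "k \<odot> \<zero> = \<zero>"
  using smult_r_null[of k] by simp

lemma smult_minus_1: "x \<in> carrier A \<Longrightarrow> (-1) \<odot> x = \<ominus> x"
  by (rule sym, rule minus_equality) (use smult_add_left[of x "-1" 1] in simp_all)

lemma smult_eq_mult_one: "x \<in> carrier A \<Longrightarrow> k \<odot> x = (k \<odot> \<one>) \<otimes> x"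
  by (simp add: smult_mult_left)

end

text \<open>The condition over which \<open>generated_subalgebra\<close> intersects. As a predicate
  it turns every extension from generators into one pattern: the elements with the wanted property
  form a subalgebra containing the generators.\<close>

definition is_subalgebra :: "('k::field, 'a) module \<Rightarrow> 'a set \<Rightarrow> bool" where
  "is_subalgebra A B \<longleftrightarrow> subring B A \<and> (\<forall>k. \<forall>b\<in>B. k \<odot>\<^bsub>A\<^esub> b \<in> B)"

text \<open>Closure under negation comes for free, the negative being the multiple by the scalar
  -1.\<close>

lemma (in k_algebra) is_subalgebraI:
  assumes "B \<subseteq> carrier A" "\<one> \<in> B"
    and "\<And>k x. x \<in> B \<Longrightarrow> k \<odot> x \<in> B"
    and "\<And>x y. \<lbrakk>x \<in> B; y \<in> B\<rbrakk> \<Longrightarrow> x \<oplus> y \<in> B"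
    and "\<And>x y. \<lbrakk>x \<in> B; y \<in> B\<rbrakk> \<Longrightarrow> x \<otimes> y \<in> B"
  shows "is_subalgebra A B"
proof -
  have "\<ominus> x \<in> B" if "x \<in> B" for x
    using assms(3)[OF that, of "-1"] smult_minus_1[of x] assms(1) that by auto
  then show ?thesis
    unfolding is_subalgebra_def using assms by (auto intro: subringI)
qed

lemma is_subalgebraD:
  assumes "is_subalgebra A B"
  shows "B \<subseteq> carrier A" "\<one>\<^bsub>A\<^esub> \<in> B" "\<zero>\<^bsub>A\<^esub> \<in> B"
    and "x \<in> B \<Longrightarrow> k \<odot>\<^bsub>A\<^esub> x \<in> B"
    and "x \<in> B \<Longrightarrow> \<ominus>\<^bsub>A\<^esub> x \<in> B"
    and "\<lbrakk>x \<in> B; y \<in> B\<rbrakk> \<Longrightarrow> x \<oplus>\<^bsub>A\<^esub> y \<in> B"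
    and "\<lbrakk>x \<in> B; y \<in> B\<rbrakk> \<Longrightarrow> x \<otimes>\<^bsub>A\<^esub> y \<in> B"
  using assms subringE[of B A] by (auto simp: is_subalgebra_def)

lemma (in k_algebra) k_algebra_subalgebra:
  assumes "is_subalgebra A B"
  shows "k_algebra (A\<lparr>carrier := B\<rparr>)"
  using assms is_subalgebraD[OF assms]
  by (intro k_algebraI subring_is_ring)
     (auto simp: is_subalgebra_def smult_add_left smult_add_right smult_smult
        smult_mult_left smult_mult_right subset_eq)

lemma (in k_algebra) generated_subalgebra_eq:
  "generated_subalgebra A S = A\<lparr>carrier := \<Inter>{B. is_subalgebra A B \<and> S \<subseteq> B}\<rparr>"
  unfolding generated_subalgebra_def is_subalgebra_def by (simp add: conj_assoc)

lemma (in k_algebra) is_subalgebra_carrier: "is_subalgebra A (carrier A)"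
  by (rule is_subalgebraI) auto

lemma (in k_algebra) is_subalgebra_generated:
  assumes "S \<subseteq> carrier A"
  shows "is_subalgebra A (carrier (generated_subalgebra A S))"
proof (rule is_subalgebraI)
  show "carrier (generated_subalgebra A S) \<subseteq> carrier A"
    unfolding generated_subalgebra_eq using is_subalgebra_carrier assms by auto
qed (auto simp: generated_subalgebra_eq dest: is_subalgebraD)

lemma (in k_algebra) k_algebra_generated:
  assumes "S \<subseteq> carrier A"
  shows "k_algebra (generated_subalgebra A S)"
  using k_algebra_subalgebra[OF is_subalgebra_generated[OF assms]]
  by (simp add: generated_subalgebra_eq)

lemma (in k_algebra) generated_subset: "S \<subseteq> carrier (generated_subalgebra A S)"
  by (auto simp: generated_subalgebra_eq)

lemma (in k_algebra) generated_least:
  "\<lbrakk>is_subalgebra A B; S \<subseteq> B\<rbrakk> \<Longrightarrow> carrier (generated_subalgebra A S) \<subseteq> B"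
  by (auto simp: generated_subalgebra_eq)

lemma generated_subalgebra_sel [simp]:
  "monoid.mult (generated_subalgebra A S) = monoid.mult A"
  "monoid.one (generated_subalgebra A S) = monoid.one A"
  "ring.add (generated_subalgebra A S) = ring.add A"
  "ring.zero (generated_subalgebra A S) = ring.zero A"
  "smult (generated_subalgebra A S) = smult A"
  by (simp_all add: generated_subalgebra_def)

lemma alg_homI:
  assumes "\<And>x. x \<in> carrier A \<Longrightarrow> h x \<in> carrier B"
    and "\<And>x y. \<lbrakk>x \<in> carrier A; y \<in> carrier A\<rbrakk> \<Longrightarrow> h (x \<otimes>\<^bsub>A\<^esub> y) = h x \<otimes>\<^bsub>B\<^esub> h y"
    and "\<And>x y. \<lbrakk>x \<in> carrier A; y \<in> carrier A\<rbrakk> \<Longrightarrow> h (x \<oplus>\<^bsub>A\<^esub> y) = h x \<oplus>\<^bsub>B\<^esub> h y"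
    and "h \<one>\<^bsub>A\<^esub> = \<one>\<^bsub>B\<^esub>"
    and "\<And>k x. x \<in> carrier A \<Longrightarrow> h (k \<odot>\<^bsub>A\<^esub> x) = k \<odot>\<^bsub>B\<^esub> h x"
  shows "h \<in> alg_hom A B"
  unfolding alg_hom_def using assms by (auto intro!: ring_hom_memI)

lemma alg_homD:
  assumes "h \<in> alg_hom A B"
  shows "x \<in> carrier A \<Longrightarrow> h x \<in> carrier B"
    and "\<lbrakk>x \<in> carrier A; y \<in> carrier A\<rbrakk> \<Longrightarrow> h (x \<otimes>\<^bsub>A\<^esub> y) = h x \<otimes>\<^bsub>B\<^esub> h y"
    and "\<lbrakk>x \<in> carrier A; y \<in> carrier A\<rbrakk> \<Longrightarrow> h (x \<oplus>\<^bsub>A\<^esub> y) = h x \<oplus>\<^bsub>B\<^esub> h y"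
    and "h \<one>\<^bsub>A\<^esub> = \<one>\<^bsub>B\<^esub>"
    and "x \<in> carrier A \<Longrightarrow> h (k \<odot>\<^bsub>A\<^esub> x) = k \<odot>\<^bsub>B\<^esub> h x"
  using assms by (auto simp: alg_hom_def ring_hom_def Pi_def)

lemma alg_hom_minus:
  assumes "k_algebra A" "k_algebra B" "h \<in> alg_hom A B" "x \<in> carrier A"
  shows "h (\<ominus>\<^bsub>A\<^esub> x) = \<ominus>\<^bsub>B\<^esub> h x"
  using assms alg_homD(1,5)[OF assms(3)] k_algebra.smult_minus_1 by metis

lemma alg_hom_zero:
  assumes "k_algebra A" "k_algebra B" "h \<in> alg_hom A B"
  shows "h \<zero>\<^bsub>A\<^esub> = \<zero>\<^bsub>B\<^esub>"
  using assms ring_hom_zero[of h A B] by (auto simp: alg_hom_def k_algebra_ring)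

lemma alg_hom_minus_diff:
  assumes "k_algebra A" "k_algebra B" "h \<in> alg_hom A B" "x \<in> carrier A" "y \<in> carrier A"
  shows "h (x \<ominus>\<^bsub>A\<^esub> y) = h x \<ominus>\<^bsub>B\<^esub> h y"
proof -
  interpret A: k_algebra A by fact
  show ?thesis
    using assms by (simp add: a_minus_def alg_hom_minus alg_homD(3)[OF assms(3)])
qed

lemma alg_hom_comp:
  assumes "h \<in> alg_hom A B" "h' \<in> alg_hom B D"
  shows "(\<lambda>x. h' (h x)) \<in> alg_hom A D"
  by (rule alg_homI) (simp_all add: alg_homD[OF assms(1)] alg_homD[OF assms(2)])

lemma alg_hom_id: "(\<lambda>x. x) \<in> alg_hom A A"
  by (rule alg_homI) auto

lemma alg_hom_Units:
  assumes "k_algebra A" "k_algebra B" and h: "h \<in> alg_hom A B" and u: "u \<in> Units A"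
  shows "h u \<in> Units B" "h (inv\<^bsub>A\<^esub> u) = inv\<^bsub>B\<^esub> h u"
proof -
  interpret A: k_algebra A by fact
  interpret B: k_algebra B by fact
  have carr: "u \<in> carrier A" "inv\<^bsub>A\<^esub> u \<in> carrier A" using u by auto
  have l: "h (inv\<^bsub>A\<^esub> u) \<otimes>\<^bsub>B\<^esub> h u = \<one>\<^bsub>B\<^esub>" and r: "h u \<otimes>\<^bsub>B\<^esub> h (inv\<^bsub>A\<^esub> u) = \<one>\<^bsub>B\<^esub>"
    using u carr by (simp_all add: alg_homD(2,4)[OF h, symmetric])
  then show "h u \<in> Units B"
    using carr alg_homD(1)[OF h] unfolding Units_def by auto
  show "h (inv\<^bsub>A\<^esub> u) = inv\<^bsub>B\<^esub> h u"
    using B.inv_char[OF _ _ r l] carr alg_homD(1)[OF h] by simp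
qed

lemma alg_isoI:
  assumes h: "h \<in> alg_hom A B" and h': "h' \<in> alg_hom B A"
    and "\<And>x. x \<in> carrier A \<Longrightarrow> h' (h x) = x" "\<And>y. y \<in> carrier B \<Longrightarrow> h (h' y) = y"
  shows "A \<cong>\<^sub>a B"
  unfolding alg_iso_def
  by (intro bexI[OF _ h] bij_betw_byWitness[where f' = h'])
     (use assms alg_homD(1)[OF h] alg_homD(1)[OF h'] in auto)

text \<open>The inverse bijection respects every operation: each identity is \<open>gh\<close> at a
  value formed in \<open>A\<close> from preimages. Closure of \<open>A\<close> under its operations
  is what puts that value in the carrier.\<close>

lemma alg_isoE:
  assumes "A \<cong>\<^sub>a B" "k_algebra A"
  obtains h h' where "h \<in> alg_hom A B" "h' \<in> alg_hom B A"
    "\<And>x. x \<in> carrier A \<Longrightarrow> h' (h x) = x" "\<And>y. y \<in> carrier B \<Longrightarrow> h (h' y) = y"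
proof -
  interpret A: k_algebra A by fact
  obtain h where h: "h \<in> alg_hom A B" and bij: "bij_betw h (carrier A) (carrier B)"
    using assms(1) unfolding alg_iso_def by blast
  let ?g = "inv_into (carrier A) h"
  have g: "?g y \<in> carrier A" "h (?g y) = y" if "y \<in> carrier B" for y
    using bij that by (auto simp: bij_betw_def inv_into_into f_inv_into_f)
  have gh: "?g (h x) = x" if "x \<in> carrier A" for x
    using bij that by (auto simp: bij_betw_def)
  have "?g \<in> alg_hom B A"
  proof (rule alg_homI)
    fix x y assume x: "x \<in> carrier B" and y: "y \<in> carrier B"
    show "?g (x \<otimes>\<^bsub>B\<^esub> y) = ?g x \<otimes>\<^bsub>A\<^esub> ?g y"
      using gh[of "?g x \<otimes>\<^bsub>A\<^esub> ?g y"] g[OF x] g[OF y] by (simp add: alg_homD(2)[OF h])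
    show "?g (x \<oplus>\<^bsub>B\<^esub> y) = ?g x \<oplus>\<^bsub>A\<^esub> ?g y"
      using gh[of "?g x \<oplus>\<^bsub>A\<^esub> ?g y"] g[OF x] g[OF y] by (simp add: alg_homD(3)[OF h])
  next
    fix k x assume x: "x \<in> carrier B"
    show "?g (k \<odot>\<^bsub>B\<^esub> x) = k \<odot>\<^bsub>A\<^esub> ?g x"
      using gh[of "k \<odot>\<^bsub>A\<^esub> ?g x"] g[OF x] by (simp add: alg_homD(5)[OF h])
  next
    show "?g \<one>\<^bsub>B\<^esub> = \<one>\<^bsub>A\<^esub>"
      using gh[of "\<one>\<^bsub>A\<^esub>"] by (simp add: alg_homD(4)[OF h])
  qed (rule g)
  then show thesis using that h g gh by blast
qed

text \<open>The uniqueness device of the whole proof: once the generators lie in this set, the two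
  homomorphisms coincide.\<close>

lemma is_subalgebra_equalizer:
  assumes "k_algebra A" "k_algebra B" and f: "f \<in> alg_hom A B" and g: "g \<in> alg_hom A B"
  shows "is_subalgebra A {x \<in> carrier A. f x = g x}"
proof -
  interpret A: k_algebra A by fact
  show ?thesis
    by (rule A.is_subalgebraI) (auto simp: alg_homD[OF f] alg_homD[OF g])
qed

lemma is_subalgebra_vimage:
  assumes "k_algebra A" and h: "h \<in> alg_hom A B" and B': "is_subalgebra B B'"
  shows "is_subalgebra A {x \<in> carrier A. h x \<in> B'}"
proof -
  interpret A: k_algebra A by fact
  show ?thesis
    by (rule A.is_subalgebraI) (auto simp: alg_homD[OF h] is_subalgebraD[OF B'])
qed

lemma is_subalgebra_image:
  assumes "k_algebra A" "k_algebra B" and h: "h \<in> alg_hom A B"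
  shows "is_subalgebra B (h ` carrier A)"
proof -
  interpret A: k_algebra A by fact
  interpret B: k_algebra B by fact
  show ?thesis
    by (rule B.is_subalgebraI)
       (auto simp: alg_homD(1)[OF h] alg_homD(2-5)[OF h, symmetric])
qed

section \<open>Centralizers\<close>

definition centralizer :: "('k::field, 'a) module \<Rightarrow> 'a set \<Rightarrow> 'a set" where
  "centralizer A S = {x \<in> carrier A. \<forall>c\<in>S. x \<otimes>\<^bsub>A\<^esub> c = c \<otimes>\<^bsub>A\<^esub> x}"

context k_algebra
begin

lemma is_subalgebra_centralizer:
  assumes "S \<subseteq> carrier A"
  shows "is_subalgebra A (centralizer A S)"
proof -
  have "(x \<otimes> y) \<otimes> c = c \<otimes> (x \<otimes> y)"
    if "x \<in> carrier A" "y \<in> carrier A" "c \<in> carrier A" "x \<otimes> c = c \<otimes> x" "y \<otimes> c = c \<otimes> y" for x y c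
    using that by (metis m_assoc)
  then show ?thesis
    using assms by (intro is_subalgebraI)
      (auto simp: centralizer_def l_distr r_distr smult_mult_left smult_mult_right subset_eq)
qed

lemma commute_inv:
  assumes "u \<in> Units A" "x \<in> carrier A" "u \<otimes> x = x \<otimes> u"
  shows "inv u \<otimes> x = x \<otimes> inv u"
proof -
  have u: "u \<in> carrier A" "inv u \<in> carrier A" "inv u \<otimes> u = \<one>" "u \<otimes> inv u = \<one>"
    using assms(1) by auto
  have "inv u \<otimes> x = inv u \<otimes> (x \<otimes> u) \<otimes> inv u"
    using u assms(2) by (simp add: m_assoc)
  also have "\<dots> = (inv u \<otimes> u) \<otimes> (x \<otimes> inv u)"
    using u(1,2) assms(2) by (simp add: assms(3)[symmetric] m_assoc)
  finally show ?thesis using u assms(2) by simp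
qed

lemma inv_in_centralizer:
  assumes "S \<subseteq> carrier A" "u \<in> Units A" "u \<in> centralizer A S"
  shows "inv u \<in> centralizer A S"
  using assms commute_inv[of u] by (auto simp: centralizer_def)

end

text \<open>The axioms are equations or, for negatives, the existence of an image element, so they
  pass to any structure covered by a map compatible with the operations. For quotients this replaces
  a verification on cosets.\<close>

lemma k_algebra_image:
  fixes Q :: "('k::field, 'b) module"
  assumes "k_algebra A"
    and surj: "carrier Q = \<pi> ` carrier A"
    and \<pi>_mult: "\<And>x y. \<lbrakk>x \<in> carrier A; y \<in> carrier A\<rbrakk> \<Longrightarrow> \<pi> x \<otimes>\<^bsub>Q\<^esub> \<pi> y = \<pi> (x \<otimes>\<^bsub>A\<^esub> y)"
    and \<pi>_add: "\<And>x y. \<lbrakk>x \<in> carrier A; y \<in> carrier A\<rbrakk> \<Longrightarrow> \<pi> x \<oplus>\<^bsub>Q\<^esub> \<pi> y = \<pi> (x \<oplus>\<^bsub>A\<^esub> y)"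
    and \<pi>_one: "\<one>\<^bsub>Q\<^esub> = \<pi> \<one>\<^bsub>A\<^esub>" and \<pi>_zero: "\<zero>\<^bsub>Q\<^esub> = \<pi> \<zero>\<^bsub>A\<^esub>"
    and \<pi>_smult: "\<And>k x. x \<in> carrier A \<Longrightarrow> k \<odot>\<^bsub>Q\<^esub> \<pi> x = \<pi> (k \<odot>\<^bsub>A\<^esub> x)"
  shows "k_algebra Q"
proof -
  interpret A: k_algebra A by fact
  note \<pi> = \<pi>_mult \<pi>_add \<pi>_one \<pi>_zero \<pi>_smult
  have "abelian_group Q"
  proof (rule abelian_groupI)
    fix x assume "x \<in> carrier Q"
    then obtain a where a: "a \<in> carrier A" "x = \<pi> a" using surj by auto
    have "\<pi> (\<ominus>\<^bsub>A\<^esub> a) \<oplus>\<^bsub>Q\<^esub> x = \<zero>\<^bsub>Q\<^esub>" using a by (simp add: \<pi> A.l_neg)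
    then show "\<exists>y\<in>carrier Q. y \<oplus>\<^bsub>Q\<^esub> x = \<zero>\<^bsub>Q\<^esub>" using a surj by auto
  qed (auto simp: surj \<pi> A.a_ac)
  moreover have "Group.monoid Q"
    by (rule monoidI) (auto simp: surj \<pi> A.m_assoc)
  ultimately have "ring Q"
    by (rule ringI) (auto simp: surj \<pi> A.l_distr A.r_distr)
  then show ?thesis
    by (rule k_algebraI)
       (auto simp: surj \<pi> A.smult_add_left A.smult_add_right A.smult_smult
          A.smult_mult_left A.smult_mult_right)
qed


section \<open>Quotient algebras\<close>

context k_algebra
begin

text \<open>An ideal of a unital algebra is automatically a subspace, because scaling by
  \<open>k\<close> is multiplication by \<open>k \<odot> \<one>\<close>.\<close>

lemma ideal_smult: "\<lbrakk>ideal I A; x \<in> I\<rbrakk> \<Longrightarrow> k \<odot> x \<in> I"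
  using smult_eq_mult_one[of x k] ideal.I_l_closed[of I A x "k \<odot> \<one>"]
    additive_subgroup.a_Hcarr[OF ideal.axioms(1)] by fastforce

text \<open>Scalar multiplication on the quotient is defined as a union over all representatives.
  All cosets in that union coincide, as two representatives differ by an element of \<open>I\<close>
  and \<open>I\<close> is closed under scaling.\<close>

lemma quotient_smult:
  assumes "ideal I A" "a \<in> carrier A"
  shows "(\<Union>x\<in>I +> a. I +> (k \<odot> x)) = I +> (k \<odot> a)"
proof -
  interpret ideal I A by fact
  have "I +> (k \<odot> x) = I +> (k \<odot> a)" if "x \<in> I +> a" for x
  proof -
    from that obtain i where i: "i \<in> I" "x = i \<oplus> a"
      by (auto simp: a_r_coset_def')
    then have "i \<in> carrier A" by auto
    with i assms have "k \<odot> x \<ominus> k \<odot> a = k \<odot> i"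
      by (simp add: smult_add_right a_minus_def a_assoc r_neg)
    then show ?thesis
      using quotient_eq_iff_same_a_r_cos[OF assms(1), of "k \<odot> x" "k \<odot> a"]
        ideal_smult[OF assms(1) i(1), of k] assms(2) i \<open>i \<in> carrier A\<close> by simp
  qed
  moreover have "a \<in> I +> a" using assms(2) by (rule a_rcos_self)
  ultimately show ?thesis by blast
qed

lemma quotient_algebra_sel:
  "carrier (quotient_algebra A I) = (+>) I ` carrier A"
  "monoid.mult (quotient_algebra A I) = rcoset_mult A I"
  "monoid.one (quotient_algebra A I) = I +> \<one>"
  "ring.zero (quotient_algebra A I) = I"
  "ring.add (quotient_algebra A I) = set_add A"
  "smult (quotient_algebra A I) = (\<lambda>k Q. \<Union>x\<in>Q. I +> (k \<odot> x))"
  by (auto simp: quotient_algebra_def ring.extend_def module.fields_def FactRing_def A_RCOSETS_def')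

lemma quotient_hom_rules:
  assumes "ideal I A" "x \<in> carrier A" "y \<in> carrier A"
  defines "Q \<equiv> quotient_algebra A I"
  shows "(I +> x) \<otimes>\<^bsub>Q\<^esub> (I +> y) = I +> (x \<otimes> y)"
    and "(I +> x) \<oplus>\<^bsub>Q\<^esub> (I +> y) = I +> (x \<oplus> y)"
    and "k \<odot>\<^bsub>Q\<^esub> (I +> x) = I +> (k \<odot> x)"
proof -
  interpret ideal I A by fact
  show "(I +> x) \<otimes>\<^bsub>Q\<^esub> (I +> y) = I +> (x \<otimes> y)" "(I +> x) \<oplus>\<^bsub>Q\<^esub> (I +> y) = I +> (x \<oplus> y)"
    "k \<odot>\<^bsub>Q\<^esub> (I +> x) = I +> (k \<odot> x)"
    using assms(2,3) a_subset
    by (auto simp: Q_def quotient_algebra_sel rcoset_mult_add a_rcos_sum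
        quotient_smult[OF assms(1)])
qed

lemma quotient_zero: "ideal I A \<Longrightarrow> \<zero>\<^bsub>quotient_algebra A I\<^esub> = I +> \<zero>"
  by (simp add: quotient_algebra_sel additive_subgroup.a_subset[OF ideal.axioms(1)])

lemma k_algebra_quotient:
  assumes "ideal I A"
  shows "k_algebra (quotient_algebra A I)"
  by (rule k_algebra_image[OF k_algebra_axioms, where \<pi> = "(+>) I"])
     (simp_all add: quotient_hom_rules[OF assms] quotient_algebra_sel(1,3) quotient_zero[OF assms])

lemma quotient_class_hom:
  assumes "ideal I A"
  shows "(+>) I \<in> alg_hom A (quotient_algebra A I)"
  by (rule alg_homI) (simp_all add: quotient_hom_rules[OF assms] quotient_algebra_sel(1,3))

lemma quotient_lift:
  assumes I: "ideal I A" and D: "k_algebra D" and f: "f \<in> alg_hom A D"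
    and vanish: "\<And>x. x \<in> I \<Longrightarrow> f x = \<zero>\<^bsub>D\<^esub>"
  obtains h where "h \<in> alg_hom (quotient_algebra A I) D"
    "\<And>a. a \<in> carrier A \<Longrightarrow> h (I +> a) = f a"
proof -
  interpret D: k_algebra D by fact
  \<comment> \<open>An arbitrary representative is chosen; \<open>f\<close> kills \<open>I\<close>,
    so the value does not depend on the choice.\<close>
  define h where "h Q = f (SOME a. a \<in> carrier A \<and> I +> a = Q)" for Q
  have h: "h (I +> a) = f a" if "a \<in> carrier A" for a
  proof -
    define b where "b = (SOME b. b \<in> carrier A \<and> I +> b = I +> a)"
    have b: "b \<in> carrier A" "I +> b = I +> a"
      using someI[of "\<lambda>b. b \<in> carrier A \<and> I +> b = I +> a" a] that by (auto simp: b_def)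
    then have "b \<ominus> a \<in> I"
      using quotient_eq_iff_same_a_r_cos[OF I] that by blast
    then have "f b \<ominus>\<^bsub>D\<^esub> f a = \<zero>\<^bsub>D\<^esub>"
      using vanish b that alg_hom_minus_diff[OF k_algebra_axioms D f] by metis
    then have "f b = f a"
      using b that by (simp add: alg_homD(1)[OF f] D.r_right_minus_eq)
    then show ?thesis by (simp add: h_def b_def)
  qed
  have "h \<in> alg_hom (quotient_algebra A I) D"
    by (rule alg_homI)
       (auto simp: quotient_algebra_sel(1,3) quotient_hom_rules[OF I] h alg_homD[OF f])
  then show thesis using h that by blast
qed

end


section \<open>Linear extension from a basis\<close>

lemma lookup_pm_scale [simp]:
  "Poly_Mapping.lookup (pm_scale k p) x = k * Poly_Mapping.lookup p x"
  by (simp add: Poly_Mapping.map.rep_eq when_def)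

lemma keys_pm_scale: "Poly_Mapping.keys (pm_scale k p) \<subseteq> Poly_Mapping.keys p"
  by (auto simp: in_keys_iff)

lemma pm_scale_single [simp]:
  "pm_scale k (Poly_Mapping.single x c) = Poly_Mapping.single x (k * c)"
  by (rule poly_mapping_eqI) (simp add: lookup_single when_def)

text \<open>Makes the span occurring in \<open>tensor_algebra\<close> available with its induction
  and minimality rules.\<close>

interpretation pm: Modules.module "pm_scale :: 'k::field \<Rightarrow> ('x \<Rightarrow>\<^sub>0 'k) \<Rightarrow> _"
  by standard (rule poly_mapping_eqI; simp add: lookup_add algebra_simps)+

text \<open>Reduces a statement that is additive in \<open>p\<close> to basis vectors. The support
  stays inside \<open>S\<close> throughout, because in the pair algebra products behave well only
  for basis vectors taken from the carriers.\<close>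

lemma pm_induct [consumes 1, case_names zero single add]:
  fixes p :: "'x \<Rightarrow>\<^sub>0 'k::comm_monoid_add"
  assumes "Poly_Mapping.keys p \<subseteq> S"
    and "P 0"
    and "\<And>x c. x \<in> S \<Longrightarrow> P (Poly_Mapping.single x c)"
    and "\<And>p q. \<lbrakk>Poly_Mapping.keys p \<subseteq> S; Poly_Mapping.keys q \<subseteq> S; P p; P q\<rbrakk> \<Longrightarrow> P (p + q)"
  shows "P p"
  using assms(1)
proof (induction p rule: Poly_Mapping.update_induct)
  case const
  show ?case by (fact assms(2))
next
  case (update f a b)
  have eq: "Poly_Mapping.update a b f = Poly_Mapping.single a b + f"
    using update(1) by (intro poly_mapping_eqI)
      (auto simp: lookup_update lookup_add lookup_single when_def in_keys_iff)
  have "Poly_Mapping.keys (Poly_Mapping.update a b f) = insert a (Poly_Mapping.keys f)"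
    using update(2) by (simp add: keys_update)
  with update show ?case
    unfolding eq by (intro assms(3,4)) auto
qed

definition lin_ext :: "('k::field, 'd) module \<Rightarrow> ('x \<Rightarrow> 'd) \<Rightarrow> ('x \<Rightarrow>\<^sub>0 'k) \<Rightarrow> 'd" where
  "lin_ext D u p = (\<Oplus>\<^bsub>D\<^esub>x\<in>Poly_Mapping.keys p. Poly_Mapping.lookup p x \<odot>\<^bsub>D\<^esub> u x)"

context k_algebra
begin

text \<open>Coefficients may cancel in \<open>p + q\<close>, so its support can be smaller than the
  union of the two supports. Summing over a common finite superset makes additivity a termwise
  statement.\<close>

lemma lin_ext_superset:
  assumes "u \<in> S \<rightarrow> carrier A" "finite F" "Poly_Mapping.keys p \<subseteq> F" "F \<subseteq> S"
  shows "lin_ext A u p = (\<Oplus>x\<in>F. Poly_Mapping.lookup p x \<odot> u x)"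
  unfolding lin_ext_def using assms
  by (intro add.finprod_mono_neutral_cong_left) (auto simp: in_keys_iff Pi_iff subset_iff)

lemma lin_ext_closed:
  assumes "u \<in> S \<rightarrow> carrier A" "Poly_Mapping.keys p \<subseteq> S"
  shows "lin_ext A u p \<in> carrier A"
  unfolding lin_ext_def using assms by (intro finsum_closed) auto

lemma lin_ext_zero: "lin_ext A u 0 = \<zero>"
  by (simp add: lin_ext_def)

lemma lin_ext_single:
  assumes "u x \<in> carrier A"
  shows "lin_ext A u (Poly_Mapping.single x c) = c \<odot> u x"
  using assms lin_ext_superset[of u "{x}" "{x}" "Poly_Mapping.single x c"] by simp

lemma lin_ext_add:
  assumes u: "u \<in> S \<rightarrow> carrier A" and "Poly_Mapping.keys p \<subseteq> S" "Poly_Mapping.keys q \<subseteq> S"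
  shows "lin_ext A u (p + q) = lin_ext A u p \<oplus> lin_ext A u q"
proof -
  let ?F = "Poly_Mapping.keys p \<union> Poly_Mapping.keys q"
  have uF: "u x \<in> carrier A" if "x \<in> ?F" for x using u assms that by auto
  let ?f = "\<lambda>p x. Poly_Mapping.lookup p x \<odot> u x"
  have f: "?f p \<in> ?F \<rightarrow> carrier A" for p using uF by auto
  have "lin_ext A u (p + q) = finsum A (?f (p + q)) ?F"
    using assms Poly_Mapping.keys_add[of p q] by (intro lin_ext_superset[OF u]) auto
  also have "\<dots> = (\<Oplus>x\<in>?F. ?f p x \<oplus> ?f q x)"
    by (rule add.finprod_cong') (use uF in \<open>auto simp: lookup_add smult_add_left\<close>)
  also have "\<dots> = finsum A (?f p) ?F \<oplus> finsum A (?f q) ?F"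
    by (rule finsum_addf) (rule f)+
  also have "finsum A (?f p) ?F = lin_ext A u p"
    using assms by (intro lin_ext_superset[OF u, symmetric]) auto
  also have "finsum A (?f q) ?F = lin_ext A u q"
    using assms by (intro lin_ext_superset[OF u, symmetric]) auto
  finally show ?thesis .
qed

lemma lin_ext_scale:
  assumes u: "u \<in> S \<rightarrow> carrier A" and p: "Poly_Mapping.keys p \<subseteq> S"
  shows "lin_ext A u (pm_scale k p) = k \<odot> lin_ext A u p"
  using p
proof (induction p rule: pm_induct)
  case zero
  then show ?case by (simp add: lin_ext_zero)
next
  case (single x c)
  with funcset_mem[OF u single] show ?case by (simp add: lin_ext_single smult_smult)
next
  case (add p q)
  have "lin_ext A u (pm_scale k (p + q)) = lin_ext A u (pm_scale k p) \<oplus> lin_ext A u (pm_scale k q)"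
    using add keys_pm_scale[of k p] keys_pm_scale[of k q]
    by (subst pm.scale_right_distrib, subst lin_ext_add[OF u]) auto
  also have "\<dots> = k \<odot> lin_ext A u (p + q)"
    using add by (simp add: lin_ext_add[OF u] smult_add_right lin_ext_closed[OF u])
  finally show ?case .
qed

end

text \<open>The monoid algebra of \<open>S\<close> under \<open>m\<close>, covering both the free
  algebra (words) and the pair algebra (pairs of elements). The product \<open>M\<close> is a
  parameter pinned down by biadditivity and its values on basis vectors, since the two instances
  define it differently, as a convolution and as a double sum.\<close>

locale based_algebra =
  fixes S :: "'x set" and M :: "('x \<Rightarrow>\<^sub>0 'k::field) \<Rightarrow> ('x \<Rightarrow>\<^sub>0 'k) \<Rightarrow> ('x \<Rightarrow>\<^sub>0 'k)"
    and m :: "'x \<Rightarrow> 'x \<Rightarrow> 'x" and e :: 'x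
  assumes M_add_left: "M (p + q) r = M p r + M q r"
    and M_add_right: "M p (q + r) = M p q + M p r"
    and M_single:
      "M (Poly_Mapping.single x c) (Poly_Mapping.single y d) = Poly_Mapping.single (m x y) (c * d)"
    and m_closed: "\<lbrakk>x \<in> S; y \<in> S\<rbrakk> \<Longrightarrow> m x y \<in> S"
    and m_assoc: "\<lbrakk>x \<in> S; y \<in> S; z \<in> S\<rbrakk> \<Longrightarrow> m (m x y) z = m x (m y z)"
    and e_closed: "e \<in> S" and m_e_left: "x \<in> S \<Longrightarrow> m e x = x" and m_e_right: "x \<in> S \<Longrightarrow> m x e = x"
begin

definition alg :: "('k, 'x \<Rightarrow>\<^sub>0 'k) module" where
  "alg = \<lparr>carrier = {p. Poly_Mapping.keys p \<subseteq> S}, monoid.mult = M,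
     monoid.one = Poly_Mapping.single e 1, ring.zero = 0, ring.add = (+), smult = pm_scale\<rparr>"

lemma alg_sel [simp]:
  "carrier alg = {p. Poly_Mapping.keys p \<subseteq> S}" "monoid.mult alg = M"
  "monoid.one alg = Poly_Mapping.single e 1" "ring.zero alg = 0" "ring.add alg = (+)"
  "smult alg = pm_scale"
  by (simp_all add: alg_def)

lemma M_zero [simp]: "M 0 p = 0" "M p 0 = 0"
  using M_add_left[of 0 0 p] M_add_right[of p 0 0] by simp_all

lemma keys_addI:
  "\<lbrakk>Poly_Mapping.keys p \<subseteq> S; Poly_Mapping.keys q \<subseteq> S\<rbrakk> \<Longrightarrow> Poly_Mapping.keys (p + q) \<subseteq> S"
  using Poly_Mapping.keys_add[of p q] by blast

lemma M_closed:
  assumes "Poly_Mapping.keys p \<subseteq> S" "Poly_Mapping.keys q \<subseteq> S"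
  shows "Poly_Mapping.keys (M p q) \<subseteq> S"
  using assms(1)
proof (induction p rule: pm_induct)
  case (single x c)
  show ?case using assms(2)
    by (induction q rule: pm_induct) (simp_all add: M_add_right M_single single m_closed keys_addI)
qed (simp_all add: M_add_left keys_addI)

lemma M_scale:
  "M (pm_scale k p) q = pm_scale k (M p q)" "M p (pm_scale k q) = pm_scale k (M p q)"
proof -
  have *: "M (pm_scale k p) q = pm_scale k (M p q) \<and> M p (pm_scale k q) = pm_scale k (M p q)"
    using subset_UNIV[of "Poly_Mapping.keys p"]
  proof (induction p rule: pm_induct)
    case (single x c)
    show ?case using subset_UNIV[of "Poly_Mapping.keys q"]
      by (induction q rule: pm_induct)
         (simp_all add: M_add_right M_single pm.scale_right_distrib mult.assoc mult.left_commute)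
  qed (simp_all add: M_add_left pm.scale_right_distrib)
  then show "M (pm_scale k p) q = pm_scale k (M p q)" "M p (pm_scale k q) = pm_scale k (M p q)"
    by auto
qed

lemma M_assoc:
  assumes "Poly_Mapping.keys p \<subseteq> S" "Poly_Mapping.keys q \<subseteq> S" "Poly_Mapping.keys r \<subseteq> S"
  shows "M (M p q) r = M p (M q r)"
  using assms(1)
proof (induction p rule: pm_induct)
  case (single x c)
  show ?case using assms(2)
  proof (induction q rule: pm_induct)
    case (single y d)
    show ?case using assms(3)
      by (induction r rule: pm_induct)
         (simp_all add: M_add_right M_single m_assoc single \<open>x \<in> S\<close> mult.assoc)
  qed (simp_all add: M_add_left M_add_right)
qed (simp_all add: M_add_left)

lemma M_one:
  assumes "Poly_Mapping.keys p \<subseteq> S"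
  shows "M (Poly_Mapping.single e 1) p = p" "M p (Poly_Mapping.single e 1) = p"
proof -
  have "M (Poly_Mapping.single e 1) p = p \<and> M p (Poly_Mapping.single e 1) = p"
    using assms by (induction p rule: pm_induct)
      (simp_all add: M_add_left M_add_right M_single m_e_left m_e_right)
  then show "M (Poly_Mapping.single e 1) p = p" "M p (Poly_Mapping.single e 1) = p" by auto
qed

lemma k_algebra_alg: "k_algebra alg"
proof (rule k_algebraI)
  have "abelian_group alg"
  proof (rule abelian_groupI)
    fix p assume "p \<in> carrier alg"
    then show "\<exists>q\<in>carrier alg. q \<oplus>\<^bsub>alg\<^esub> p = \<zero>\<^bsub>alg\<^esub>"
      by (intro bexI[of _ "- p"]) auto
  qed (auto simp: ac_simps intro: keys_addI[THEN subsetD])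
  moreover have "Group.monoid alg"
    by (rule monoidI) (auto simp: M_assoc M_one e_closed dest: M_closed[THEN subsetD])
  ultimately show "ring alg"
    by (rule ringI) (simp_all add: M_add_left M_add_right)
qed (use keys_pm_scale in \<open>fastforce simp: M_scale pm.scale_left_distrib pm.scale_right_distrib\<close>)+

text \<open>The universal property of a monoid algebra: a monoid homomorphism into the
  multiplicative monoid of \<open>D\<close> extends linearly. By bilinearity, multiplicativity has
  to be checked on basis vectors only.\<close>

lemma lin_ext_alg_hom:
  assumes D: "k_algebra D" and u: "u \<in> S \<rightarrow> carrier D"
    and u_m: "\<And>x y. \<lbrakk>x \<in> S; y \<in> S\<rbrakk> \<Longrightarrow> u (m x y) = u x \<otimes>\<^bsub>D\<^esub> u y"
    and u_e: "u e = \<one>\<^bsub>D\<^esub>"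
  shows "lin_ext D u \<in> alg_hom alg D"
proof -
  interpret D: k_algebra D by fact
  note closed = D.lin_ext_closed[OF u] and uS = funcset_mem[OF u]
  have mult: "lin_ext D u (M p q) = lin_ext D u p \<otimes>\<^bsub>D\<^esub> lin_ext D u q"
    if "Poly_Mapping.keys p \<subseteq> S" and q: "Poly_Mapping.keys q \<subseteq> S" for p q
    using that(1)
  proof (induction p rule: pm_induct)
    case zero
    show ?case by (simp add: D.lin_ext_zero closed q)
  next
    case (single x c)
    show ?case using q
    proof (induction q rule: pm_induct)
      case zero
      show ?case using uS[OF single] by (simp add: D.lin_ext_zero D.lin_ext_single)
    next
      case (single y d)
      show ?case using uS[OF \<open>x \<in> S\<close>] uS[OF \<open>y \<in> S\<close>] \<open>x \<in> S\<close> \<open>y \<in> S\<close>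
        by (simp add: M_single D.lin_ext_single m_closed u_m D.smult_mult_left
            D.smult_mult_right D.smult_smult mult.commute[of d c])
    next
      case (add p q)
      have "Poly_Mapping.keys (Poly_Mapping.single x c) \<subseteq> S" using single by simp
      with add show ?case
        by (simp add: M_add_right D.lin_ext_add[OF u] M_closed D.r_distr closed del: keys_single)
    qed
  next
    case (add p p')
    then show ?case
      by (simp add: M_add_left D.lin_ext_add[OF u] M_closed D.l_distr closed q)
  qed
  show ?thesis
    by (rule alg_homI)
       (simp_all add: closed mult D.lin_ext_add[OF u] D.lin_ext_scale[OF u]
          D.lin_ext_single uS e_closed u_e)
qed

end


section \<open>Presented algebras\<close>

interpretation free: based_algebra UNIV
  "(*) :: ('g list \<Rightarrow>\<^sub>0 'k::field) \<Rightarrow> _" "(+)" "0 :: 'g list"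
  by standard (simp_all add: algebra_simps mult_single add.assoc)

lemma free_algebra_eq: "free_algebra = free.alg"
  by (simp add: free_algebra_def free.alg_def)

lemma k_algebra_free: "k_algebra free_algebra"
  unfolding free_algebra_eq by (rule free.k_algebra_alg)

lemma free_algebra_sel [simp]:
  "carrier free_algebra = UNIV" "monoid.mult free_algebra = (*)" "monoid.one free_algebra = 1"
  "ring.zero free_algebra = 0" "ring.add free_algebra = (+)" "smult free_algebra = pm_scale"
  by (simp_all add: free_algebra_def)

lemma free_algebra_minus [simp]: "\<ominus>\<^bsub>free_algebra\<^esub> p = - p"
proof -
  interpret F: k_algebra free_algebra by (rule k_algebra_free)
  show ?thesis by (rule F.minus_equality) simp_all
qed

lemma free_hom:
  assumes D: "k_algebra D" and f: "f \<in> alg_hom free_algebra D"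
  shows "f p \<in> carrier D" "f (p * q) = f p \<otimes>\<^bsub>D\<^esub> f q" "f (p + q) = f p \<oplus>\<^bsub>D\<^esub> f q"
    "f (- p) = \<ominus>\<^bsub>D\<^esub> f p" "f (p - q) = f p \<ominus>\<^bsub>D\<^esub> f q" "f 1 = \<one>\<^bsub>D\<^esub>" "f 0 = \<zero>\<^bsub>D\<^esub>"
proof -
  show neg: "f (- p) = \<ominus>\<^bsub>D\<^esub> f p" for p
    using alg_hom_minus[OF k_algebra_free D f, of p] by simp
  show add: "f (p + q) = f p \<oplus>\<^bsub>D\<^esub> f q" for p q
    using alg_homD(3)[OF f] by simp
  show "f (p - q) = f p \<ominus>\<^bsub>D\<^esub> f q"
    using add[of p "- q"] neg[of q] by (simp add: a_minus_def)
  show "f 0 = \<zero>\<^bsub>D\<^esub>"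
    using alg_hom_zero[OF k_algebra_free D f] by simp
qed (use alg_homD[OF f] in simp_all)

lemma free_algebra_generators:
  fixes B :: "('g list \<Rightarrow>\<^sub>0 'k::field) set"
  assumes "is_subalgebra free_algebra B" "\<And>g. free_gen g \<in> B"
  shows "p \<in> B"
  using subset_UNIV[of "Poly_Mapping.keys p"]
proof (induction p rule: pm_induct)
  case (single w c)
  have "Poly_Mapping.single w 1 \<in> B"
  proof (induction w)
    case Nil
    show ?case using is_subalgebraD(2)[OF assms(1)] single_one
      by (simp add: zero_list_def[symmetric])
  next
    case (Cons g w)
    have "Poly_Mapping.single (g # w) (1::'k) = free_gen g * Poly_Mapping.single w 1"
      by (simp add: free_gen_def mult_single plus_list_def)
    then show ?case using is_subalgebraD(7)[OF assms(1) assms(2)[of g] Cons] by simp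
  qed
  from is_subalgebraD(4)[OF assms(1) this, of c] show ?case by simp
qed (use is_subalgebraD[OF assms(1)] in simp_all)

lemma free_eval:
  fixes v :: "'g \<Rightarrow> 'd"
  assumes D: "k_algebra D" and v: "\<And>g. v g \<in> carrier D"
  obtains f where "f \<in> alg_hom free_algebra D" "\<And>g. f (free_gen g) = v g"
proof -
  interpret D: k_algebra D by fact
  define u where "u w = foldr (\<lambda>g r. v g \<otimes>\<^bsub>D\<^esub> r) w \<one>\<^bsub>D\<^esub>" for w
  have u: "u w \<in> carrier D" for w by (induction w) (simp_all add: u_def v)
  have "u (w + w') = u w \<otimes>\<^bsub>D\<^esub> u w'" for w w'
    unfolding plus_list_def
    by (induction w) (use u in \<open>simp_all add: u_def v D.m_assoc\<close>)
  then have "lin_ext D u \<in> alg_hom free_algebra D"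
    unfolding free_algebra_eq
    by (intro free.lin_ext_alg_hom D) (use u in \<open>auto simp: u_def zero_list_def\<close>)
  moreover have "lin_ext D u (free_gen g) = v g" for g
    unfolding free_gen_def by (subst D.lin_ext_single) (use v in \<open>simp_all add: u_def\<close>)
  ultimately show thesis using that by blast
qed

lemma ideal_presented: "ideal (Idl\<^bsub>free_algebra\<^esub> rels) free_algebra"
  by (rule ring.genideal_ideal) (simp_all add: k_algebra_ring k_algebra_free)

lemma k_algebra_presented: "k_algebra (presented_algebra rels)"
  unfolding presented_algebra_def
  by (rule k_algebra.k_algebra_quotient[OF k_algebra_free ideal_presented])

lemma presented_class_hom: "presented_class rels \<in> alg_hom free_algebra (presented_algebra rels)"
  unfolding presented_algebra_def
  using k_algebra.quotient_class_hom[OF k_algebra_free ideal_presented]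
  by (simp add: presented_class_def[abs_def])

lemmas presented_class_simps = free_hom[OF k_algebra_presented presented_class_hom]

lemma presented_class_surj:
  assumes "z \<in> carrier (presented_algebra rels)"
  obtains p where "z = presented_class rels p"
  using assms unfolding presented_algebra_def
  by (auto simp: k_algebra.quotient_algebra_sel(1)[OF k_algebra_free] presented_class_def)

lemma presented_class_rel:
  assumes "r \<in> rels"
  shows "presented_class rels r = \<zero>\<^bsub>presented_algebra rels\<^esub>"
proof -
  interpret F: k_algebra free_algebra by (rule k_algebra_free)
  have "r \<in> Idl\<^bsub>free_algebra\<^esub> rels"
    using F.genideal_self[of rels] assms by auto
  then show ?thesis
    using F.quotient_eq_iff_same_a_r_cos[OF ideal_presented, of r 0 rels]
    by (simp add: presented_class_def presented_algebra_def a_minus_def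
        F.quotient_zero[OF ideal_presented])
qed

text \<open>The premise on relators ranges over every \<open>f\<close> with the prescribed values
  because the evaluation map is obtained only existentially, from \<open>free_eval\<close>. An
  application then merely computes \<open>f r\<close> from the values on generators.\<close>

lemma presented_lift:
  assumes D: "k_algebra D" and v: "\<And>g. v g \<in> carrier D"
    and rels: "\<And>f r. \<lbrakk>f \<in> alg_hom free_algebra D; \<And>g. f (free_gen g) = v g; r \<in> rels\<rbrakk>
      \<Longrightarrow> f r = \<zero>\<^bsub>D\<^esub>"
  obtains h where "h \<in> alg_hom (presented_algebra rels) D"
    "\<And>g. h (presented_class rels (free_gen g)) = v g"
proof -
  interpret F: k_algebra free_algebra by (rule k_algebra_free)
  interpret D: k_algebra D by fact
  obtain f where f: "f \<in> alg_hom free_algebra D" "\<And>g. f (free_gen g) = v g"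
    using free_eval[where D = D and v = v, OF D v] by blast
  note simps = free_hom[OF D f(1)]
  \<comment> \<open>The kernel is an ideal that contains the relators, hence contains the ideal they
    generate.\<close>
  have "ideal {p. f p = \<zero>\<^bsub>D\<^esub>} free_algebra"
    by (rule idealI[OF F.ring_axioms F.add.subgroupI]) (auto simp: simps intro: exI[of _ 0])
  then have "Idl\<^bsub>free_algebra\<^esub> rels \<subseteq> {p. f p = \<zero>\<^bsub>D\<^esub>}"
    by (rule F.genideal_minimal) (use rels[OF f] in auto)
  then have vanish: "f p = \<zero>\<^bsub>D\<^esub>" if "p \<in> Idl\<^bsub>free_algebra\<^esub> rels" for p
    using that by auto
  obtain h where "h \<in> alg_hom (presented_algebra rels) D"
      "\<And>a. h (presented_class rels a) = f a"
    by (rule F.quotient_lift[OF ideal_presented D f(1) vanish])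
       (auto simp: presented_algebra_def presented_class_def)
  then show thesis using that f(2) by simp
qed

lemma presented_generators:
  assumes B: "is_subalgebra (presented_algebra rels) B"
    and gen: "\<And>g. presented_class rels (free_gen g) \<in> B"
  shows "carrier (presented_algebra rels) \<subseteq> B"
proof
  fix z assume "z \<in> carrier (presented_algebra rels)"
  then obtain p where p: "z = presented_class rels p" by (rule presented_class_surj)
  have "p \<in> {q \<in> carrier free_algebra. presented_class rels q \<in> B}"
    using is_subalgebra_vimage[OF k_algebra_free presented_class_hom B]
    by (rule free_algebra_generators) (simp add: gen)
  then show "z \<in> B" by (simp add: p)
qed


section \<open>Tensor products\<close>

locale tensor_pair = A: k_algebra A + B: k_algebra B
  for A :: "('k::field, 'a) module" and B :: "('k, 'b) module"
begin

abbreviation "T \<equiv> A \<otimes>\<^sub>a B"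
abbreviation "J \<equiv> module.span pm_scale (bilinearity_relators A B)"

text \<open>The elementary tensor, usually written a \<otimes> b.\<close>

definition t :: "'a \<Rightarrow> 'b \<Rightarrow> ('a \<times> 'b \<Rightarrow>\<^sub>0 'k) set" where
  "t a b = J +>\<^bsub>pair_algebra A B\<^esub> Poly_Mapping.single (a, b) 1"

abbreviation "pm \<equiv> monoid.mult (pair_algebra A B)"

lemma pair_mult: "pm p q = (\<Sum>x\<in>Poly_Mapping.keys p. \<Sum>y\<in>Poly_Mapping.keys q.
    Poly_Mapping.single (fst x \<otimes>\<^bsub>A\<^esub> fst y, snd x \<otimes>\<^bsub>B\<^esub> snd y)
      (Poly_Mapping.lookup p x * Poly_Mapping.lookup q y))"
  by (simp add: pair_algebra_def case_prod_unfold)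

sublocale pair: based_algebra "carrier A \<times> carrier B" pm
  "\<lambda>x y. (fst x \<otimes>\<^bsub>A\<^esub> fst y, snd x \<otimes>\<^bsub>B\<^esub> snd y)" "(\<one>\<^bsub>A\<^esub>, \<one>\<^bsub>B\<^esub>)"
proof
  \<comment> \<open>The index set depends on the support of \<open>p + q\<close>, in which terms may
    cancel. Additivity survives because each summand is additive in the coefficient and vanishes at
    coefficient 0.\<close>
  show "pm (p + q) r = pm p r + pm q r" for p q r
    unfolding pair_mult
    by (rule setsum_keys_plus_distrib)
       (simp_all add: distrib_right single_add sum.distrib)
  show "pm p (q + r) = pm p q + pm p r" for p q r
    unfolding pair_mult sum.distrib[symmetric]
    by (intro sum.cong refl setsum_keys_plus_distrib) (simp_all add: distrib_left single_add)
qed (auto simp: pair_mult A.m_assoc B.m_assoc keys_single)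

lemma pair_algebra_eq: "pair_algebra A B = pair.alg"
  by (simp add: pair.alg_def) (simp add: pair_algebra_def)

sublocale P: k_algebra "pair_algebra A B"
  using pair.k_algebra_alg by (simp only: pair_algebra_eq[symmetric])

lemma pair_sel:
  "carrier (pair_algebra A B) = {p. Poly_Mapping.keys p \<subseteq> carrier A \<times> carrier B}"
  "monoid.one (pair_algebra A B) = Poly_Mapping.single (\<one>\<^bsub>A\<^esub>, \<one>\<^bsub>B\<^esub>) 1"
  "ring.zero (pair_algebra A B) = 0" "ring.add (pair_algebra A B) = (+)"
  "smult (pair_algebra A B) = pm_scale"
  by (simp_all add: pair_algebra_def)

text \<open>The negative of a structure is taken inside its carrier, so it agrees with the pointwise
  negative there.\<close>

lemma pair_minus: "p \<in> carrier (pair_algebra A B) \<Longrightarrow> \<ominus>\<^bsub>pair_algebra A B\<^esub> p = - p"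
  using P.smult_minus_1[of p] pm.scale_minus_left[of 1 p]
  by (simp only: pair_sel(5) pm.scale_one)

lemma pair_mult_diff: "pm p (q - r) = pm p q - pm p r" "pm (p - q) r = pm p r - pm q r"
  using pair.M_add_right[of p "q - r" r] pair.M_add_left[of "p - q" q r]
  by (simp_all only: diff_add_cancel eq_diff_eq)

text \<open>The relators with an arbitrary coefficient \<open>c\<close> in place of 1: this is the
  shape in which they appear after multiplication by a basis vector with coefficient.\<close>

lemma relators:
  assumes "a \<in> carrier A" "b \<in> carrier B"
  shows "a' \<in> carrier A \<Longrightarrow> Poly_Mapping.single (a \<oplus>\<^bsub>A\<^esub> a', b) c - Poly_Mapping.single (a, b) c
      - Poly_Mapping.single (a', b) c \<in> J"
    and "b' \<in> carrier B \<Longrightarrow> Poly_Mapping.single (a, b \<oplus>\<^bsub>B\<^esub> b') c - Poly_Mapping.single (a, b) c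
      - Poly_Mapping.single (a, b') c \<in> J"
    and "Poly_Mapping.single (k \<odot>\<^bsub>A\<^esub> a, b) c - Poly_Mapping.single (a, b) (k * c) \<in> J"
    and "Poly_Mapping.single (a, k \<odot>\<^bsub>B\<^esub> b) c - Poly_Mapping.single (a, b) (k * c) \<in> J"
proof -
  have scale: "pm_scale c r \<in> J" if "r \<in> bilinearity_relators A B" for r
    using that by (intro pm.span_scale pm.span_base)
  note [simp] = pm.scale_right_diff_distrib
  show "a' \<in> carrier A \<Longrightarrow> Poly_Mapping.single (a \<oplus>\<^bsub>A\<^esub> a', b) c - Poly_Mapping.single (a, b) c
      - Poly_Mapping.single (a', b) c \<in> J"
    using scale[of "Poly_Mapping.single (a \<oplus>\<^bsub>A\<^esub> a', b) 1 - Poly_Mapping.single (a, b) 1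
      - Poly_Mapping.single (a', b) 1"] assms
    unfolding bilinearity_relators_def Let_def by fastforce
  show "b' \<in> carrier B \<Longrightarrow> Poly_Mapping.single (a, b \<oplus>\<^bsub>B\<^esub> b') c - Poly_Mapping.single (a, b) c
      - Poly_Mapping.single (a, b') c \<in> J"
    using scale[of "Poly_Mapping.single (a, b \<oplus>\<^bsub>B\<^esub> b') 1 - Poly_Mapping.single (a, b) 1
      - Poly_Mapping.single (a, b') 1"] assms
    unfolding bilinearity_relators_def Let_def by fastforce
  have "Poly_Mapping.single (k \<odot>\<^bsub>A\<^esub> a, b) 1 - pm_scale k (Poly_Mapping.single (a, b) 1)
      \<in> bilinearity_relators A B"
    unfolding bilinearity_relators_def Let_def using assms by blast
  from scale[OF this]
  show "Poly_Mapping.single (k \<odot>\<^bsub>A\<^esub> a, b) c - Poly_Mapping.single (a, b) (k * c) \<in> J"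
    by (simp add: mult.commute)
  have "Poly_Mapping.single (a, k \<odot>\<^bsub>B\<^esub> b) 1 - pm_scale k (Poly_Mapping.single (a, b) 1)
      \<in> bilinearity_relators A B"
    unfolding bilinearity_relators_def Let_def using assms by blast
  from scale[OF this]
  show "Poly_Mapping.single (a, k \<odot>\<^bsub>B\<^esub> b) c - Poly_Mapping.single (a, b) (k * c) \<in> J"
    by (simp add: mult.commute)
qed

lemma bilinearity_relators_cases:
  assumes "r \<in> bilinearity_relators A B"
  obtains
    (1) a a' b where "a \<in> carrier A" "a' \<in> carrier A" "b \<in> carrier B"
      "r = Poly_Mapping.single (a \<oplus>\<^bsub>A\<^esub> a', b) 1 - Poly_Mapping.single (a, b) 1
        - Poly_Mapping.single (a', b) 1"
  | (2) a b b' where "a \<in> carrier A" "b \<in> carrier B" "b' \<in> carrier B"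
      "r = Poly_Mapping.single (a, b \<oplus>\<^bsub>B\<^esub> b') 1 - Poly_Mapping.single (a, b) 1
        - Poly_Mapping.single (a, b') 1"
  | (3) k a b where "a \<in> carrier A" "b \<in> carrier B"
      "r = Poly_Mapping.single (k \<odot>\<^bsub>A\<^esub> a, b) 1 - Poly_Mapping.single (a, b) k"
  | (4) k a b where "a \<in> carrier A" "b \<in> carrier B"
      "r = Poly_Mapping.single (a, k \<odot>\<^bsub>B\<^esub> b) 1 - Poly_Mapping.single (a, b) k"
  using assms unfolding bilinearity_relators_def Let_def
  by (auto simp del: single_one)

lemma relators_carrier: "bilinearity_relators A B \<subseteq> carrier (pair_algebra A B)"
proof
  fix r assume "r \<in> bilinearity_relators A B"
  then show "r \<in> carrier (pair_algebra A B)"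
    by (cases rule: bilinearity_relators_cases)
       (auto simp: pair_sel dest!: keys_diff[THEN subsetD] split: if_splits)
qed

lemma J_carrier: "J \<subseteq> carrier (pair_algebra A B)"
proof (rule pm.span_minimal[OF relators_carrier], rule pm.subspaceI)
  show "pm_scale c x \<in> carrier (pair_algebra A B)" if "x \<in> carrier (pair_algebra A B)" for c x
    using P.smult_carrier[OF that] by (simp add: pair_sel)
qed (simp_all add: pair_sel pair.keys_addI)

text \<open>As multiplication in \<open>A\<close> and in \<open>B\<close> is itself bilinear,
  multiplying a relator by a basis vector gives a scalar multiple of a relator of the same
  kind.\<close>

lemma J_single_mult:
  assumes "x \<in> carrier A \<times> carrier B" "r \<in> bilinearity_relators A B"
  shows "pm (Poly_Mapping.single x c) r \<in> J" "pm r (Poly_Mapping.single x c) \<in> J"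
proof -
  obtain a0 b0 where x: "x = (a0, b0)" "a0 \<in> carrier A" "b0 \<in> carrier B"
    using assms(1) by auto
  note simps = x pair_mult_diff pair.M_single A.l_distr A.r_distr B.l_distr B.r_distr
    A.smult_mult_left A.smult_mult_right B.smult_mult_left B.smult_mult_right
  show "pm (Poly_Mapping.single x c) r \<in> J"
    using assms(2)
    by (cases rule: bilinearity_relators_cases)
       (simp_all add: simps relators mult.commute[of c])
  show "pm r (Poly_Mapping.single x c) \<in> J"
    using assms(2)
    by (cases rule: bilinearity_relators_cases) (simp_all add: simps relators)
qed

lemma J_mult:
  assumes "r \<in> J" "p \<in> carrier (pair_algebra A B)"
  shows "pm p r \<in> J \<and> pm r p \<in> J"
  using assms(1)
proof (induction r rule: pm.span_induct_alt)
  case base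
  show ?case by (simp add: pm.span_zero)
next
  case (step c r q)
  have "pm p r \<in> J \<and> pm r p \<in> J"
    using assms(2)[unfolded pair_sel, simplified]
    by (induction p rule: pm_induct)
       (use step J_single_mult in \<open>simp_all add: pm.span_zero pair.M_add_left pair.M_add_right pm.span_add\<close>)
  with step show ?case
    by (simp add: pair.M_add_left pair.M_add_right pair.M_scale pm.span_add pm.span_scale)
qed

lemma ideal_J: "ideal J (pair_algebra A B)"
proof (rule idealI[OF P.ring_axioms P.add.subgroupI])
  show "\<ominus>\<^bsub>pair_algebra A B\<^esub> p \<in> J" if "p \<in> J" for p
    using that J_carrier by (auto simp: pair_minus pm.span_neg)
  show "p \<oplus>\<^bsub>pair_algebra A B\<^esub> q \<in> J" if "p \<in> J" "q \<in> J" for p q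
    using that by (simp add: pair_sel pm.span_add)
qed (use J_carrier J_mult pm.span_zero in blast)+

sublocale T: k_algebra T
  unfolding tensor_algebra_def by (rule P.k_algebra_quotient[OF ideal_J])

lemma class_hom: "(+>\<^bsub>pair_algebra A B\<^esub>) J \<in> alg_hom (pair_algebra A B) T"
  unfolding tensor_algebra_def by (rule P.quotient_class_hom[OF ideal_J])

lemma single_carrier:
  "\<lbrakk>a \<in> carrier A; b \<in> carrier B\<rbrakk> \<Longrightarrow> Poly_Mapping.single (a, b) c \<in> carrier (pair_algebra A B)"
  by (simp add: pair_sel)

lemma t_closed [simp, intro]: "\<lbrakk>a \<in> carrier A; b \<in> carrier B\<rbrakk> \<Longrightarrow> t a b \<in> carrier T"
  unfolding t_def by (rule alg_homD(1)[OF class_hom single_carrier])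

lemma class_eqI:
  assumes "p \<in> carrier (pair_algebra A B)" "q \<in> carrier (pair_algebra A B)" "p - q \<in> J"
  shows "J +>\<^bsub>pair_algebra A B\<^esub> p = J +>\<^bsub>pair_algebra A B\<^esub> q"
  using P.quotient_eq_iff_same_a_r_cos[OF ideal_J assms(1,2)] assms
  by (simp add: a_minus_def pair_minus pair_sel(4))

lemma t_mult:
  assumes "a \<in> carrier A" "b \<in> carrier B" "a' \<in> carrier A" "b' \<in> carrier B"
  shows "t a b \<otimes>\<^bsub>T\<^esub> t a' b' = t (a \<otimes>\<^bsub>A\<^esub> a') (b \<otimes>\<^bsub>B\<^esub> b')"
  using assms by (simp add: t_def alg_homD(2)[OF class_hom, symmetric] single_carrier pair.M_single)

lemma t_one: "t \<one>\<^bsub>A\<^esub> \<one>\<^bsub>B\<^esub> = \<one>\<^bsub>T\<^esub>"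
  using alg_homD(4)[OF class_hom] by (simp add: t_def pair_sel)

lemma t_smult:
  assumes "a \<in> carrier A" "b \<in> carrier B"
  shows "k \<odot>\<^bsub>T\<^esub> t a b = J +>\<^bsub>pair_algebra A B\<^esub> Poly_Mapping.single (a, b) k"
    and "t (k \<odot>\<^bsub>A\<^esub> a) b = k \<odot>\<^bsub>T\<^esub> t a b" "t a (k \<odot>\<^bsub>B\<^esub> b) = k \<odot>\<^bsub>T\<^esub> t a b"
proof -
  show *: "k \<odot>\<^bsub>T\<^esub> t a b = J +>\<^bsub>pair_algebra A B\<^esub> Poly_Mapping.single (a, b) k"
    using assms by (simp add: t_def alg_homD(5)[OF class_hom, symmetric] single_carrier pair_sel(5))
  show "t (k \<odot>\<^bsub>A\<^esub> a) b = k \<odot>\<^bsub>T\<^esub> t a b" "t a (k \<odot>\<^bsub>B\<^esub> b) = k \<odot>\<^bsub>T\<^esub> t a b"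
    unfolding * unfolding t_def using assms relators(3,4)[OF assms, of k 1]
    by (intro class_eqI; simp add: single_carrier)+
qed

lemma t_add_left:
  assumes "a \<in> carrier A" "a' \<in> carrier A" "b \<in> carrier B"
  shows "t (a \<oplus>\<^bsub>A\<^esub> a') b = t a b \<oplus>\<^bsub>T\<^esub> t a' b"
proof -
  have "t a b \<oplus>\<^bsub>T\<^esub> t a' b = J +>\<^bsub>pair_algebra A B\<^esub>
      (Poly_Mapping.single (a, b) 1 + Poly_Mapping.single (a', b) 1)"
    using assms alg_homD(3)[OF class_hom, of "Poly_Mapping.single (a, b) 1" "Poly_Mapping.single (a', b) 1"]
    by (simp add: t_def single_carrier pair_sel(4))
  also have "\<dots> = t (a \<oplus>\<^bsub>A\<^esub> a') b"
    unfolding t_def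
  proof (rule class_eqI[symmetric])
    show "Poly_Mapping.single (a, b) 1 + Poly_Mapping.single (a', b) 1 \<in> carrier (pair_algebra A B)"
      using assms P.a_closed[OF single_carrier[of a b 1] single_carrier[of a' b 1]]
      by (simp add: pair_sel(4))
  qed (use assms relators(1)[of a b a' 1] in \<open>simp_all add: single_carrier algebra_simps\<close>)
  finally show ?thesis ..
qed

lemma t_add_right:
  assumes "a \<in> carrier A" "b \<in> carrier B" "b' \<in> carrier B"
  shows "t a (b \<oplus>\<^bsub>B\<^esub> b') = t a b \<oplus>\<^bsub>T\<^esub> t a b'"
proof -
  have "t a b \<oplus>\<^bsub>T\<^esub> t a b' = J +>\<^bsub>pair_algebra A B\<^esub>
      (Poly_Mapping.single (a, b) 1 + Poly_Mapping.single (a, b') 1)"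
    using assms alg_homD(3)[OF class_hom, of "Poly_Mapping.single (a, b) 1" "Poly_Mapping.single (a, b') 1"]
    by (simp add: t_def single_carrier pair_sel(4))
  also have "\<dots> = t a (b \<oplus>\<^bsub>B\<^esub> b')"
    unfolding t_def
  proof (rule class_eqI[symmetric])
    show "Poly_Mapping.single (a, b) 1 + Poly_Mapping.single (a, b') 1 \<in> carrier (pair_algebra A B)"
      using assms P.a_closed[OF single_carrier[of a b 1] single_carrier[of a b' 1]]
      by (simp add: pair_sel(4))
  qed (use assms relators(2)[of a b b' 1] in \<open>simp_all add: single_carrier algebra_simps\<close>)
  finally show ?thesis ..
qed

lemma t_zero: "a \<in> carrier A \<Longrightarrow> t a \<zero>\<^bsub>B\<^esub> = \<zero>\<^bsub>T\<^esub>"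
  using t_smult(3)[of a "\<zero>\<^bsub>B\<^esub>" 0] by simp

lemma left_hom: "(\<lambda>a. t a \<one>\<^bsub>B\<^esub>) \<in> alg_hom A T"
  by (rule alg_homI) (simp_all add: t_mult t_add_left t_smult(2) t_one)

lemma right_hom: "t \<one>\<^bsub>A\<^esub> \<in> alg_hom B T"
  by (rule alg_homI) (simp_all add: t_mult t_add_right t_smult(3) t_one)

lemma t_generates:
  assumes S: "is_subalgebra T S"
    and gen: "\<And>a b. \<lbrakk>a \<in> carrier A; b \<in> carrier B\<rbrakk> \<Longrightarrow> t a b \<in> S"
  shows "carrier T \<subseteq> S"
proof
  fix z assume "z \<in> carrier T"
  then obtain p where p: "p \<in> carrier (pair_algebra A B)" "z = J +>\<^bsub>pair_algebra A B\<^esub> p"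
    unfolding tensor_algebra_def by (auto simp: P.quotient_algebra_sel(1))
  have "J +>\<^bsub>pair_algebra A B\<^esub> p \<in> S"
    using p(1)[unfolded pair_sel, simplified]
  proof (induction p rule: pm_induct)
    case zero
    show ?case
      using is_subalgebraD(3)[OF S] alg_hom_zero[OF P.k_algebra_axioms T.k_algebra_axioms class_hom]
      by (simp add: pair_sel)
  next
    case (single x c)
    then obtain a b where "x = (a, b)" "a \<in> carrier A" "b \<in> carrier B" by auto
    then show ?case using is_subalgebraD(4)[OF S gen[of a b], of c] by (simp add: t_smult(1))
  next
    case (add p q)
    then show ?case
      using alg_homD(3)[OF class_hom, of p q] is_subalgebraD(6)[OF S] by (simp add: pair_sel)
  qed
  then show "z \<in> S" by (simp add: p)
qed

lemma hom_eqI: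
  assumes "k_algebra D" "f \<in> alg_hom T D" "g \<in> alg_hom T D"
    and "\<And>a b. \<lbrakk>a \<in> carrier A; b \<in> carrier B\<rbrakk> \<Longrightarrow> f (t a b) = g (t a b)"
    and "z \<in> carrier T"
  shows "f z = g z"
  using t_generates[OF is_subalgebra_equalizer[OF T.k_algebra_axioms assms(1-3)]] assms(4,5)
  by auto

text \<open>The universal property of the tensor product among algebras. Commuting images are
  required because the product of a \<otimes> b and a' \<otimes> b' moves a' past b.\<close>

lemma lift:
  assumes D: "k_algebra D" and f: "f \<in> alg_hom A D" and g: "g \<in> alg_hom B D"
    and comm: "\<And>a b. \<lbrakk>a \<in> carrier A; b \<in> carrier B\<rbrakk> \<Longrightarrow> f a \<otimes>\<^bsub>D\<^esub> g b = g b \<otimes>\<^bsub>D\<^esub> f a"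
  obtains h where "h \<in> alg_hom T D"
    "\<And>a b. \<lbrakk>a \<in> carrier A; b \<in> carrier B\<rbrakk> \<Longrightarrow> h (t a b) = f a \<otimes>\<^bsub>D\<^esub> g b"
proof -
  interpret D: k_algebra D by fact
  note fD = alg_homD[OF f] and gD = alg_homD[OF g]
  define u where "u x = f (fst x) \<otimes>\<^bsub>D\<^esub> g (snd x)" for x
  have u: "u \<in> carrier A \<times> carrier B \<rightarrow> carrier D"
    by (auto simp: u_def fD(1) gD(1))
  have "lin_ext D u \<in> alg_hom pair.alg D"
  proof (rule pair.lin_ext_alg_hom[OF D u])
    fix x y assume xy: "x \<in> carrier A \<times> carrier B" "y \<in> carrier A \<times> carrier B"
    then obtain a b a' b' where eq: "x = (a, b)" "y = (a', b')"
      and in_AB: "a \<in> carrier A" "b \<in> carrier B" "a' \<in> carrier A" "b' \<in> carrier B" by auto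
    \<comment> \<open>Interchange of the two middle factors, by \<open>comm\<close>.\<close>
    have "(f a \<otimes>\<^bsub>D\<^esub> f a') \<otimes>\<^bsub>D\<^esub> (g b \<otimes>\<^bsub>D\<^esub> g b') = f a \<otimes>\<^bsub>D\<^esub> (f a' \<otimes>\<^bsub>D\<^esub> g b) \<otimes>\<^bsub>D\<^esub> g b'"
      using in_AB by (simp add: fD(1) gD(1) D.m_assoc)
    also have "\<dots> = (f a \<otimes>\<^bsub>D\<^esub> g b) \<otimes>\<^bsub>D\<^esub> (f a' \<otimes>\<^bsub>D\<^esub> g b')"
      using in_AB by (simp only: comm[of a' b]) (simp add: fD(1) gD(1) D.m_assoc)
    finally show "u (fst x \<otimes>\<^bsub>A\<^esub> fst y, snd x \<otimes>\<^bsub>B\<^esub> snd y) = u x \<otimes>\<^bsub>D\<^esub> u y"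
      using in_AB by (simp add: eq u_def fD(2) gD(2))
  qed (simp add: u_def fD(4) gD(4))
  then have L: "lin_ext D u \<in> alg_hom (pair_algebra A B) D"
    by (simp only: pair_algebra_eq[symmetric])
  have vanish: "lin_ext D u x = \<zero>\<^bsub>D\<^esub>" if "x \<in> J" for x
  proof -
    have L_diff: "lin_ext D u (p - q) = lin_ext D u p \<ominus>\<^bsub>D\<^esub> lin_ext D u q"
      if "p \<in> carrier (pair_algebra A B)" "q \<in> carrier (pair_algebra A B)" for p q
      using alg_hom_minus_diff[OF P.k_algebra_axioms D L that]
      by (simp add: a_minus_def pair_minus[OF that(2)] pair_sel(4))
    have diff_carrier: "p - q \<in> carrier (pair_algebra A B)"
      if "p \<in> carrier (pair_algebra A B)" "q \<in> carrier (pair_algebra A B)" for p q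
      using P.minus_closed[OF that] by (simp add: a_minus_def pair_minus[OF that(2)] pair_sel(4))
    have cancel: "(p \<oplus>\<^bsub>D\<^esub> q) \<ominus>\<^bsub>D\<^esub> p \<ominus>\<^bsub>D\<^esub> q = \<zero>\<^bsub>D\<^esub>" if "p \<in> carrier D" "q \<in> carrier D" for p q
      using that D.r_neg[of "p \<oplus>\<^bsub>D\<^esub> q"] by (simp add: a_minus_def D.minus_add D.a_assoc)
    have rel: "lin_ext D u r = \<zero>\<^bsub>D\<^esub>" if "r \<in> bilinearity_relators A B" for r
      using that
      by (cases rule: bilinearity_relators_cases)
         (simp_all add: L_diff diff_carrier single_carrier D.lin_ext_single u_def fD gD
            D.l_distr D.r_distr D.smult_mult_left D.smult_mult_right cancel D.r_right_minus_eq)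
    \<comment> \<open>The kernel is a subspace, so vanishing on the relators gives vanishing on
      their span.\<close>
    have "J \<subseteq> {p \<in> carrier (pair_algebra A B). lin_ext D u p = \<zero>\<^bsub>D\<^esub>}"
    proof (rule pm.span_minimal, use rel relators_carrier in blast, rule pm.subspaceI)
      fix c p assume "p \<in> {p \<in> carrier (pair_algebra A B). lin_ext D u p = \<zero>\<^bsub>D\<^esub>}"
      then show "pm_scale c p \<in> {p \<in> carrier (pair_algebra A B). lin_ext D u p = \<zero>\<^bsub>D\<^esub>}"
        using alg_homD(5)[OF L, of p c] P.smult_carrier[of p c] by (simp add: pair_sel)
    next
      fix p q assume "p \<in> {p \<in> carrier (pair_algebra A B). lin_ext D u p = \<zero>\<^bsub>D\<^esub>}"
        "q \<in> {p \<in> carrier (pair_algebra A B). lin_ext D u p = \<zero>\<^bsub>D\<^esub>}"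
      then show "p + q \<in> {p \<in> carrier (pair_algebra A B). lin_ext D u p = \<zero>\<^bsub>D\<^esub>}"
        using alg_homD(3)[OF L, of p q] P.a_closed[of p q] by (simp add: pair_sel)
    qed (simp add: pair_sel D.lin_ext_zero)
    then show ?thesis using that by blast
  qed
  obtain h where h: "h \<in> alg_hom T D"
    "\<And>p. p \<in> carrier (pair_algebra A B) \<Longrightarrow> h (J +>\<^bsub>pair_algebra A B\<^esub> p) = lin_ext D u p"
    using P.quotient_lift[OF ideal_J D L vanish] unfolding tensor_algebra_def by blast
  have "h (t a b) = f a \<otimes>\<^bsub>D\<^esub> g b" if "a \<in> carrier A" "b \<in> carrier B" for a b
    using that by (simp add: t_def h(2) single_carrier D.lin_ext_single u_def fD gD)
  with h(1) show thesis by (rule that)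
qed

end

section \<open>Functoriality of the tensor product in its second factor\<close>

context tensor_pair
begin

lemma tensor_iso_right:
  assumes "B \<cong>\<^sub>a B'" and B': "k_algebra B'"
  shows "A \<otimes>\<^sub>a B \<cong>\<^sub>a A \<otimes>\<^sub>a B'"
proof -
  interpret T': tensor_pair A B'
    by (intro tensor_pair.intro A.k_algebra_axioms B')
  obtain f g where f: "f \<in> alg_hom B B'" and g: "g \<in> alg_hom B' B"
    and gf: "\<And>x. x \<in> carrier B \<Longrightarrow> g (f x) = x" and fg: "\<And>y. y \<in> carrier B' \<Longrightarrow> f (g y) = y"
    by (rule alg_isoE[OF assms(1) B.k_algebra_axioms]) blast
  obtain F where F: "F \<in> alg_hom T T'.T"
    and Ft: "\<And>a b. \<lbrakk>a \<in> carrier A; b \<in> carrier B\<rbrakk> \<Longrightarrow>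
      F (t a b) = T'.t a \<one>\<^bsub>B'\<^esub> \<otimes>\<^bsub>T'.T\<^esub> T'.t \<one>\<^bsub>A\<^esub> (f b)"
    by (rule lift[OF T'.T.k_algebra_axioms T'.left_hom alg_hom_comp[OF f T'.right_hom]])
       (auto simp: T'.t_mult alg_homD(1)[OF f])
  obtain G where G: "G \<in> alg_hom T'.T T"
    and Gt: "\<And>a b. \<lbrakk>a \<in> carrier A; b \<in> carrier B'\<rbrakk> \<Longrightarrow>
      G (T'.t a b) = t a \<one>\<^bsub>B\<^esub> \<otimes>\<^bsub>T\<^esub> t \<one>\<^bsub>A\<^esub> (g b)"
    by (rule T'.lift[OF T.k_algebra_axioms left_hom alg_hom_comp[OF g right_hom]])
       (auto simp: t_mult alg_homD(1)[OF g])
  show ?thesis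
  proof (rule alg_isoI[OF F G])
    show "G (F z) = z" if "z \<in> carrier T" for z
      by (rule hom_eqI[OF T.k_algebra_axioms alg_hom_comp[OF F G] alg_hom_id _ that])
         (simp add: Ft Gt t_mult T'.t_mult alg_homD(1)[OF f] gf)
    show "F (G z) = z" if "z \<in> carrier T'.T" for z
      by (rule T'.hom_eqI[OF T'.T.k_algebra_axioms alg_hom_comp[OF G F] alg_hom_id _ that])
         (simp add: Ft Gt t_mult T'.t_mult alg_homD(1)[OF g] fg)
  qed
qed

end


section \<open>Matrix algebras\<close>

definition diag2 :: "('k::field, 'a) module \<Rightarrow> 'a \<Rightarrow> 'a^2^2" where
  "diag2 A x = (\<chi> i j. if i = j then x else \<zero>\<^bsub>A\<^esub>)"

definition unit2 :: "('k::field, 'a) module \<Rightarrow> 2 \<Rightarrow> 2 \<Rightarrow> 'a^2^2" where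
  "unit2 A k l = (\<chi> i j. if i = k \<and> j = l then \<one>\<^bsub>A\<^esub> else \<zero>\<^bsub>A\<^esub>)"

context k_algebra
begin

lemma M2_sel:
  "M \<in> carrier (M2 A) \<longleftrightarrow> (\<forall>i j. M $ i $ j \<in> carrier A)"
  "(M \<oplus>\<^bsub>M2 A\<^esub> N) $ i $ j = M $ i $ j \<oplus> N $ i $ j"
  "\<one>\<^bsub>M2 A\<^esub> $ i $ j = (if i = j then \<one> else \<zero>)"
  "\<zero>\<^bsub>M2 A\<^esub> $ i $ j = \<zero>"
  "(k \<odot>\<^bsub>M2 A\<^esub> M) $ i $ j = k \<odot> M $ i $ j"
  by (simp_all add: M2_def)

lemma M2_mult:
  assumes "M \<in> carrier (M2 A)" "N \<in> carrier (M2 A)"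
  shows "(M \<otimes>\<^bsub>M2 A\<^esub> N) $ i $ j = M $ i $ 1 \<otimes> N $ 1 $ j \<oplus> M $ i $ 2 \<otimes> N $ 2 $ j"
  using assms by (simp add: M2_def UNIV_2)

lemma M2_mult_closed:
  "\<lbrakk>M \<in> carrier (M2 A); N \<in> carrier (M2 A)\<rbrakk> \<Longrightarrow> M \<otimes>\<^bsub>M2 A\<^esub> N \<in> carrier (M2 A)"
  by (subst M2_sel) (simp add: M2_mult, simp add: M2_sel)

lemma k_algebra_M2: "k_algebra (M2 A)"
proof (rule k_algebraI)
  have "abelian_group (M2 A)"
  proof (rule abelian_groupI)
    fix M assume "M \<in> carrier (M2 A)"
    then show "\<exists>N\<in>carrier (M2 A). N \<oplus>\<^bsub>M2 A\<^esub> M = \<zero>\<^bsub>M2 A\<^esub>"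
      by (intro bexI[of _ "\<chi> i j. \<ominus> (M $ i $ j)"]) (auto simp: vec_eq_iff M2_sel l_neg)
  qed (auto simp: vec_eq_iff M2_sel a_ac)
  moreover have "Group.monoid (M2 A)"
  proof (rule monoidI)
    show "\<one>\<^bsub>M2 A\<^esub> \<in> carrier (M2 A)" by (simp add: M2_sel)
    show "M \<otimes>\<^bsub>M2 A\<^esub> N \<otimes>\<^bsub>M2 A\<^esub> P = M \<otimes>\<^bsub>M2 A\<^esub> (N \<otimes>\<^bsub>M2 A\<^esub> P)"
      if "M \<in> carrier (M2 A)" "N \<in> carrier (M2 A)" "P \<in> carrier (M2 A)" for M N P
      using that unfolding vec_eq_iff
      by (simp add: M2_mult M2_mult_closed)
         (simp add: M2_sel l_distr r_distr m_assoc a_ac)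
    show "\<one>\<^bsub>M2 A\<^esub> \<otimes>\<^bsub>M2 A\<^esub> M = M" "M \<otimes>\<^bsub>M2 A\<^esub> \<one>\<^bsub>M2 A\<^esub> = M" if "M \<in> carrier (M2 A)" for M
    proof -
      have "\<one>\<^bsub>M2 A\<^esub> \<in> carrier (M2 A)" by (simp add: M2_sel)
      with that show "\<one>\<^bsub>M2 A\<^esub> \<otimes>\<^bsub>M2 A\<^esub> M = M" "M \<otimes>\<^bsub>M2 A\<^esub> \<one>\<^bsub>M2 A\<^esub> = M"
        unfolding vec_eq_iff forall_2 by (simp_all add: M2_mult) (simp_all add: M2_sel)
    qed
  qed (simp add: M2_mult_closed)
  ultimately show "ring (M2 A)"
  proof (rule ringI)
    fix M N P assume MNP: "M \<in> carrier (M2 A)" "N \<in> carrier (M2 A)" "P \<in> carrier (M2 A)"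
    then have "M \<oplus>\<^bsub>M2 A\<^esub> N \<in> carrier (M2 A)" by (simp add: M2_sel)
    with MNP show "(M \<oplus>\<^bsub>M2 A\<^esub> N) \<otimes>\<^bsub>M2 A\<^esub> P = M \<otimes>\<^bsub>M2 A\<^esub> P \<oplus>\<^bsub>M2 A\<^esub> N \<otimes>\<^bsub>M2 A\<^esub> P"
      "P \<otimes>\<^bsub>M2 A\<^esub> (M \<oplus>\<^bsub>M2 A\<^esub> N) = P \<otimes>\<^bsub>M2 A\<^esub> M \<oplus>\<^bsub>M2 A\<^esub> P \<otimes>\<^bsub>M2 A\<^esub> N"
      unfolding vec_eq_iff
      by (simp_all add: M2_mult M2_sel(2)) (simp_all add: M2_sel l_distr r_distr a_ac)
  qed
next
  fix k M N assume MN: "M \<in> carrier (M2 A)" "N \<in> carrier (M2 A)"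
  then have "k \<odot>\<^bsub>M2 A\<^esub> M \<in> carrier (M2 A)" "k \<odot>\<^bsub>M2 A\<^esub> N \<in> carrier (M2 A)"
    by (simp_all add: M2_sel)
  with MN show "(k \<odot>\<^bsub>M2 A\<^esub> M) \<otimes>\<^bsub>M2 A\<^esub> N = k \<odot>\<^bsub>M2 A\<^esub> (M \<otimes>\<^bsub>M2 A\<^esub> N)"
    "M \<otimes>\<^bsub>M2 A\<^esub> (k \<odot>\<^bsub>M2 A\<^esub> N) = k \<odot>\<^bsub>M2 A\<^esub> (M \<otimes>\<^bsub>M2 A\<^esub> N)"
    unfolding vec_eq_iff
    by (simp_all add: M2_mult M2_sel(5))
       (simp_all add: M2_sel smult_mult_left smult_mult_right smult_add_right)
qed (auto simp: vec_eq_iff M2_sel smult_add_left smult_add_right smult_smult)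

lemma diag2_hom: "diag2 A \<in> alg_hom A (M2 A)"
proof (rule alg_homI)
  show diag: "diag2 A x \<in> carrier (M2 A)" if "x \<in> carrier A" for x
    using that by (simp add: M2_sel diag2_def)
  show "diag2 A (x \<otimes> y) = diag2 A x \<otimes>\<^bsub>M2 A\<^esub> diag2 A y" if "x \<in> carrier A" "y \<in> carrier A" for x y
    using that diag[of x] diag[of y] unfolding vec_eq_iff forall_2
    by (simp add: M2_mult) (simp add: diag2_def)
qed (auto simp: vec_eq_iff M2_sel diag2_def)

lemma unit2_closed [simp]: "unit2 A k l \<in> carrier (M2 A)"
  by (simp add: M2_sel unit2_def)

lemma unit2_mult:
  "unit2 A i j \<otimes>\<^bsub>M2 A\<^esub> unit2 A k l = (if j = k then unit2 A i l else \<zero>\<^bsub>M2 A\<^esub>)"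
  using exhaust_2[of j] exhaust_2[of k]
  by (auto simp: vec_eq_iff M2_mult) (auto simp: unit2_def M2_sel)

lemma unit2_sum: "unit2 A 1 1 \<oplus>\<^bsub>M2 A\<^esub> unit2 A 2 2 = \<one>\<^bsub>M2 A\<^esub>"
  unfolding vec_eq_iff forall_2 by (simp add: unit2_def M2_sel)

lemma diag2_unit2:
  assumes "x \<in> carrier A"
  shows "(diag2 A x \<otimes>\<^bsub>M2 A\<^esub> unit2 A k l) $ i $ j = (if i = k \<and> j = l then x else \<zero>)"
    and "diag2 A x \<otimes>\<^bsub>M2 A\<^esub> unit2 A k l = unit2 A k l \<otimes>\<^bsub>M2 A\<^esub> diag2 A x"
proof -
  note d = alg_homD(1)[OF diag2_hom assms]
  show "(diag2 A x \<otimes>\<^bsub>M2 A\<^esub> unit2 A k l) $ i $ j = (if i = k \<and> j = l then x else \<zero>)"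
    using assms d exhaust_2[of i] exhaust_2[of k]
    by (auto simp: M2_mult) (auto simp: diag2_def unit2_def)
  have "(unit2 A k l \<otimes>\<^bsub>M2 A\<^esub> diag2 A x) $ i $ j = (if i = k \<and> j = l then x else \<zero>)" for i j
    using assms d exhaust_2[of j] exhaust_2[of l]
    by (auto simp: M2_mult) (auto simp: diag2_def unit2_def)
  moreover have "(diag2 A x \<otimes>\<^bsub>M2 A\<^esub> unit2 A k l) $ i $ j = (if i = k \<and> j = l then x else \<zero>)" for i j
    using assms d exhaust_2[of i] exhaust_2[of k]
    by (auto simp: M2_mult) (auto simp: diag2_def unit2_def)
  ultimately show "diag2 A x \<otimes>\<^bsub>M2 A\<^esub> unit2 A k l = unit2 A k l \<otimes>\<^bsub>M2 A\<^esub> diag2 A x"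
    by (simp add: vec_eq_iff)
qed

end

lemma M2_map_hom:
  assumes A: "k_algebra A" and B: "k_algebra B" and f: "f \<in> alg_hom A B"
  shows "(\<lambda>M. \<chi> i j. f (M $ i $ j)) \<in> alg_hom (M2 A) (M2 B)"
proof -
  interpret A: k_algebra A by fact
  interpret B: k_algebra B by fact
  have closed: "(\<chi> i j. f (M $ i $ j)) \<in> carrier (M2 B)" if "M \<in> carrier (M2 A)" for M
    using that by (simp add: A.M2_sel B.M2_sel alg_homD(1)[OF f])
  show ?thesis
  proof (rule alg_homI)
    fix M N assume MN: "M \<in> carrier (M2 A)" "N \<in> carrier (M2 A)"
    then show "(\<chi> i j. f ((M \<otimes>\<^bsub>M2 A\<^esub> N) $ i $ j)) =
        (\<chi> i j. f (M $ i $ j)) \<otimes>\<^bsub>M2 B\<^esub> (\<chi> i j. f (N $ i $ j))"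
      unfolding vec_eq_iff
      by (simp add: A.M2_mult B.M2_mult closed) (simp add: A.M2_sel alg_homD[OF f])
  qed (auto simp: closed vec_eq_iff A.M2_sel B.M2_sel alg_homD[OF f] alg_hom_zero[OF A B f])
qed

text \<open>The criterion for being a matrix algebra: matrix units in \<open>D\<close> that commute
  with the image of \<open>W\<close>. It is applied to the standard units of \<open>M2 A\<close>, to
  the elements 1 \<otimes> \<open>unit2 B i j\<close> of a tensor product, and to the units found in
  the localized super Jordan plane.\<close>

locale matrix_units = W: k_algebra W + D: k_algebra D
  for W :: "('k::field, 'a) module" and D :: "('k, 'd) module" +
  fixes \<phi> :: "'a \<Rightarrow> 'd" and e :: "2 \<Rightarrow> 2 \<Rightarrow> 'd"
  assumes \<phi>: "\<phi> \<in> alg_hom W D" and e_closed [simp, intro]: "e i j \<in> carrier D"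
    and e_mult: "e i j \<otimes>\<^bsub>D\<^esub> e k l = (if j = k then e i l else \<zero>\<^bsub>D\<^esub>)"
    and e_sum: "e 1 1 \<oplus>\<^bsub>D\<^esub> e 2 2 = \<one>\<^bsub>D\<^esub>"
    and \<phi>_e: "w \<in> carrier W \<Longrightarrow> \<phi> w \<otimes>\<^bsub>D\<^esub> e i j = e i j \<otimes>\<^bsub>D\<^esub> \<phi> w"
begin

definition \<Theta> :: "'a^2^2 \<Rightarrow> 'd" where
  "\<Theta> m = (\<phi> (m $ 1 $ 1) \<otimes>\<^bsub>D\<^esub> e 1 1 \<oplus>\<^bsub>D\<^esub> \<phi> (m $ 1 $ 2) \<otimes>\<^bsub>D\<^esub> e 1 2) \<oplus>\<^bsub>D\<^esub>
    (\<phi> (m $ 2 $ 1) \<otimes>\<^bsub>D\<^esub> e 2 1 \<oplus>\<^bsub>D\<^esub> \<phi> (m $ 2 $ 2) \<otimes>\<^bsub>D\<^esub> e 2 2)"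

lemma \<phi>_closed [simp]: "w \<in> carrier W \<Longrightarrow> \<phi> w \<in> carrier D"
  by (rule alg_homD(1)[OF \<phi>])

lemma term_mult:
  assumes "a \<in> carrier W" "b \<in> carrier W"
  shows "(\<phi> a \<otimes>\<^bsub>D\<^esub> e i j) \<otimes>\<^bsub>D\<^esub> (\<phi> b \<otimes>\<^bsub>D\<^esub> e k l) =
    (if j = k then (\<phi> a \<otimes>\<^bsub>D\<^esub> \<phi> b) \<otimes>\<^bsub>D\<^esub> e i l else \<zero>\<^bsub>D\<^esub>)"
proof -
  have "(\<phi> a \<otimes>\<^bsub>D\<^esub> e i j) \<otimes>\<^bsub>D\<^esub> (\<phi> b \<otimes>\<^bsub>D\<^esub> e k l) = \<phi> a \<otimes>\<^bsub>D\<^esub> (e i j \<otimes>\<^bsub>D\<^esub> \<phi> b) \<otimes>\<^bsub>D\<^esub> e k l"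
    using assms by (simp add: D.m_assoc)
  also have "\<dots> = (\<phi> a \<otimes>\<^bsub>D\<^esub> \<phi> b) \<otimes>\<^bsub>D\<^esub> (e i j \<otimes>\<^bsub>D\<^esub> e k l)"
    using assms by (simp add: \<phi>_e[symmetric] D.m_assoc)
  finally show ?thesis using assms by (simp add: e_mult)
qed

lemma \<Theta>_hom: "\<Theta> \<in> alg_hom (M2 W) D"
proof (rule alg_homI)
  fix m assume m: "m \<in> carrier (M2 W)"
  then show "\<Theta> m \<in> carrier D" by (simp add: \<Theta>_def W.M2_sel)
  show "\<Theta> (k \<odot>\<^bsub>M2 W\<^esub> m) = k \<odot>\<^bsub>D\<^esub> \<Theta> m" for k
    using m by (simp add: \<Theta>_def W.M2_sel alg_homD(5)[OF \<phi>] D.smult_add_right D.smult_mult_left)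
  fix n assume n: "n \<in> carrier (M2 W)"
  show "\<Theta> (m \<oplus>\<^bsub>M2 W\<^esub> n) = \<Theta> m \<oplus>\<^bsub>D\<^esub> \<Theta> n"
    using m n by (simp add: \<Theta>_def W.M2_sel alg_homD(3)[OF \<phi>] D.l_distr D.a_ac)
  have "\<Theta> m \<otimes>\<^bsub>D\<^esub> \<Theta> n = \<Theta> (m \<otimes>\<^bsub>M2 W\<^esub> n)"
    using m n by (simp add: \<Theta>_def W.M2_mult)
      (simp add: W.M2_sel D.l_distr D.r_distr term_mult alg_homD(2,3)[OF \<phi>] D.a_ac)
  then show "\<Theta> (m \<otimes>\<^bsub>M2 W\<^esub> n) = \<Theta> m \<otimes>\<^bsub>D\<^esub> \<Theta> n" ..
next
  show "\<Theta> \<one>\<^bsub>M2 W\<^esub> = \<one>\<^bsub>D\<^esub>"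
    by (simp add: \<Theta>_def W.M2_sel alg_homD(4)[OF \<phi>] e_sum
        alg_hom_zero[OF W.k_algebra_axioms D.k_algebra_axioms \<phi>])
qed

text \<open>The classical recovery of coefficients: the product of \<open>e k i\<close>,
  \<open>\<Theta> m\<close> and \<open>e j k\<close> isolates the (i, j) entry times
  \<open>e k k\<close>, and summing over \<open>k\<close> removes the idempotent. Hence
  \<open>\<Theta>\<close> is injective as soon as \<open>\<phi>\<close> is.\<close>

lemma \<Theta>_coeff:
  assumes "m \<in> carrier (M2 W)"
  shows "e 1 i \<otimes>\<^bsub>D\<^esub> \<Theta> m \<otimes>\<^bsub>D\<^esub> e j 1 \<oplus>\<^bsub>D\<^esub> e 2 i \<otimes>\<^bsub>D\<^esub> \<Theta> m \<otimes>\<^bsub>D\<^esub> e j 2 = \<phi> (m $ i $ j)"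
proof -
  have m: "m $ i $ j \<in> carrier W" for i j using assms by (simp add: W.M2_sel)
  have coeff: "e k i \<otimes>\<^bsub>D\<^esub> (\<phi> w \<otimes>\<^bsub>D\<^esub> e i' j') \<otimes>\<^bsub>D\<^esub> e j k =
      (if i = i' \<and> j' = j then \<phi> w \<otimes>\<^bsub>D\<^esub> e k k else \<zero>\<^bsub>D\<^esub>)" if w: "w \<in> carrier W" for k w i' j'
  proof -
    have "e k i \<otimes>\<^bsub>D\<^esub> (\<phi> w \<otimes>\<^bsub>D\<^esub> e i' j') \<otimes>\<^bsub>D\<^esub> e j k = (e k i \<otimes>\<^bsub>D\<^esub> \<phi> w) \<otimes>\<^bsub>D\<^esub> (e i' j' \<otimes>\<^bsub>D\<^esub> e j k)"
      using w by (simp add: D.m_assoc)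
    also have "\<dots> = \<phi> w \<otimes>\<^bsub>D\<^esub> (e k i \<otimes>\<^bsub>D\<^esub> (e i' j' \<otimes>\<^bsub>D\<^esub> e j k))"
      using w by (simp add: \<phi>_e[symmetric] D.m_assoc)
    finally show ?thesis using w by (auto simp: e_mult)
  qed
  have "e k i \<otimes>\<^bsub>D\<^esub> \<Theta> m \<otimes>\<^bsub>D\<^esub> e j k = \<phi> (m $ i $ j) \<otimes>\<^bsub>D\<^esub> e k k" for k
    using m exhaust_2[of i] exhaust_2[of j]
    by (auto simp: \<Theta>_def D.l_distr D.r_distr coeff)
  then show ?thesis
    using m by (simp add: D.r_distr[symmetric] e_sum)
qed

text \<open>Injectivity is \<open>\<Theta>_coeff\<close>. For surjectivity, the image is a
  subalgebra containing the values of \<open>\<phi>\<close>, reached from scalar matrices, and every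
  \<open>e i j\<close>.\<close>

lemma \<Theta>_iso:
  assumes inj: "inj_on \<phi> (carrier W)"
    and gen: "\<And>S. \<lbrakk>is_subalgebra D S; \<phi> ` carrier W \<subseteq> S; \<And>i j. e i j \<in> S\<rbrakk> \<Longrightarrow> carrier D \<subseteq> S"
  shows "M2 W \<cong>\<^sub>a D"
  unfolding alg_iso_def
proof (intro bexI[OF _ \<Theta>_hom] bij_betw_imageI)
  have "m = n" if "m \<in> carrier (M2 W)" "n \<in> carrier (M2 W)" "\<Theta> m = \<Theta> n" for m n
  proof -
    have "\<phi> (m $ i $ j) = \<phi> (n $ i $ j)" for i j
      using \<Theta>_coeff[OF that(1), of i j] \<Theta>_coeff[OF that(2), of i j] that(3) by simp
    then show ?thesis
      using that(1,2) inj by (auto simp: vec_eq_iff W.M2_sel inj_on_def)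
  qed
  then show "inj_on \<Theta> (carrier (M2 W))" by (auto intro!: inj_onI)
  note \<phi>_zero = alg_hom_zero[OF W.k_algebra_axioms D.k_algebra_axioms \<phi>]
  have diag: "\<Theta> (diag2 W w) = \<phi> w" if "w \<in> carrier W" for w
    using that by (simp add: \<Theta>_def diag2_def \<phi>_zero D.r_distr[symmetric] e_sum)
  have unit: "\<Theta> (unit2 W i j) = e i j" for i j
    using exhaust_2[of i] exhaust_2[of j]
    by (auto simp: \<Theta>_def unit2_def \<phi>_zero alg_homD(4)[OF \<phi>])
  have "carrier D \<subseteq> \<Theta> ` carrier (M2 W)"
  proof (rule gen)
    show "is_subalgebra D (\<Theta> ` carrier (M2 W))"
      by (rule is_subalgebra_image[OF W.k_algebra_M2 D.k_algebra_axioms \<Theta>_hom])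
    show "\<phi> ` carrier W \<subseteq> \<Theta> ` carrier (M2 W)"
      using alg_homD(1)[OF W.diag2_hom] by (force simp: diag[symmetric])
    show "e i j \<in> \<Theta> ` carrier (M2 W)" for i j
      using W.unit2_closed by (force simp: unit[symmetric])
  qed
  then show "\<Theta> ` carrier (M2 W) = carrier D"
    using alg_homD(1)[OF \<Theta>_hom] by blast
qed

end

lemma (in k_algebra) matrix_units_M2: "matrix_units A (M2 A) (diag2 A) (unit2 A)"
  by (intro matrix_units.intro matrix_units_axioms.intro k_algebra_axioms k_algebra_M2 diag2_hom
      unit2_closed unit2_mult unit2_sum diag2_unit2(2))

text \<open>For the standard units \<open>\<Theta>\<close> is the identity: a matrix is the sum of
  its entries, as scalar matrices, times the units. It serves to evaluate composites with other maps
  \<open>\<Theta>\<close>.\<close>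

lemma (in k_algebra) M2_decomp:
  assumes "m \<in> carrier (M2 A)"
  shows "matrix_units.\<Theta> (M2 A) (diag2 A) (unit2 A) m = m"
  using assms unfolding vec_eq_iff forall_2
  by (simp add: matrix_units.\<Theta>_def[OF matrix_units_M2] M2_sel(1)) (simp add: M2_sel(2) diag2_unit2(1))

section \<open>Matrices over a tensor product\<close>

context tensor_pair
begin

text \<open>The map \<open>h\<close> sends a \<otimes> M to the matrix with entries a \<otimes>
  M_ij. Its inverse is \<open>\<Theta>\<close> for the matrix units 1 \<otimes> E_ij, where
  \<open>\<phi>\<close> sends a \<otimes> b to a tensored with the scalar matrix of b.\<close>

lemma tensor_M2: "A \<otimes>\<^sub>a M2 B \<cong>\<^sub>a M2 (A \<otimes>\<^sub>a B)"
proof -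
  interpret MT: k_algebra "M2 T" by (rule T.k_algebra_M2)
  interpret T': tensor_pair A "M2 B"
    by (intro tensor_pair.intro A.k_algebra_axioms B.k_algebra_M2)
  let ?map = "\<lambda>M. \<chi> i j. t \<one>\<^bsub>A\<^esub> (M $ i $ j)"
  have comm: "diag2 T (t a \<one>\<^bsub>B\<^esub>) \<otimes>\<^bsub>M2 T\<^esub> ?map M = (\<chi> i j. t a (M $ i $ j))"
    "?map M \<otimes>\<^bsub>M2 T\<^esub> diag2 T (t a \<one>\<^bsub>B\<^esub>) = (\<chi> i j. t a (M $ i $ j))"
    if "a \<in> carrier A" "M \<in> carrier (M2 B)" for a M
  proof -
    have M: "M $ i $ j \<in> carrier B" for i j using that by (simp add: B.M2_sel)
    have c: "diag2 T (t a \<one>\<^bsub>B\<^esub>) \<in> carrier (M2 T)" "?map M \<in> carrier (M2 T)"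
      using that(1) M by (simp_all add: alg_homD(1)[OF T.diag2_hom]) (simp add: T.M2_sel)
    show "diag2 T (t a \<one>\<^bsub>B\<^esub>) \<otimes>\<^bsub>M2 T\<^esub> ?map M = (\<chi> i j. t a (M $ i $ j))"
      "?map M \<otimes>\<^bsub>M2 T\<^esub> diag2 T (t a \<one>\<^bsub>B\<^esub>) = (\<chi> i j. t a (M $ i $ j))"
      unfolding vec_eq_iff forall_2
      using that M by (simp_all add: T.M2_mult[OF c] T.M2_mult[OF c(2,1)])
        (simp_all add: diag2_def t_mult)
  qed
  obtain h where h: "h \<in> alg_hom T'.T (M2 T)"
    and ht: "\<And>a M. \<lbrakk>a \<in> carrier A; M \<in> carrier (M2 B)\<rbrakk> \<Longrightarrow>
      h (T'.t a M) = diag2 T (t a \<one>\<^bsub>B\<^esub>) \<otimes>\<^bsub>M2 T\<^esub> ?map M"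
    by (rule T'.lift[OF MT.k_algebra_axioms alg_hom_comp[OF left_hom T.diag2_hom]
        M2_map_hom[OF B.k_algebra_axioms T.k_algebra_axioms right_hom]])
       (simp_all add: comm)
  note dB = alg_homD(1)[OF B.diag2_hom]
  obtain \<phi> where \<phi>: "\<phi> \<in> alg_hom T T'.T"
    and \<phi>t: "\<And>a b. \<lbrakk>a \<in> carrier A; b \<in> carrier B\<rbrakk> \<Longrightarrow>
      \<phi> (t a b) = T'.t a \<one>\<^bsub>M2 B\<^esub> \<otimes>\<^bsub>T'.T\<^esub> T'.t \<one>\<^bsub>A\<^esub> (diag2 B b)"
    by (rule lift[OF T'.T.k_algebra_axioms T'.left_hom alg_hom_comp[OF B.diag2_hom T'.right_hom]])
       (auto simp: T'.t_mult dB)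
  have \<phi>t: "\<phi> (t a b) = T'.t a (diag2 B b)" if "a \<in> carrier A" "b \<in> carrier B" for a b
    using that by (simp add: \<phi>t T'.t_mult dB)
  interpret E: matrix_units B "M2 B" "diag2 B" "unit2 B" by (rule B.matrix_units_M2)
  interpret ET: matrix_units T "M2 T" "diag2 T" "unit2 T" by (rule T.matrix_units_M2)
  interpret U: matrix_units T T'.T \<phi> "\<lambda>i j. T'.t \<one>\<^bsub>A\<^esub> (unit2 B i j)"
  proof (unfold_locales, rule \<phi>)
    fix i j k l :: 2
    show "T'.t \<one>\<^bsub>A\<^esub> (unit2 B i j) \<in> carrier T'.T" by simp
    show "T'.t \<one>\<^bsub>A\<^esub> (unit2 B i j) \<otimes>\<^bsub>T'.T\<^esub> T'.t \<one>\<^bsub>A\<^esub> (unit2 B k l) =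
        (if j = k then T'.t \<one>\<^bsub>A\<^esub> (unit2 B i l) else \<zero>\<^bsub>T'.T\<^esub>)"
      using alg_hom_zero[OF T'.B.k_algebra_axioms T'.T.k_algebra_axioms T'.right_hom]
      by (simp add: T'.t_mult B.unit2_mult)
    show "T'.t \<one>\<^bsub>A\<^esub> (unit2 B 1 1) \<oplus>\<^bsub>T'.T\<^esub> T'.t \<one>\<^bsub>A\<^esub> (unit2 B 2 2) = \<one>\<^bsub>T'.T\<^esub>"
      by (simp add: T'.t_add_right[symmetric] B.unit2_sum T'.t_one)
    \<comment> \<open>The elements whose image commutes with a given unit form a subalgebra, so
      elementary tensors suffice.\<close>
    have "carrier T \<subseteq> {z \<in> carrier T. \<phi> z \<in> centralizer T'.T {T'.t \<one>\<^bsub>A\<^esub> (unit2 B i j)}}"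
      by (rule t_generates[OF is_subalgebra_vimage[OF T.k_algebra_axioms \<phi>
            T'.T.is_subalgebra_centralizer]])
         (auto simp: centralizer_def \<phi>t T'.t_mult dB B.diag2_unit2(2))
    then show "\<phi> w \<otimes>\<^bsub>T'.T\<^esub> T'.t \<one>\<^bsub>A\<^esub> (unit2 B i j) = T'.t \<one>\<^bsub>A\<^esub> (unit2 B i j) \<otimes>\<^bsub>T'.T\<^esub> \<phi> w"
      if "w \<in> carrier T" for w
      using that by (auto simp: centralizer_def)
  qed
  \<comment> \<open>\<open>h\<close> carries \<open>\<phi>\<close> and the units 1 \<otimes> E_ij to
    scalar matrices and standard units, so \<open>h\<close> after \<open>U.\<Theta>\<close> is the
    decomposition \<open>M2_decomp\<close> over \<open>T\<close>.\<close>
  have h\<phi>: "h (\<phi> z) = diag2 T z" if "z \<in> carrier T" for z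
  proof (rule hom_eqI[OF MT.k_algebra_axioms alg_hom_comp[OF \<phi> h] T.diag2_hom _ that])
    fix a b assume "a \<in> carrier A" "b \<in> carrier B"
    then show "h (\<phi> (t a b)) = diag2 T (t a b)"
      using alg_hom_zero[OF B.k_algebra_axioms T.k_algebra_axioms]
      by (simp add: \<phi>t ht dB comm) (simp add: vec_eq_iff diag2_def t_zero)
  qed
  have he: "h (T'.t \<one>\<^bsub>A\<^esub> (unit2 B i j)) = unit2 T i j" for i j
    by (simp add: ht comm) (simp add: vec_eq_iff unit2_def t_zero t_one)
  show ?thesis
  proof (rule alg_isoI[OF h U.\<Theta>_hom])
    fix m assume m: "m \<in> carrier (M2 T)"
    then have "h (U.\<Theta> m) = ET.\<Theta> m"
      unfolding U.\<Theta>_def ET.\<Theta>_def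
      by (simp add: alg_homD(2,3)[OF h] T.M2_sel h\<phi> he)
    then show "h (U.\<Theta> m) = m" using T.M2_decomp[OF m] by simp
  next
    fix z assume z: "z \<in> carrier T'.T"
    show "U.\<Theta> (h z) = z"
    proof (rule T'.hom_eqI[OF T'.T.k_algebra_axioms alg_hom_comp[OF h U.\<Theta>_hom] alg_hom_id _ z])
      fix a M assume a: "a \<in> carrier A" and M: "M \<in> carrier (M2 B)"
      then have M': "M $ i $ j \<in> carrier B" for i j by (simp add: B.M2_sel)
      \<comment> \<open>The other composite collects the terms a \<otimes> (scalar matrix of M_ij)
        E_ij back into a \<otimes> M, by the decomposition over \<open>B\<close>.\<close>
      have "U.\<Theta> (h (T'.t a M)) = T'.t a (E.\<Theta> M)"
        using a M M' by (simp add: ht comm)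
          (simp add: U.\<Theta>_def E.\<Theta>_def \<phi>t T'.t_mult dB T'.t_add_right)
      then show "U.\<Theta> (h (T'.t a M)) = T'.t a M" using B.M2_decomp[OF M] by simp
    qed
  qed
qed

end


section \<open>Localization at the powers of an element\<close>

locale localization = R: k_algebra R + L: k_algebra L
  for R :: "('k::field, 'a) module" and s :: 'a and L :: "('k, 'b) module" and \<iota> :: "'a \<Rightarrow> 'b" +
  assumes s_closed [simp]: "s \<in> carrier R"
    and loc: "is_localization R (powers R s) L \<iota>"
begin

lemma \<iota>: "\<iota> \<in> alg_hom R L"
  and \<iota>_pow_Units: "\<iota> (s [^]\<^bsub>R\<^esub> (n::nat)) \<in> Units L"
  using loc by (auto simp: is_localization_def powers_def)

lemma \<iota>_closed [simp]: "r \<in> carrier R \<Longrightarrow> \<iota> r \<in> carrier L"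
  by (rule alg_homD(1)[OF \<iota>])

lemma \<iota>_s_Units: "\<iota> s \<in> Units L"
  using \<iota>_pow_Units[of 1] by simp

lemma fraction:
  assumes "z \<in> carrier L"
  obtains n :: nat and r where "r \<in> carrier R" "\<iota> (s [^]\<^bsub>R\<^esub> n) \<otimes>\<^bsub>L\<^esub> z = \<iota> r"
proof -
  obtain n :: nat and r where r: "r \<in> carrier R" "z = inv\<^bsub>L\<^esub> (\<iota> (s [^]\<^bsub>R\<^esub> n)) \<otimes>\<^bsub>L\<^esub> \<iota> r"
    using loc assms unfolding is_localization_def powers_def by blast
  then have "\<iota> (s [^]\<^bsub>R\<^esub> n) \<otimes>\<^bsub>L\<^esub> z = \<iota> r"
    using \<iota>_pow_Units[of n] by (simp add: L.m_assoc[symmetric])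
  with r(1) show thesis by (rule that)
qed

text \<open>Every element is a fraction whose denominator is a power of \<open>s\<close>, and the
  inverse of such a power is a power of the inverse of \<open>\<iota> s\<close>.\<close>

lemma generators:
  assumes S: "is_subalgebra L S" and "\<iota> ` carrier R \<subseteq> S" "inv\<^bsub>L\<^esub> (\<iota> s) \<in> S"
  shows "carrier L \<subseteq> S"
proof
  fix z assume z: "z \<in> carrier L"
  have inv_pow: "inv\<^bsub>L\<^esub> (\<iota> (s [^]\<^bsub>R\<^esub> n)) \<in> S" for n :: nat
  proof (induction n)
    case 0
    show ?case using is_subalgebraD(2)[OF S] by (simp add: alg_homD(4)[OF \<iota>])
  next
    case (Suc n)
    have u: "\<iota> (s [^]\<^bsub>R\<^esub> n) \<in> Units L" "\<iota> s \<in> Units L"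
      by (rule \<iota>_pow_Units, rule \<iota>_s_Units)
    let ?u = "\<iota> (s [^]\<^bsub>R\<^esub> n)" and ?v = "\<iota> s"
    have "(inv\<^bsub>L\<^esub> ?v \<otimes>\<^bsub>L\<^esub> inv\<^bsub>L\<^esub> ?u) \<otimes>\<^bsub>L\<^esub> (?u \<otimes>\<^bsub>L\<^esub> ?v) = inv\<^bsub>L\<^esub> ?v \<otimes>\<^bsub>L\<^esub> (inv\<^bsub>L\<^esub> ?u \<otimes>\<^bsub>L\<^esub> ?u) \<otimes>\<^bsub>L\<^esub> ?v"
      "(?u \<otimes>\<^bsub>L\<^esub> ?v) \<otimes>\<^bsub>L\<^esub> (inv\<^bsub>L\<^esub> ?v \<otimes>\<^bsub>L\<^esub> inv\<^bsub>L\<^esub> ?u) = ?u \<otimes>\<^bsub>L\<^esub> (?v \<otimes>\<^bsub>L\<^esub> inv\<^bsub>L\<^esub> ?v) \<otimes>\<^bsub>L\<^esub> inv\<^bsub>L\<^esub> ?u"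
      using u L.Units_inv_closed by (simp_all add: L.m_assoc L.Units_closed del: L.Units_l_inv L.Units_r_inv)
    then have "inv\<^bsub>L\<^esub> (?u \<otimes>\<^bsub>L\<^esub> ?v) = inv\<^bsub>L\<^esub> ?v \<otimes>\<^bsub>L\<^esub> inv\<^bsub>L\<^esub> ?u"
      using u by (intro L.inv_char) (simp_all add: L.Units_closed)
    then have "inv\<^bsub>L\<^esub> (\<iota> (s [^]\<^bsub>R\<^esub> Suc n)) = inv\<^bsub>L\<^esub> ?v \<otimes>\<^bsub>L\<^esub> inv\<^bsub>L\<^esub> ?u"
      by (simp add: alg_homD(2)[OF \<iota>])
    then show ?case using Suc assms(3) is_subalgebraD(7)[OF S] by simp
  qed
  obtain n :: nat and r where r: "r \<in> carrier R" "\<iota> (s [^]\<^bsub>R\<^esub> n) \<otimes>\<^bsub>L\<^esub> z = \<iota> r"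
    using fraction[OF z] by blast
  then have "z = inv\<^bsub>L\<^esub> (\<iota> (s [^]\<^bsub>R\<^esub> n)) \<otimes>\<^bsub>L\<^esub> \<iota> r"
    using z \<iota>_pow_Units[of n] by (simp add: r(2)[symmetric] L.m_assoc[symmetric] L.Units_closed)
  then show "z \<in> S"
    using inv_pow[of n] r(1) assms(2) is_subalgebraD(7)[OF S] by auto
qed

text \<open>Homomorphisms preserve inverses of units, so agreement on the image of \<open>R\<close>
  already settles the inverse of \<open>\<iota> s\<close>.\<close>

lemma hom_eqI:
  assumes D: "k_algebra D" and f: "f \<in> alg_hom L D" and g: "g \<in> alg_hom L D"
    and eq: "\<And>r. r \<in> carrier R \<Longrightarrow> f (\<iota> r) = g (\<iota> r)" and z: "z \<in> carrier L"
  shows "f z = g z"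
proof -
  note inv = alg_hom_Units(2)[OF L.k_algebra_axioms D _ \<iota>_s_Units]
  have "carrier L \<subseteq> {z \<in> carrier L. f z = g z}"
    by (rule generators[OF is_subalgebra_equalizer[OF L.k_algebra_axioms D f g]])
       (use \<iota>_s_Units in \<open>auto simp: eq inv[OF f] inv[OF g]\<close>)
  then show ?thesis using z by blast
qed

text \<open>The universal property of localization. The extension must send s^(-n) r to the inverse
  of \<open>\<phi>\<close> of s^n times \<open>\<phi> r\<close>; the work lies in showing that this
  is independent of the fraction and multiplicative.\<close>

lemma lift:
  assumes D: "k_algebra D" and \<phi>: "\<phi> \<in> alg_hom R D" and unit: "\<phi> s \<in> Units D"
  obtains h where "h \<in> alg_hom L D" "\<And>r. r \<in> carrier R \<Longrightarrow> h (\<iota> r) = \<phi> r"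
proof -
  interpret D: k_algebra D by fact
  note \<iota>D = alg_homD[OF \<iota>] and \<phi>D = alg_homD[OF \<phi>]
  let ?s = "\<lambda>n::nat. s [^]\<^bsub>R\<^esub> n"
  have s_add: "?s (m + n) = ?s m \<otimes>\<^bsub>R\<^esub> ?s n" for m n
    by (simp add: R.nat_pow_mult)
  have s_comm: "?s m \<otimes>\<^bsub>R\<^esub> ?s n = ?s n \<otimes>\<^bsub>R\<^esub> ?s m" for m n
    by (simp add: R.nat_pow_mult add.commute)
  have \<phi>_Units: "\<phi> (?s n) \<in> Units D" for n
    by (induction n) (use unit in \<open>simp_all add: \<phi>D D.Units_m_closed\<close>)
  have cancel: "w = w'"
    if "\<phi> (?s n) \<otimes>\<^bsub>D\<^esub> w = \<phi> (?s n) \<otimes>\<^bsub>D\<^esub> w'" "w \<in> carrier D" "w' \<in> carrier D" for n w w'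
    using that D.Units_l_cancel[OF \<phi>_Units] by simp
  \<comment> \<open>The kernel of \<open>\<iota>\<close> consists of elements killed by a power of
    \<open>s\<close>, and \<open>\<phi>\<close> turns that power into a unit; so
    \<open>\<phi>\<close> factors through the image of \<open>\<iota>\<close>.\<close>
  have key: "\<phi> r = \<phi> r'" if r: "r \<in> carrier R" "r' \<in> carrier R" "\<iota> r = \<iota> r'" for r r'
  proof -
    have "\<iota> (r \<ominus>\<^bsub>R\<^esub> r') = \<zero>\<^bsub>L\<^esub>"
      using r by (simp add: alg_hom_minus_diff[OF R.k_algebra_axioms L.k_algebra_axioms \<iota>]
          L.r_right_minus_eq)
    then obtain n where "?s n \<otimes>\<^bsub>R\<^esub> (r \<ominus>\<^bsub>R\<^esub> r') = \<zero>\<^bsub>R\<^esub>"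
      using loc r R.minus_closed unfolding is_localization_def powers_def by blast
    then have "\<phi> (?s n) \<otimes>\<^bsub>D\<^esub> (\<phi> r \<ominus>\<^bsub>D\<^esub> \<phi> r') = \<phi> (?s n) \<otimes>\<^bsub>D\<^esub> \<zero>\<^bsub>D\<^esub>"
      using r by (simp add: \<phi>D alg_hom_zero[OF R.k_algebra_axioms D \<phi>]
          alg_hom_minus_diff[OF R.k_algebra_axioms D \<phi>, symmetric] \<phi>D(2)[symmetric] R.minus_closed)
    then have "\<phi> r \<ominus>\<^bsub>D\<^esub> \<phi> r' = \<zero>\<^bsub>D\<^esub>"
      by (rule cancel) (use r in \<open>simp_all add: \<phi>D D.minus_closed\<close>)
    then show ?thesis using r by (simp add: \<phi>D D.r_right_minus_eq)
  qed
  \<comment> \<open>The graph of the extension: one power of \<open>s\<close> carries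
    \<open>z\<close> and \<open>w\<close> to the images of the same element of \<open>R\<close>.
    Working with a relation avoids choosing fractions.\<close>
  define G where "G z w \<longleftrightarrow> z \<in> carrier L \<and> w \<in> carrier D \<and>
      (\<exists>n. \<exists>r\<in>carrier R. \<iota> (?s n) \<otimes>\<^bsub>L\<^esub> z = \<iota> r \<and> \<phi> (?s n) \<otimes>\<^bsub>D\<^esub> w = \<phi> r)" for z w
  \<comment> \<open>Any left multiplier \<open>q\<close> taking \<open>z\<close> into the image of
    \<open>R\<close> gives the corresponding equation for \<open>w\<close>. With \<open>q\<close> a
    power of \<open>s\<close> this yields uniqueness; a general \<open>q\<close> is needed for
    products.\<close>
  have transfer: "\<phi> q \<otimes>\<^bsub>D\<^esub> w = \<phi> r"
    if G: "G z w" and q: "q \<in> carrier R" and r: "r \<in> carrier R" and eq: "\<iota> q \<otimes>\<^bsub>L\<^esub> z = \<iota> r" for q z w r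
  proof -
    obtain m r' where m: "z \<in> carrier L" "w \<in> carrier D" "r' \<in> carrier R"
      "\<iota> (?s m) \<otimes>\<^bsub>L\<^esub> z = \<iota> r'" "\<phi> (?s m) \<otimes>\<^bsub>D\<^esub> w = \<phi> r'"
      using G unfolding G_def by blast
    have u: "\<iota> (?s m) \<in> Units L" "inv\<^bsub>L\<^esub> (\<iota> (?s m)) \<in> carrier L"
      using \<iota>_pow_Units by auto
    \<comment> \<open>The left Ore condition, read off from q s^(-m) being again a left fraction
      s^(-l) q': in \<open>L\<close> this gives s^l q = q' s^m.\<close>
    obtain l q' where q': "q' \<in> carrier R"
      and l: "\<iota> (?s l) \<otimes>\<^bsub>L\<^esub> (\<iota> q \<otimes>\<^bsub>L\<^esub> inv\<^bsub>L\<^esub> (\<iota> (?s m))) = \<iota> q'"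
      using fraction[OF L.m_closed[OF \<iota>_closed[OF q] u(2)]] by blast
    have "\<iota> (?s l \<otimes>\<^bsub>R\<^esub> q) = \<iota> (q' \<otimes>\<^bsub>R\<^esub> ?s m)"
      using q q' u by (simp add: \<iota>D l[symmetric] L.m_assoc)
    then have 1: "\<phi> (?s l \<otimes>\<^bsub>R\<^esub> q) = \<phi> (q' \<otimes>\<^bsub>R\<^esub> ?s m)"
      using q q' by (intro key) auto
    have "\<iota> (?s l \<otimes>\<^bsub>R\<^esub> r) = \<iota> (?s l \<otimes>\<^bsub>R\<^esub> q) \<otimes>\<^bsub>L\<^esub> z"
      using q r m(1) by (simp add: \<iota>D eq[symmetric] L.m_assoc)
    also have "\<dots> = \<iota> q' \<otimes>\<^bsub>L\<^esub> (\<iota> (?s m) \<otimes>\<^bsub>L\<^esub> z)"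
      using \<open>\<iota> (?s l \<otimes>\<^bsub>R\<^esub> q) = \<iota> (q' \<otimes>\<^bsub>R\<^esub> ?s m)\<close> q' m(1) by (simp add: \<iota>D L.m_assoc)
    also have "\<dots> = \<iota> (q' \<otimes>\<^bsub>R\<^esub> r')"
      using q' m by (simp add: \<iota>D)
    finally have 2: "\<phi> (?s l \<otimes>\<^bsub>R\<^esub> r) = \<phi> (q' \<otimes>\<^bsub>R\<^esub> r')"
      using q' m(3) r by (intro key) auto
    have "\<phi> (?s l) \<otimes>\<^bsub>D\<^esub> (\<phi> q \<otimes>\<^bsub>D\<^esub> w) = \<phi> (?s l \<otimes>\<^bsub>R\<^esub> q) \<otimes>\<^bsub>D\<^esub> w"
      using q m(2) by (simp add: \<phi>D D.m_assoc)
    also have "\<dots> = \<phi> q' \<otimes>\<^bsub>D\<^esub> (\<phi> (?s m) \<otimes>\<^bsub>D\<^esub> w)"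
      unfolding 1 using q' m(2) by (simp add: \<phi>D D.m_assoc)
    also have "\<dots> = \<phi> (?s l) \<otimes>\<^bsub>D\<^esub> \<phi> r"
      using 2 q' m r by (simp add: \<phi>D)
    finally show ?thesis
      by (rule cancel) (use q r m(2) in \<open>simp_all add: \<phi>D\<close>)
  qed
  have G_ex: "\<exists>w. G z w" if z: "z \<in> carrier L" for z
  proof -
    obtain n :: nat and r where r: "r \<in> carrier R" "\<iota> (?s n) \<otimes>\<^bsub>L\<^esub> z = \<iota> r"
      using fraction[OF z] by blast
    have "\<phi> (?s n) \<otimes>\<^bsub>D\<^esub> (inv\<^bsub>D\<^esub> (\<phi> (?s n)) \<otimes>\<^bsub>D\<^esub> \<phi> r) = \<phi> r"
      using \<phi>_Units[of n] r(1) by (simp add: D.m_assoc[symmetric] \<phi>D)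
    then show ?thesis
      using r z \<phi>_Units[of n] unfolding G_def by (metis D.Units_inv_closed D.m_closed \<phi>D(1))
  qed
  have G_unique: "w = w'" if G: "G z w" and G': "G z w'" for z w w'
  proof -
    obtain n r where "r \<in> carrier R" "\<iota> (?s n) \<otimes>\<^bsub>L\<^esub> z = \<iota> r" "\<phi> (?s n) \<otimes>\<^bsub>D\<^esub> w = \<phi> r"
      using G unfolding G_def by blast
    with transfer[OF G', of "?s n" r] show ?thesis
      using G G' unfolding G_def by (intro cancel[of n w w']) auto
  qed
  define h where "h z = (THE w. G z w)" for z
  have Gh: "G z (h z)" if "z \<in> carrier L" for z
    unfolding h_def using G_ex[OF that] G_unique by (metis theI)
  have hG: "h z = w" if "G z w" for z w
    using Gh[of z] G_unique that unfolding G_def by blast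
  have h_closed: "h z \<in> carrier D" if "z \<in> carrier L" for z
    using Gh[OF that] by (simp add: G_def)
  have h_\<iota>: "h (\<iota> r) = \<phi> r" if "r \<in> carrier R" for r
    using that by (intro hG) (auto simp: G_def \<phi>D \<iota>D intro!: exI[of _ 0] bexI[of _ r])
  have "h \<in> alg_hom L D"
  proof (rule alg_homI)
    show "h \<one>\<^bsub>L\<^esub> = \<one>\<^bsub>D\<^esub>"
      using h_\<iota>[of "\<one>\<^bsub>R\<^esub>"] by (simp add: \<iota>D \<phi>D)
  next
    fix z z' assume z: "z \<in> carrier L" and z': "z' \<in> carrier L"
    obtain n r where n: "r \<in> carrier R" "\<iota> (?s n) \<otimes>\<^bsub>L\<^esub> z = \<iota> r" "\<phi> (?s n) \<otimes>\<^bsub>D\<^esub> h z = \<phi> r"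
      using Gh[OF z] unfolding G_def by blast
    obtain m r' where m: "r' \<in> carrier R" "\<iota> (?s m) \<otimes>\<^bsub>L\<^esub> z' = \<iota> r'" "\<phi> (?s m) \<otimes>\<^bsub>D\<^esub> h z' = \<phi> r'"
      using Gh[OF z'] unfolding G_def by blast
    \<comment> \<open>A common denominator: powers of \<open>s\<close> commute, so the product of
      the two clears both \<open>z\<close> and \<open>z'\<close>.\<close>
    let ?q = "?s n \<otimes>\<^bsub>R\<^esub> ?s m" and ?r = "?s m \<otimes>\<^bsub>R\<^esub> r \<oplus>\<^bsub>R\<^esub> ?s n \<otimes>\<^bsub>R\<^esub> r'"
    have "\<iota> ?q \<otimes>\<^bsub>L\<^esub> (z \<oplus>\<^bsub>L\<^esub> z') = \<iota> (?s m \<otimes>\<^bsub>R\<^esub> ?s n) \<otimes>\<^bsub>L\<^esub> z \<oplus>\<^bsub>L\<^esub> \<iota> ?q \<otimes>\<^bsub>L\<^esub> z'"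
      unfolding s_comm[of m n] using z z' by (simp add: L.r_distr)
    also have "\<dots> = \<iota> ?r"
      using z z' n m by (simp add: \<iota>D L.m_assoc)
    finally have 1: "\<iota> ?q \<otimes>\<^bsub>L\<^esub> (z \<oplus>\<^bsub>L\<^esub> z') = \<iota> ?r" .
    have "\<phi> ?q \<otimes>\<^bsub>D\<^esub> (h z \<oplus>\<^bsub>D\<^esub> h z') = \<phi> (?s m \<otimes>\<^bsub>R\<^esub> ?s n) \<otimes>\<^bsub>D\<^esub> h z \<oplus>\<^bsub>D\<^esub> \<phi> ?q \<otimes>\<^bsub>D\<^esub> h z'"
      unfolding s_comm[of m n] using z z' by (simp add: D.r_distr h_closed \<phi>D(1))
    also have "\<dots> = \<phi> ?r"
      using z z' n m by (simp add: \<phi>D D.m_assoc h_closed)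
    finally have 2: "\<phi> ?q \<otimes>\<^bsub>D\<^esub> (h z \<oplus>\<^bsub>D\<^esub> h z') = \<phi> ?r" .
    have "?r \<in> carrier R" using n(1) m(1) by simp
    then have "G (z \<oplus>\<^bsub>L\<^esub> z') (h z \<oplus>\<^bsub>D\<^esub> h z')"
      using 1 2 z z' h_closed unfolding G_def s_add[symmetric] by (metis D.a_closed L.a_closed)
    then show "h (z \<oplus>\<^bsub>L\<^esub> z') = h z \<oplus>\<^bsub>D\<^esub> h z'" by (rule hG)
    \<comment> \<open>In s^(-n) r s^(-m) r' the factor r stands between the denominators. A power
      s^p clears r z', and then s^(p+n) clears z z'; \<open>transfer\<close> is applied with the
      multiplier s^p r, in general not a power of \<open>s\<close>.\<close>
    obtain p :: nat and r'' where p: "r'' \<in> carrier R" "\<iota> (?s p) \<otimes>\<^bsub>L\<^esub> (\<iota> r \<otimes>\<^bsub>L\<^esub> z') = \<iota> r''"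
      using fraction[OF L.m_closed[OF \<iota>_closed[OF n(1)] z']] by blast
    have "\<iota> (?s p \<otimes>\<^bsub>R\<^esub> r) \<otimes>\<^bsub>L\<^esub> z' = \<iota> r''"
      using p n(1) z' by (simp add: \<iota>D L.m_assoc)
    then have 3: "\<phi> (?s p \<otimes>\<^bsub>R\<^esub> r) \<otimes>\<^bsub>D\<^esub> h z' = \<phi> r''"
      using transfer[OF Gh[OF z'], of "?s p \<otimes>\<^bsub>R\<^esub> r" r''] p(1) n(1) by simp
    have "\<iota> (?s (p + n)) \<otimes>\<^bsub>L\<^esub> (z \<otimes>\<^bsub>L\<^esub> z') = \<iota> (?s p) \<otimes>\<^bsub>L\<^esub> ((\<iota> (?s n) \<otimes>\<^bsub>L\<^esub> z) \<otimes>\<^bsub>L\<^esub> z')"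
      using z z' by (simp add: s_add \<iota>D L.m_assoc)
    also have "\<dots> = \<iota> r''" by (simp add: n(2) p(2))
    finally have 4: "\<iota> (?s (p + n)) \<otimes>\<^bsub>L\<^esub> (z \<otimes>\<^bsub>L\<^esub> z') = \<iota> r''" .
    have "\<phi> (?s (p + n)) \<otimes>\<^bsub>D\<^esub> (h z \<otimes>\<^bsub>D\<^esub> h z') = \<phi> (?s p) \<otimes>\<^bsub>D\<^esub> ((\<phi> (?s n) \<otimes>\<^bsub>D\<^esub> h z) \<otimes>\<^bsub>D\<^esub> h z')"
      using z z' by (simp add: s_add \<phi>D D.m_assoc h_closed)
    also have "\<dots> = \<phi> r''"
      using 3 n z' by (simp add: \<phi>D D.m_assoc h_closed)
    finally have "G (z \<otimes>\<^bsub>L\<^esub> z') (h z \<otimes>\<^bsub>D\<^esub> h z')"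
      using 4 p(1) z z' h_closed unfolding G_def by (metis D.m_closed L.m_closed)
    then show "h (z \<otimes>\<^bsub>L\<^esub> z') = h z \<otimes>\<^bsub>D\<^esub> h z'" by (rule hG)
  next
    fix k z assume z: "z \<in> carrier L"
    obtain n r where n: "r \<in> carrier R" "\<iota> (?s n) \<otimes>\<^bsub>L\<^esub> z = \<iota> r" "\<phi> (?s n) \<otimes>\<^bsub>D\<^esub> h z = \<phi> r"
      using Gh[OF z] unfolding G_def by blast
    have "G (k \<odot>\<^bsub>L\<^esub> z) (k \<odot>\<^bsub>D\<^esub> h z)"
      unfolding G_def using z n h_closed
      by (auto simp: L.smult_mult_right D.smult_mult_right \<iota>D(1,5) \<phi>D(1,5)
          intro!: exI[of _ n] bexI[of _ "k \<odot>\<^bsub>R\<^esub> r"])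
    then show "h (k \<odot>\<^bsub>L\<^esub> z) = k \<odot>\<^bsub>D\<^esub> h z" by (rule hG)
  qed (rule h_closed)
  then show thesis using h_\<iota> by (rule that)
qed

end


section \<open>The relations of the super Jordan plane and of its bosonization\<close>

text \<open>Translates the quadratic-type relator \<open>y s - s y - x s\<close> into an equation
  without subtraction, and back.\<close>

lemma (in k_algebra) minus_minus_eq_zero_iff:
  assumes "a \<in> carrier A" "b \<in> carrier A" "c \<in> carrier A"
  shows "a \<ominus> b \<ominus> c = \<zero> \<longleftrightarrow> a = b \<oplus> c"
proof -
  have "a \<ominus> b \<ominus> c = a \<ominus> (b \<oplus> c)"
    using assms by (simp add: a_minus_def minus_add a_assoc)
  then show ?thesis using assms by (simp add: r_right_minus_eq)
qed

text \<open>A pair satisfying the relations in an arbitrary algebra. The identities below are thus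
  proved once and hold in both presented algebras, in their localizations and in the tensor
  product.\<close>

locale sj_pair = k_algebra D for D :: "('k::field, 'd) module" (structure) +
  fixes x y
  assumes x [simp]: "x \<in> carrier D" and y [simp]: "y \<in> carrier D"
    and xx: "x \<otimes> x = \<zero>"
    and y_s: "y \<otimes> (x \<otimes> y \<oplus> y \<otimes> x) =
      (x \<otimes> y \<oplus> y \<otimes> x) \<otimes> y \<oplus> x \<otimes> (x \<otimes> y \<oplus> y \<otimes> x)"
begin

definition s where "s = x \<otimes> y \<oplus> y \<otimes> x"
definition d where "d = y \<otimes> x \<ominus> x \<otimes> y"

lemma s_closed [simp]: "s \<in> carrier D" and d_closed [simp]: "d \<in> carrier D"
  by (simp_all add: s_def d_def a_minus_def)

lemma x_x: "z \<in> carrier D \<Longrightarrow> x \<otimes> (x \<otimes> z) = \<zero>"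
  by (simp add: m_assoc[symmetric] xx)

text \<open>Expanding ys = sy + xs, the term yxy occurs on both sides and xxy vanishes.\<close>

lemma y_y_x: "y \<otimes> (y \<otimes> x) = x \<otimes> (y \<otimes> y) \<oplus> x \<otimes> (y \<otimes> x)"
proof -
  have "y \<otimes> (x \<otimes> y) \<oplus> y \<otimes> (y \<otimes> x) =
      y \<otimes> (x \<otimes> y) \<oplus> (x \<otimes> (y \<otimes> y) \<oplus> x \<otimes> (y \<otimes> x))"
    using y_s by (simp add: l_distr r_distr m_assoc x_x a_ac)
  then show ?thesis by simp
qed

text \<open>The rule with a trailing factor: with products nested to the right, yyx also occurs as
  the beginning of a longer product.\<close>

lemma y_y_x': "z \<in> carrier D \<Longrightarrow>
    y \<otimes> (y \<otimes> (x \<otimes> z)) = x \<otimes> (y \<otimes> (y \<otimes> z)) \<oplus> x \<otimes> (y \<otimes> (x \<otimes> z))"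
  using arg_cong[OF y_y_x, of "\<lambda>w. w \<otimes> z"] by (simp add: m_assoc l_distr)

text \<open>The rewriting system \<open>xx \<rightarrow> 0\<close>, \<open>yyx \<rightarrow> xyy + xyx\<close> is confluent, so the
  simplifier decides the identities between noncommutative polynomials in \<open>x\<close> and \<open>y\<close>.\<close>

lemmas nf = xx x_x y_y_x y_y_x' l_distr r_distr m_assoc l_minus r_minus minus_add a_ac

lemma s_x: "s \<otimes> x = x \<otimes> s"
  by (simp add: s_def nf)

lemma s_y: "s \<otimes> y \<oplus> x \<otimes> s = y \<otimes> s"
  unfolding s_def by (rule y_s[symmetric])

lemma d_x: "d \<otimes> x = \<ominus> (x \<otimes> d)"
  by (simp add: d_def a_minus_def nf)

text \<open>On the right-hand side -yyx becomes -(xyy + xyx), and -xyx cancels the xyx coming from x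
  d. What remains is yxy - xyy.\<close>

lemma d_y: "d \<otimes> y = (\<ominus> y \<oplus> x) \<otimes> d"
proof -
  have "d \<otimes> y = y \<otimes> (x \<otimes> y) \<oplus> \<ominus> (x \<otimes> (y \<otimes> y))"
    by (simp add: d_def a_minus_def nf)
  moreover have "(\<ominus> y \<oplus> x) \<otimes> d = (x \<otimes> (y \<otimes> x) \<oplus> \<ominus> (x \<otimes> (y \<otimes> x)))
      \<oplus> (y \<otimes> (x \<otimes> y) \<oplus> \<ominus> (x \<otimes> (y \<otimes> y)))"
    by (simp only: d_def a_minus_def) (simp add: nf del: r_neg l_neg r_neg1 r_neg2)
  ultimately show ?thesis by (simp add: r_neg)
qed

text \<open>The squares differ only in the signs of yxxy and xyyx. Both vanish: the first contains
  xx, and xyyx = x(xyy + xyx).\<close>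

lemma d_d: "d \<otimes> d = s \<otimes> s"
  by (simp add: d_def s_def a_minus_def nf)

lemma s_d: "s \<otimes> d = d \<otimes> s"
  by (simp add: d_def s_def a_minus_def nf)

text \<open>By \<open>d_d\<close> the inverse is d s^(-2). It is two-sided because \<open>d\<close>
  commutes with \<open>s\<close>, hence with its inverse.\<close>

lemma d_Units:
  assumes "s \<in> Units D"
  shows "d \<in> Units D"
proof -
  note [simp] = Units_inv_closed[OF assms]
  have inv_d: "inv s \<otimes> d = d \<otimes> inv s"
    by (rule commute_inv[OF assms]) (simp_all add: s_d)
  have s_inv: "s \<otimes> (inv s \<otimes> z) = z" if "z \<in> carrier D" for z
    using that assms by (simp add: m_assoc[symmetric])
  have "d \<otimes> (d \<otimes> (inv s \<otimes> inv s)) = s \<otimes> (s \<otimes> (inv s \<otimes> inv s))"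
    by (simp only: m_assoc[symmetric] x y s_closed d_closed m_closed Units_inv_closed[OF assms] d_d)
  then have r: "d \<otimes> (d \<otimes> (inv s \<otimes> inv s)) = \<one>"
    using assms by (simp add: s_inv)
  have "(d \<otimes> (inv s \<otimes> inv s)) \<otimes> d = d \<otimes> (d \<otimes> (inv s \<otimes> inv s))"
    by (metis inv_d m_assoc d_closed Units_inv_closed[OF assms] m_closed)
  with r show ?thesis unfolding Units_def by fastforce
qed

end

text \<open>The relations are equations between polynomial expressions, so homomorphisms transport
  them together with \<open>s\<close> and \<open>d\<close>.\<close>

lemma sj_pair_hom:
  assumes R: "sj_pair R x y" and D: "k_algebra D" and h: "h \<in> alg_hom R D"
  shows "sj_pair D (h x) (h y)" "sj_pair.s D (h x) (h y) = h (sj_pair.s R x y)"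
    "sj_pair.d D (h x) (h y) = h (sj_pair.d R x y)"
proof -
  interpret R: sj_pair R x y by fact
  interpret D: k_algebra D by fact
  note hD = alg_homD[OF h]
  show D': "sj_pair D (h x) (h y)"
  proof (intro sj_pair.intro sj_pair_axioms.intro D)
    show "h x \<otimes>\<^bsub>D\<^esub> h x = \<zero>\<^bsub>D\<^esub>"
      by (simp add: hD(2)[symmetric] R.xx alg_hom_zero[OF R.k_algebra_axioms D h])
    show "h y \<otimes>\<^bsub>D\<^esub> (h x \<otimes>\<^bsub>D\<^esub> h y \<oplus>\<^bsub>D\<^esub> h y \<otimes>\<^bsub>D\<^esub> h x) =
        (h x \<otimes>\<^bsub>D\<^esub> h y \<oplus>\<^bsub>D\<^esub> h y \<otimes>\<^bsub>D\<^esub> h x) \<otimes>\<^bsub>D\<^esub> h y \<oplus>\<^bsub>D\<^esub>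
        h x \<otimes>\<^bsub>D\<^esub> (h x \<otimes>\<^bsub>D\<^esub> h y \<oplus>\<^bsub>D\<^esub> h y \<otimes>\<^bsub>D\<^esub> h x)"
      by (simp add: hD(2,3)[symmetric]) (simp only: R.y_s)
  qed (simp_all add: hD)
  interpret D': sj_pair D "h x" "h y" by (rule D')
  show "D'.s = h R.s" by (simp add: D'.s_def R.s_def hD)
  show "D'.d = h R.d"
    by (simp add: D'.d_def R.d_def hD alg_hom_minus_diff[OF R.k_algebra_axioms D h])
qed

abbreviation (input) sj_gen_class :: "sj_gen \<Rightarrow> (sj_gen list \<Rightarrow>\<^sub>0 'k::field) set" where
  "sj_gen_class g \<equiv> presented_class sj_relators (free_gen g)"

lemma sj_pair_super_jordan:
  "sj_pair (super_jordan :: ('k::field, (sj_gen list \<Rightarrow>\<^sub>0 'k) set) module)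
    (sj_gen_class SJ_x) (sj_gen_class SJ_y)"
proof -
  interpret k_algebra "super_jordan :: ('k::field, (sj_gen list \<Rightarrow>\<^sub>0 'k) set) module"
    unfolding super_jordan_def by (rule k_algebra_presented)
  note simps = presented_class_simps[of sj_relators, folded super_jordan_def]
  let ?X = "free_gen SJ_x :: sj_gen list \<Rightarrow>\<^sub>0 'k" and ?Y = "free_gen SJ_y :: sj_gen list \<Rightarrow>\<^sub>0 'k"
  let ?S = "?X * ?Y + ?Y * ?X"
  have "?X * ?X \<in> sj_relators" "?Y * ?S - ?S * ?Y - ?X * ?S \<in> sj_relators"
    by (simp_all add: sj_relators_def Let_def)
  note rels = this[THEN presented_class_rel, folded super_jordan_def]
  show ?thesis
    by (intro sj_pair.intro sj_pair_axioms.intro k_algebra_axioms)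
       (use rels in \<open>simp_all only: simps minus_minus_eq_zero_iff a_closed m_closed\<close>)
qed

lemma sj_gen_class_closed [simp]: "sj_gen_class g \<in> carrier super_jordan"
  by (simp add: presented_class_simps(1) super_jordan_def)

lemma sj_s_eq: "sj_s = sj_pair.s super_jordan (sj_gen_class SJ_x) (sj_gen_class SJ_y)"
  unfolding sj_s_def sj_pair.s_def[OF sj_pair_super_jordan]
  by (simp add: presented_class_simps super_jordan_def)

lemma super_jordan_lift:
  fixes D :: "('k::field, 'd) module"
  assumes "sj_pair D x y"
  obtains h where "h \<in> alg_hom super_jordan D"
    "h (sj_gen_class SJ_x) = x" "h (sj_gen_class SJ_y) = y"
proof -
  interpret sj_pair D x y by fact
  let ?v = "case_sj_gen x y" and ?s = "x \<otimes>\<^bsub>D\<^esub> y \<oplus>\<^bsub>D\<^esub> y \<otimes>\<^bsub>D\<^esub> x"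
  have rel: "y \<otimes>\<^bsub>D\<^esub> ?s \<ominus>\<^bsub>D\<^esub> ?s \<otimes>\<^bsub>D\<^esub> y \<ominus>\<^bsub>D\<^esub> x \<otimes>\<^bsub>D\<^esub> ?s = \<zero>\<^bsub>D\<^esub>"
    using y_s by (simp only: minus_minus_eq_zero_iff x y a_closed m_closed)
  obtain h where h: "h \<in> alg_hom (presented_algebra sj_relators) D"
    "\<And>g. h (sj_gen_class g) = ?v g"
  proof (rule presented_lift[OF k_algebra_axioms, of ?v sj_relators])
    show "?v g \<in> carrier D" for g by (cases g) simp_all
    fix f and r :: "sj_gen list \<Rightarrow>\<^sub>0 'k"
    assume f: "f \<in> alg_hom free_algebra D" "\<And>g. f (free_gen g) = ?v g" and "r \<in> sj_relators"
    then show "f r = \<zero>\<^bsub>D\<^esub>"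
      by (auto simp only: sj_relators_def Let_def insert_iff empty_iff sj_gen.case
          free_hom[OF k_algebra_axioms f(1)] f(2) xx rel)
  qed blast
  from that[of h] h(1) h(2)[of SJ_x] h(2)[of SJ_y] show thesis by (simp add: super_jordan_def)
qed

lemma super_jordan_generators:
  assumes "is_subalgebra super_jordan B" "sj_gen_class SJ_x \<in> B" "sj_gen_class SJ_y \<in> B"
  shows "carrier super_jordan \<subseteq> B"
proof -
  have "sj_gen_class g \<in> B" for g using assms(2,3) by (cases g) simp_all
  with assms(1) show ?thesis unfolding super_jordan_def by (intro presented_generators) auto
qed

section \<open>Algebras satisfying the relations of the bosonization\<close>

locale bos_quad = sj_pair D x y for D :: "('k::field, 'd) module" (structure) and x y +
  fixes g gi
  assumes g [simp]: "g \<in> carrier D" and gi [simp]: "gi \<in> carrier D"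
    and g_gi: "g \<otimes> gi = \<one>" and gi_g: "gi \<otimes> g = \<one>"
    and g_x_gi: "g \<otimes> x \<otimes> gi = \<ominus> x" and g_y_gi: "g \<otimes> y \<otimes> gi = \<ominus> y \<oplus> x"
begin

lemma conj_g:
  assumes "g \<otimes> a \<otimes> gi = b" "a \<in> carrier D"
  shows "g \<otimes> a = b \<otimes> g" "a \<otimes> gi = gi \<otimes> b"
  using assms by (auto simp: m_assoc gi_g) (simp add: m_assoc[symmetric] gi_g)

text \<open>The automorphism fixes \<open>d\<close>: (-y + x)(-x) - (-x)(-y + x) = yx - xy, since xx
  = 0.\<close>

lemma g_d: "g \<otimes> d = d \<otimes> g"
proof -
  note gx = conj_g(1)[OF g_x_gi x] and gy = conj_g(1)[OF g_y_gi y]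
  have gx': "g \<otimes> (x \<otimes> z) = \<ominus> (x \<otimes> (g \<otimes> z))" and gy': "g \<otimes> (y \<otimes> z) = (\<ominus> y \<oplus> x) \<otimes> (g \<otimes> z)"
    if "z \<in> carrier D" for z
    using that arg_cong[OF gx, of "\<lambda>w. w \<otimes> z"] arg_cong[OF gy, of "\<lambda>w. w \<otimes> z"]
    by (simp_all add: m_assoc l_minus)
  show ?thesis
    by (simp add: d_def a_minus_def r_distr r_minus gx' gy' gx gy)
       (simp add: nf)
qed

definition C where "C = d \<otimes> gi"

lemma C_closed [simp]: "C \<in> carrier D"
  by (simp add: C_def)

text \<open>Solving this for \<open>g\<close> gives C^(-1) d, which dictates the image of
  \<open>g\<close> in the tensor product.\<close>

lemma C_g: "C \<otimes> g = d" "g \<otimes> C = d"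
  by (simp_all add: C_def m_assoc gi_g) (simp add: m_assoc[symmetric] g_d, simp add: m_assoc g_gi)

text \<open>Conjugation by \<open>d\<close> and by \<open>g\<close> agree on \<open>x\<close> and
  \<open>y\<close>, so in d g^(-1) they cancel. Commutation with \<open>g\<close> itself comes from
  \<open>g_d\<close>.\<close>

lemma C_commute: "C \<otimes> x = x \<otimes> C" "C \<otimes> y = y \<otimes> C" "C \<otimes> g = g \<otimes> C" "C \<otimes> gi = gi \<otimes> C"
proof -
  have gi_x: "gi \<otimes> x = \<ominus> (x \<otimes> gi)"
    using conj_g(2)[OF g_x_gi x] by (simp add: r_minus)
  have "y \<otimes> gi = \<ominus> (gi \<otimes> y) \<oplus> gi \<otimes> x"
    using conj_g(2)[OF g_y_gi y] by (simp add: r_minus r_distr)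
  \<comment> \<open>The inverse automorphism sends y to -(y + x); then d(y + x) = -yd compensates
    it.\<close>
  then have gi_y: "gi \<otimes> y = \<ominus> ((y \<oplus> x) \<otimes> gi)"
    by (simp add: gi_x l_distr minus_add a_assoc l_neg)
  show "C \<otimes> x = x \<otimes> C"
    by (simp add: C_def m_assoc gi_x r_minus) (simp add: m_assoc[symmetric] d_x l_minus)
  have "d \<otimes> (y \<oplus> x) = \<ominus> (y \<otimes> d)"
    by (simp add: r_distr d_x d_y l_distr l_minus a_assoc r_neg)
  then show "C \<otimes> y = y \<otimes> C"
    by (simp add: C_def m_assoc gi_y r_minus) (simp add: m_assoc[symmetric] l_minus)
  show Cg: "C \<otimes> g = g \<otimes> C" by (simp add: C_g)
  have "gi \<otimes> (C \<otimes> g) \<otimes> gi = gi \<otimes> (g \<otimes> C) \<otimes> gi" by (simp add: Cg)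
  then show "C \<otimes> gi = gi \<otimes> C"
    by (simp add: m_assoc g_gi) (simp add: m_assoc[symmetric] gi_g)
qed

lemma C_Units: "s \<in> Units D \<Longrightarrow> C \<in> Units D"
  unfolding C_def
  by (intro Units_m_closed d_Units) (auto simp: Units_def intro!: bexI[of _ g] g_gi gi_g)

end

lemma bos_quad_hom:
  assumes R: "bos_quad R x y g gi" and D: "k_algebra D" and h: "h \<in> alg_hom R D"
  shows "bos_quad D (h x) (h y) (h g) (h gi)"
    "bos_quad.C D (h x) (h y) (h gi) = h (bos_quad.C R x y gi)"
proof -
  interpret R: bos_quad R x y g gi by fact
  note hD = alg_homD[OF h] and R' = R.sj_pair_axioms
  show D': "bos_quad D (h x) (h y) (h g) (h gi)"
    by (intro bos_quad.intro bos_quad_axioms.intro sj_pair_hom(1)[OF R' D h])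
       (simp_all add: hD(1) hD(2-4)[symmetric] R.g_gi R.gi_g R.g_x_gi R.g_y_gi
          alg_hom_minus[OF R.k_algebra_axioms D h, symmetric])
  show "bos_quad.C D (h x) (h y) (h gi) = h R.C"
    by (simp add: bos_quad.C_def[OF D'] R.C_def hD(2) sj_pair_hom(3)[OF R' D h])
qed

abbreviation (input) bos_gen_class :: "bos_gen \<Rightarrow> (bos_gen list \<Rightarrow>\<^sub>0 'k::field) set" where
  "bos_gen_class g \<equiv> presented_class bos_relators (free_gen g)"

lemma bos_quad_bosonization:
  "bos_quad (bosonization :: ('k::field, (bos_gen list \<Rightarrow>\<^sub>0 'k) set) module)
    (bos_gen_class Bos_x) (bos_gen_class Bos_y)
    (bos_gen_class Bos_g) (bos_gen_class Bos_gi)"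
proof -
  interpret k_algebra "bosonization :: ('k::field, (bos_gen list \<Rightarrow>\<^sub>0 'k) set) module"
    unfolding bosonization_def by (rule k_algebra_presented)
  note simps = presented_class_simps[of bos_relators, folded bosonization_def]
  let ?X = "free_gen Bos_x :: bos_gen list \<Rightarrow>\<^sub>0 'k" and ?Y = "free_gen Bos_y :: bos_gen list \<Rightarrow>\<^sub>0 'k"
    and ?G = "free_gen Bos_g :: bos_gen list \<Rightarrow>\<^sub>0 'k" and ?I = "free_gen Bos_gi :: bos_gen list \<Rightarrow>\<^sub>0 'k"
  let ?S = "?X * ?Y + ?Y * ?X"
  have "?X * ?X \<in> bos_relators" "?Y * ?S - ?S * ?Y - ?X * ?S \<in> bos_relators"
    "?G * ?I - 1 \<in> bos_relators" "?I * ?G - 1 \<in> bos_relators"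
    "?G * ?X * ?I - (- ?X) \<in> bos_relators" "?G * ?Y * ?I - (- ?Y + ?X) \<in> bos_relators"
    unfolding bos_relators_def Let_def by blast+
  note rels = this[THEN presented_class_rel, folded bosonization_def]
  show ?thesis
    by (intro bos_quad.intro bos_quad_axioms.intro sj_pair.intro sj_pair_axioms.intro k_algebra_axioms)
       (use rels in \<open>simp_all only: simps minus_minus_eq_zero_iff r_right_minus_eq
          a_closed m_closed a_inv_closed one_closed\<close>)
qed

lemma bos_gen_class_closed [simp]: "bos_gen_class g \<in> carrier bosonization"
  by (simp add: presented_class_simps(1) bosonization_def)

lemma bos_s_eq: "bos_s = sj_pair.s bosonization (bos_gen_class Bos_x) (bos_gen_class Bos_y)"
  unfolding bos_s_def sj_pair.s_def[OF bos_quad.axioms(1)[OF bos_quad_bosonization]]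
  by (simp add: presented_class_simps bosonization_def)

text \<open>The factor 2yx - s is yx - xy, that is, \<open>d\<close>.\<close>

lemma bos_C_eq:
  "(bos_C :: (bos_gen list \<Rightarrow>\<^sub>0 'k::field) set) =
    bos_quad.C bosonization (bos_gen_class Bos_x) (bos_gen_class Bos_y) (bos_gen_class Bos_gi)"
proof -
  have eq: "2 * y * x - (x * y + y * x) = y * x - x * y" for x y :: "bos_gen list \<Rightarrow>\<^sub>0 'k"
    by (simp add: mult_2 distrib_right)
  show ?thesis
    unfolding bos_C_def Let_def bos_quad.C_def[OF bos_quad_bosonization]
      sj_pair.d_def[OF bos_quad.axioms(1)[OF bos_quad_bosonization]]
    by (simp only: eq presented_class_simps bosonization_def)
qed

lemma bosonization_lift:
  fixes D :: "('k::field, 'd) module"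
  assumes "bos_quad D x y g gi"
  obtains h where "h \<in> alg_hom bosonization D"
    "h (bos_gen_class Bos_x) = x" "h (bos_gen_class Bos_y) = y"
    "h (bos_gen_class Bos_g) = g" "h (bos_gen_class Bos_gi) = gi"
proof -
  interpret bos_quad D x y g gi by fact
  let ?v = "case_bos_gen x y g gi" and ?s = "x \<otimes>\<^bsub>D\<^esub> y \<oplus>\<^bsub>D\<^esub> y \<otimes>\<^bsub>D\<^esub> x"
  have rels: "y \<otimes>\<^bsub>D\<^esub> ?s \<ominus>\<^bsub>D\<^esub> ?s \<otimes>\<^bsub>D\<^esub> y \<ominus>\<^bsub>D\<^esub> x \<otimes>\<^bsub>D\<^esub> ?s = \<zero>\<^bsub>D\<^esub>"
    "g \<otimes>\<^bsub>D\<^esub> gi \<ominus>\<^bsub>D\<^esub> \<one>\<^bsub>D\<^esub> = \<zero>\<^bsub>D\<^esub>" "gi \<otimes>\<^bsub>D\<^esub> g \<ominus>\<^bsub>D\<^esub> \<one>\<^bsub>D\<^esub> = \<zero>\<^bsub>D\<^esub>"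
    "g \<otimes>\<^bsub>D\<^esub> x \<otimes>\<^bsub>D\<^esub> gi \<ominus>\<^bsub>D\<^esub> \<ominus>\<^bsub>D\<^esub> x = \<zero>\<^bsub>D\<^esub>"
    "g \<otimes>\<^bsub>D\<^esub> y \<otimes>\<^bsub>D\<^esub> gi \<ominus>\<^bsub>D\<^esub> (\<ominus>\<^bsub>D\<^esub> y \<oplus>\<^bsub>D\<^esub> x) = \<zero>\<^bsub>D\<^esub>"
    using y_s g_gi gi_g g_x_gi g_y_gi
    by (simp_all only: minus_minus_eq_zero_iff r_right_minus_eq x y g gi a_closed m_closed
        a_inv_closed one_closed)
  obtain h where h: "h \<in> alg_hom (presented_algebra bos_relators) D"
    "\<And>g. h (bos_gen_class g) = ?v g"
  proof (rule presented_lift[OF k_algebra_axioms, of ?v bos_relators])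
    show "?v g \<in> carrier D" for g by (cases g) simp_all
    fix f and r :: "bos_gen list \<Rightarrow>\<^sub>0 'k"
    assume f: "f \<in> alg_hom free_algebra D" "\<And>g. f (free_gen g) = ?v g" and "r \<in> bos_relators"
    then show "f r = \<zero>\<^bsub>D\<^esub>"
      by (auto simp only: bos_relators_def Let_def insert_iff empty_iff bos_gen.case
          free_hom[OF k_algebra_axioms f(1)] f(2) xx rels)
  qed blast
  from that[of h] h(1) h(2)[of Bos_x] h(2)[of Bos_y] h(2)[of Bos_g] h(2)[of Bos_gi]
  show thesis by (simp add: bosonization_def)
qed

lemma bosonization_generators:
  assumes "is_subalgebra bosonization B" "bos_gen_class Bos_x \<in> B" "bos_gen_class Bos_y \<in> B"
    "bos_gen_class Bos_g \<in> B" "bos_gen_class Bos_gi \<in> B"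
  shows "carrier bosonization \<subseteq> B"
proof -
  have "bos_gen_class g \<in> B" for g using assms(2-) by (cases g) simp_all
  with assms(1) show ?thesis unfolding bosonization_def by (intro presented_generators) auto
qed


section \<open>The localized super Jordan plane as a matrix algebra\<close>

locale sj_pair_unit = sj_pair D x y for D :: "('k::field, 'd) module" (structure) and x y +
  assumes s_Units: "s \<in> Units D"
begin

definition p where "p = y \<otimes> inv s"

lemma inv_s_closed [simp]: "inv s \<in> carrier D"
  using s_Units by simp

lemma p_closed [simp]: "p \<in> carrier D"
  by (simp add: p_def)

lemma p_s: "p \<otimes> s = y"
  using s_Units by (simp add: p_def m_assoc)

lemma inv_s_x: "inv s \<otimes> x = x \<otimes> inv s"
  by (rule commute_inv[OF s_Units]) (simp_all add: s_x)

text \<open>As the inverse of \<open>s\<close> commutes with \<open>x\<close>, it can be pulled out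
  to the right, leaving s times its inverse.\<close>

lemma x_p_add: "x \<otimes> p \<oplus> p \<otimes> x = \<one>"
proof -
  have "x \<otimes> p \<oplus> p \<otimes> x = (x \<otimes> y \<oplus> y \<otimes> x) \<otimes> inv s"
    by (simp add: p_def m_assoc inv_s_x l_distr)
  then show ?thesis using s_Units by (simp add: s_def)
qed

lemma x_p_x: "x \<otimes> (p \<otimes> x) = x"
proof -
  have "x \<otimes> (p \<otimes> x) = x \<otimes> (x \<otimes> p \<oplus> p \<otimes> x)"
    by (simp add: r_distr x_x)
  then show ?thesis by (simp add: x_p_add)
qed

text \<open>Multiplying xp + px = 1 by p on the left and on the right gives the same element;
  cancelling pxp leaves that p^2 commutes with x.\<close>

lemma p_p_x: "p \<otimes> (p \<otimes> x) = x \<otimes> (p \<otimes> p)"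
proof -
  have "p \<otimes> (x \<otimes> p) \<oplus> p \<otimes> (p \<otimes> x) = p \<otimes> (x \<otimes> p \<oplus> p \<otimes> x)"
    by (simp add: r_distr)
  also have "\<dots> = (x \<otimes> p \<oplus> p \<otimes> x) \<otimes> p"
    by (simp add: x_p_add)
  also have "\<dots> = p \<otimes> (x \<otimes> p) \<oplus> x \<otimes> (p \<otimes> p)"
    by (simp add: l_distr m_assoc a_comm)
  finally show ?thesis by simp
qed

lemma x_p_x': "z \<in> carrier D \<Longrightarrow> x \<otimes> (p \<otimes> (x \<otimes> z)) = x \<otimes> z"
  and p_p_x': "z \<in> carrier D \<Longrightarrow> p \<otimes> (p \<otimes> (x \<otimes> z)) = x \<otimes> (p \<otimes> (p \<otimes> z))"
  using arg_cong[OF x_p_x, of "\<lambda>w. w \<otimes> z"] arg_cong[OF p_p_x, of "\<lambda>w. w \<otimes> z"]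
  by (simp_all add: m_assoc)

text \<open>Reads p = \<open>e 2 1\<close> + \<open>e 1 2\<close> p^2, which recovers
  \<open>p\<close> from the matrix units and p^2.\<close>

lemma p_decomp: "p = p \<otimes> (x \<otimes> p) \<oplus> x \<otimes> (p \<otimes> p)"
proof -
  have "p = (x \<otimes> p \<oplus> p \<otimes> x) \<otimes> p" by (simp add: x_p_add)
  then show ?thesis by (simp add: l_distr m_assoc a_comm)
qed

text \<open>The matrix units \<open>xy'\<close>, \<open>x\<close>, \<open>y'xy'\<close>, \<open>y'x\<close> come from \<open>xy' + y'x = 1\<close>.  The naive choice
  \<open>y'\<close> for the entry at \<open>(2, 1)\<close> fails, as \<open>y'\<close> neither squares to zero nor commutes with \<open>s\<close>.\<close>

definition e :: "2 \<Rightarrow> 2 \<Rightarrow> 'd" where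
  "e i j = (if i = 1 then if j = 1 then x \<otimes> p else x
    else if j = 1 then p \<otimes> (x \<otimes> p) else p \<otimes> x)"

lemma e_closed: "e i j \<in> carrier D"
  by (simp add: e_def)

text \<open>All products reduce by xx = 0, xpx = x and ppx = xpp. For example, (pxp)(pxp) = p x x p
  p p = 0.\<close>

lemma e_mult: "e i j \<otimes> e k l = (if j = k then e i l else \<zero>)"
  using exhaust_2[of i] exhaust_2[of j] exhaust_2[of k] exhaust_2[of l]
  by (auto simp: e_def m_assoc xx x_x x_p_x x_p_x' p_p_x p_p_x')

lemma e_sum: "e 1 1 \<oplus> e 2 2 = \<one>"
  by (simp add: e_def x_p_add)

lemma s_p: "s \<otimes> p \<oplus> x = p \<otimes> s"
proof -
  have "s \<otimes> p \<oplus> x = (s \<otimes> y \<oplus> x \<otimes> s) \<otimes> inv s"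
    using s_Units by (simp add: p_def l_distr m_assoc)
  also have "\<dots> = p \<otimes> s"
    using s_Units by (simp add: s_y p_s m_assoc)
  finally show ?thesis .
qed

text \<open>p^2 commutes with both x and p. Moving \<open>s\<close> past \<open>p\<close> costs a
  summand x, but in every unit containing \<open>p\<close> this summand meets another factor x and
  vanishes.\<close>

lemma e_centralizer: "{p \<otimes> p, s, inv s} \<subseteq> centralizer D (\<Union>i j. {e i j})"
proof -
  have e: "(\<Union>i j. {e i j}) \<subseteq> carrier D" by (auto simp: e_closed)
  have p_s': "p \<otimes> s = s \<otimes> p \<oplus> x" by (simp add: s_p)
  have x_s: "x \<otimes> s = s \<otimes> x" by (simp add: s_x)
  have x_s': "x \<otimes> (s \<otimes> z) = s \<otimes> (x \<otimes> z)" and p_s'': "p \<otimes> (s \<otimes> z) = s \<otimes> (p \<otimes> z) \<oplus> x \<otimes> z"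
    if "z \<in> carrier D" for z
    using that arg_cong[OF x_s, of "\<lambda>w. w \<otimes> z"] arg_cong[OF p_s', of "\<lambda>w. w \<otimes> z"]
    by (simp_all add: m_assoc l_distr)
  have "p \<otimes> p \<in> centralizer D (\<Union>i j. {e i j})"
    by (auto simp: centralizer_def e_def m_assoc p_p_x p_p_x')
  moreover have s: "s \<in> centralizer D (\<Union>i j. {e i j})"
    by (auto simp: centralizer_def e_def m_assoc p_s' x_s x_s' p_s'' r_distr xx x_x)
  ultimately show ?thesis using inv_in_centralizer[OF e s_Units s] by simp
qed

end

locale localized_super_jordan =
  localization super_jordan sj_s L \<iota>
  for L :: "('k::field, 'b) module" and \<iota> :: "(sj_gen list \<Rightarrow>\<^sub>0 'k) set \<Rightarrow> 'b"
begin

abbreviation "gx \<equiv> \<iota> (sj_gen_class SJ_x)"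
abbreviation "gy \<equiv> \<iota> (sj_gen_class SJ_y)"

sublocale sj: sj_pair_unit L gx gy
  by (intro sj_pair_unit.intro sj_pair_unit_axioms.intro
      sj_pair_hom(1)[OF sj_pair_super_jordan L.k_algebra_axioms \<iota>])
     (simp add: sj_pair_hom(2)[OF sj_pair_super_jordan L.k_algebra_axioms \<iota>] sj_s_eq[symmetric] \<iota>_s_Units)

lemma \<iota>_s: "\<iota> sj_s = sj.s"
  by (simp add: sj_pair_hom(2)[OF sj_pair_super_jordan L.k_algebra_axioms \<iota>] sj_s_eq)

lemma localized_weyl_eq:
  "localized_weyl L \<iota> = generated_subalgebra L {sj.p \<otimes>\<^bsub>L\<^esub> sj.p, sj.s, inv\<^bsub>L\<^esub> sj.s}"
  by (simp add: localized_weyl_def Let_def \<iota>_s sj.p_def sj_y_def)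

lemma k_algebra_weyl: "k_algebra (localized_weyl L \<iota>)"
  unfolding localized_weyl_eq by (rule L.k_algebra_generated) auto

text \<open>The map from the Weyl part is an inclusion, hence injective; what remains is that it
  generates \<open>L\<close> together with the units.\<close>

lemma matrix_iso: "M2 (localized_weyl L \<iota>) \<cong>\<^sub>a L"
proof -
  let ?S = "{sj.p \<otimes>\<^bsub>L\<^esub> sj.p, sj.s, inv\<^bsub>L\<^esub> sj.s}"
  interpret W: k_algebra "localized_weyl L \<iota>" by (rule k_algebra_weyl)
  have S: "?S \<subseteq> carrier L" by auto
  note sub = L.is_subalgebra_generated[OF S, folded localized_weyl_eq]
  have E: "(\<Union>i j. {sj.e i j}) \<subseteq> carrier L" by (auto simp: sj.e_closed)
  have central: "carrier (localized_weyl L \<iota>) \<subseteq> centralizer L (\<Union>i j. {sj.e i j})"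
    unfolding localized_weyl_eq
    by (rule L.generated_least[OF L.is_subalgebra_centralizer[OF E] sj.e_centralizer])
  interpret matrix_units "localized_weyl L \<iota>" L "\<lambda>w. w" sj.e
  proof
    show "(\<lambda>w. w) \<in> alg_hom (localized_weyl L \<iota>) L"
      by (rule alg_homI) (use is_subalgebraD(1)[OF sub] in \<open>auto simp: localized_weyl_eq\<close>)
    show "w \<otimes>\<^bsub>L\<^esub> sj.e i j = sj.e i j \<otimes>\<^bsub>L\<^esub> w" if "w \<in> carrier (localized_weyl L \<iota>)" for w i j
      using central that by (auto simp: centralizer_def)
  qed (rule sj.e_closed sj.e_mult sj.e_sum)+
  show ?thesis
  proof (rule \<Theta>_iso)
    fix B assume B: "is_subalgebra L B" and "(\<lambda>w. w) ` carrier (localized_weyl L \<iota>) \<subseteq> B"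
      and e: "\<And>i j. sj.e i j \<in> B"
    then have S_B: "?S \<subseteq> B"
      using L.generated_subset[of ?S] unfolding localized_weyl_eq by auto
    have x: "gx \<in> B" using e[of 1 2] by (simp add: sj.e_def)
    have "sj.p \<otimes>\<^bsub>L\<^esub> (gx \<otimes>\<^bsub>L\<^esub> sj.p) \<in> B" using e[of 2 1] by (simp add: sj.e_def)
    \<comment> \<open>\<open>p_decomp\<close> yields y' itself, and then y = y' s.\<close>
    then have "sj.p \<in> B"
      using x S_B is_subalgebraD(6,7)[OF B] by (subst sj.p_decomp) auto
    then have y: "gy \<in> B"
      using S_B is_subalgebraD(7)[OF B] sj.p_s by (metis insert_subset)
    have "carrier super_jordan \<subseteq> {r \<in> carrier super_jordan. \<iota> r \<in> B}"
      using x y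
      by (intro super_jordan_generators is_subalgebra_vimage[OF R.k_algebra_axioms \<iota> B]) auto
    then show "carrier L \<subseteq> B"
      by (intro generators[OF B]) (use S_B in \<open>auto simp: \<iota>_s\<close>)
  qed simp
qed

end

lemma alg_iso_sym:
  assumes "A \<cong>\<^sub>a B" "k_algebra A"
  shows "B \<cong>\<^sub>a A"
  by (rule alg_isoE[OF assms]) (blast intro: alg_isoI)


section \<open>Splitting off the central element\<close>

locale localized_bosonization =
  localization bosonization bos_s L \<kappa>
  for L :: "('k::field, 'c) module" and \<kappa> :: "(bos_gen list \<Rightarrow>\<^sub>0 'k) set \<Rightarrow> 'c"
begin

sublocale b: bos_quad L "\<kappa> (bos_gen_class Bos_x)" "\<kappa> (bos_gen_class Bos_y)"
    "\<kappa> (bos_gen_class Bos_g)" "\<kappa> (bos_gen_class Bos_gi)"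
  by (rule bos_quad_hom(1)[OF bos_quad_bosonization L.k_algebra_axioms \<iota>])

lemma \<kappa>_s: "\<kappa> bos_s = b.s"
  by (simp add: bos_s_eq
      sj_pair_hom(2)[OF bos_quad.axioms(1)[OF bos_quad_bosonization] L.k_algebra_axioms \<iota>])

lemma \<kappa>_C: "\<kappa> bos_C = b.C"
  by (simp add: bos_C_eq bos_quad_hom(2)[OF bos_quad_bosonization L.k_algebra_axioms \<iota>])

lemma s_Units: "b.s \<in> Units L"
  using \<iota>_s_Units by (simp add: \<kappa>_s)

lemma C_Units: "b.C \<in> Units L"
  by (rule b.C_Units[OF s_Units])

lemma laurent_eq: "laurent_C L \<kappa> = generated_subalgebra L {b.C, inv\<^bsub>L\<^esub> b.C}"
  by (simp add: laurent_C_def \<kappa>_C)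

lemma k_algebra_laurent: "k_algebra (laurent_C L \<kappa>)"
  unfolding laurent_eq using C_Units by (intro L.k_algebra_generated) auto

lemma is_subalgebra_laurent: "is_subalgebra L (carrier (laurent_C L \<kappa>))"
  unfolding laurent_eq using C_Units by (intro L.is_subalgebra_generated) auto

lemma C_laurent: "b.C \<in> carrier (laurent_C L \<kappa>)" "inv\<^bsub>L\<^esub> b.C \<in> carrier (laurent_C L \<kappa>)"
  unfolding laurent_eq using L.generated_subset[of "{b.C, inv\<^bsub>L\<^esub> b.C}"] by simp_all

lemma bosonization_subset:
  assumes "is_subalgebra L B" "\<kappa> (bos_gen_class Bos_x) \<in> B" "\<kappa> (bos_gen_class Bos_y) \<in> B"
    "\<kappa> (bos_gen_class Bos_g) \<in> B" "\<kappa> (bos_gen_class Bos_gi) \<in> B"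
  shows "\<kappa> ` carrier bosonization \<subseteq> B"
proof -
  have "carrier bosonization \<subseteq> {r \<in> carrier bosonization. \<kappa> r \<in> B}"
    using assms
    by (intro bosonization_generators is_subalgebra_vimage[OF R.k_algebra_axioms \<iota>]) auto
  then show ?thesis by auto
qed

text \<open>Two passes: \<open>C\<close> commutes with the generators, hence with all of
  \<open>L\<close> including the inverse of \<open>s\<close>. So \<open>C\<close> and its inverse
  lie in the centre, a subalgebra.\<close>

lemma laurent_central:
  assumes "c \<in> carrier (laurent_C L \<kappa>)" "z \<in> carrier L"
  shows "c \<otimes>\<^bsub>L\<^esub> z = z \<otimes>\<^bsub>L\<^esub> c"
proof -
  have C: "{b.C} \<subseteq> carrier L" by simp
  have gens: "\<kappa> ` carrier bosonization \<subseteq> centralizer L {b.C}"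
    by (rule bosonization_subset[OF L.is_subalgebra_centralizer[OF C]])
       (simp_all add: centralizer_def b.C_commute)
  then have "\<kappa> bos_s \<in> centralizer L {b.C}" using s_closed by blast
  then have "inv\<^bsub>L\<^esub> \<kappa> bos_s \<in> centralizer L {b.C}"
    by (rule L.inv_in_centralizer[OF C \<iota>_s_Units])
  then have "carrier L \<subseteq> centralizer L {b.C}"
    by (rule generators[OF L.is_subalgebra_centralizer[OF C] gens])
  then have "z \<otimes>\<^bsub>L\<^esub> b.C = b.C \<otimes>\<^bsub>L\<^esub> z" if "z \<in> carrier L" for z
    using that unfolding centralizer_def by blast
  then have C_central: "b.C \<in> centralizer L (carrier L)"
    unfolding centralizer_def using C by force
  then have "inv\<^bsub>L\<^esub> b.C \<in> centralizer L (carrier L)"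
    by (rule L.inv_in_centralizer[OF subset_refl C_Units])
  with C_central have "carrier (laurent_C L \<kappa>) \<subseteq> centralizer L (carrier L)"
    unfolding laurent_eq by (intro L.generated_least L.is_subalgebra_centralizer) simp_all
  with assms show ?thesis unfolding centralizer_def by blast
qed

end

text \<open>Needed because minimality of a generated subalgebra refers to the ambient algebra,
  whereas an equalizer may be formed inside a subalgebra.\<close>

lemma is_subalgebra_trans:
  assumes "k_algebra A" "is_subalgebra A C" "is_subalgebra (A\<lparr>carrier := C\<rparr>) B"
  shows "is_subalgebra A B"
proof -
  interpret k_algebra A by fact
  show ?thesis
    by (rule is_subalgebraI)
       (use is_subalgebraD[OF assms(2)] is_subalgebraD[OF assms(3)] in auto)
qed

section \<open>The two mutually inverse maps between \<open>As\<close> and the tensor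
  product\<close>

locale localized_pair = J: localized_super_jordan Js \<iota> + B: localized_bosonization As \<kappa>
  for Js :: "('k::field, 'b) module" and \<iota> and As :: "('k, 'c) module" and \<kappa>
begin

abbreviation "K \<equiv> laurent_C As \<kappa>"

sublocale tensor_pair K Js
  by (intro tensor_pair.intro B.k_algebra_laurent J.L.k_algebra_axioms)

lemma K_sel [simp]:
  "monoid.mult K = monoid.mult As" "monoid.one K = monoid.one As" "ring.add K = ring.add As"
  "smult K = smult As"
  by (simp_all add: B.laurent_eq)

lemma inclusion_hom: "(\<lambda>c. c) \<in> alg_hom K As"
  by (rule alg_homI) (use is_subalgebraD(1)[OF B.is_subalgebra_laurent] in auto)

text \<open>Sending x to x and y to y takes \<open>s\<close> to \<open>s\<close>, a unit of
  \<open>As\<close>, so the map extends from the super Jordan plane to its localization.\<close>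

lemma super_jordan_to_bosonization:
  obtains j where "j \<in> alg_hom Js As" "j J.gx = \<kappa> (bos_gen_class Bos_x)" "j J.gy = \<kappa> (bos_gen_class Bos_y)"
proof -
  obtain h where h: "h \<in> alg_hom super_jordan As"
    "h (sj_gen_class SJ_x) = \<kappa> (bos_gen_class Bos_x)" "h (sj_gen_class SJ_y) = \<kappa> (bos_gen_class Bos_y)"
    by (rule super_jordan_lift[OF B.b.sj_pair_axioms])
  have "h sj_s = B.b.s"
    using sj_pair_hom(2)[OF sj_pair_super_jordan B.L.k_algebra_axioms h(1)]
    by (simp add: sj_s_eq h(2,3))
  then have "h sj_s \<in> Units As" by (simp add: B.s_Units)
  then obtain j where j: "j \<in> alg_hom Js As" "\<And>r. r \<in> carrier super_jordan \<Longrightarrow> j (\<iota> r) = h r"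
    using J.lift[OF B.L.k_algebra_axioms h(1)] by blast
  show thesis
    using that[OF j(1)] h(2,3) j(2) by simp
qed

abbreviation "C' \<equiv> inv\<^bsub>As\<^esub> B.b.C"
abbreviation "d' \<equiv> inv\<^bsub>Js\<^esub> J.sj.d"

lemma d_Units: "J.sj.d \<in> Units Js"
  by (rule J.sj.d_Units[OF J.sj.s_Units])

lemma d'_closed [simp]: "d' \<in> carrier Js"
  using d_Units by simp

lemma C'_closed [simp]: "C' \<in> carrier As"
  using B.C_Units by simp

lemma C_inverses [simp]: "B.b.C \<otimes>\<^bsub>As\<^esub> C' = \<one>\<^bsub>As\<^esub>" "C' \<otimes>\<^bsub>As\<^esub> B.b.C = \<one>\<^bsub>As\<^esub>"
  using B.C_Units by simp_all

lemma d_inverses [simp]: "J.sj.d \<otimes>\<^bsub>Js\<^esub> d' = \<one>\<^bsub>Js\<^esub>" "d' \<otimes>\<^bsub>Js\<^esub> J.sj.d = \<one>\<^bsub>Js\<^esub>"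
  using d_Units by simp_all

lemma one_K: "\<one>\<^bsub>As\<^esub> \<in> carrier K"
  using is_subalgebraD(2)[OF B.is_subalgebra_laurent] .

lemma t_mult':
  assumes "a \<in> carrier K" "b \<in> carrier Js" "a' \<in> carrier K" "b' \<in> carrier Js"
  shows "t a b \<otimes>\<^bsub>T\<^esub> t a' b' = t (a \<otimes>\<^bsub>As\<^esub> a') (b \<otimes>\<^bsub>Js\<^esub> b')"
  using t_mult[OF assms] by simp

text \<open>Under conjugation by C^(-1) \<otimes> d the first tensor factor cancels on elements 1
  \<otimes> z, and the second acts as conjugation by \<open>d\<close>. The relations for
  \<open>g\<close> thus become \<open>d_x\<close> and \<open>d_y\<close>.\<close>

lemma bos_quad_tensor:
  "bos_quad T (t \<one>\<^bsub>As\<^esub> J.gx) (t \<one>\<^bsub>As\<^esub> J.gy) (t C' J.sj.d) (t B.b.C d')"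
proof (intro bos_quad.intro bos_quad_axioms.intro)
  note right = right_hom[simplified]
  note right_minus = alg_hom_minus[OF J.L.k_algebra_axioms T.k_algebra_axioms right]
  note K = B.C_laurent one_K
  show "sj_pair T (t \<one>\<^bsub>As\<^esub> J.gx) (t \<one>\<^bsub>As\<^esub> J.gy)"
    by (rule sj_pair_hom(1)[OF J.sj.sj_pair_axioms T.k_algebra_axioms right])
  have conj: "t C' J.sj.d \<otimes>\<^bsub>T\<^esub> t \<one>\<^bsub>As\<^esub> z \<otimes>\<^bsub>T\<^esub> t B.b.C d' = t \<one>\<^bsub>As\<^esub> w"
    if "J.sj.d \<otimes>\<^bsub>Js\<^esub> z = w \<otimes>\<^bsub>Js\<^esub> J.sj.d" "z \<in> carrier Js" "w \<in> carrier Js" for z w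
    using that K by (simp add: t_mult' J.L.m_assoc)
  have "t C' J.sj.d \<otimes>\<^bsub>T\<^esub> t \<one>\<^bsub>As\<^esub> J.gx \<otimes>\<^bsub>T\<^esub> t B.b.C d' = t \<one>\<^bsub>As\<^esub> (\<ominus>\<^bsub>Js\<^esub> J.gx)"
    by (rule conj) (simp_all add: J.sj.d_x J.L.l_minus)
  then show "t C' J.sj.d \<otimes>\<^bsub>T\<^esub> t \<one>\<^bsub>As\<^esub> J.gx \<otimes>\<^bsub>T\<^esub> t B.b.C d' = \<ominus>\<^bsub>T\<^esub> t \<one>\<^bsub>As\<^esub> J.gx"
    by (simp add: right_minus)
  have "t C' J.sj.d \<otimes>\<^bsub>T\<^esub> t \<one>\<^bsub>As\<^esub> J.gy \<otimes>\<^bsub>T\<^esub> t B.b.C d' = t \<one>\<^bsub>As\<^esub> (\<ominus>\<^bsub>Js\<^esub> J.gy \<oplus>\<^bsub>Js\<^esub> J.gx)"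
    by (rule conj) (simp_all add: J.sj.d_y)
  then show "t C' J.sj.d \<otimes>\<^bsub>T\<^esub> t \<one>\<^bsub>As\<^esub> J.gy \<otimes>\<^bsub>T\<^esub> t B.b.C d' =
      \<ominus>\<^bsub>T\<^esub> t \<one>\<^bsub>As\<^esub> J.gy \<oplus>\<^bsub>T\<^esub> t \<one>\<^bsub>As\<^esub> J.gx"
    using one_K by (simp add: right_minus t_add_right)
qed (use B.C_laurent t_one in \<open>auto simp: t_mult'\<close>)

lemma bosonization_to_tensor:
  obtains G where "G \<in> alg_hom As T"
    "G (\<kappa> (bos_gen_class Bos_x)) = t \<one>\<^bsub>As\<^esub> J.gx" "G (\<kappa> (bos_gen_class Bos_y)) = t \<one>\<^bsub>As\<^esub> J.gy"
    "G (\<kappa> (bos_gen_class Bos_g)) = t C' J.sj.d" "G (\<kappa> (bos_gen_class Bos_gi)) = t B.b.C d'"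
proof -
  note right = right_hom[simplified]
  interpret q: bos_quad bosonization "bos_gen_class Bos_x" "bos_gen_class Bos_y"
    "bos_gen_class Bos_g" "bos_gen_class Bos_gi" by (rule bos_quad_bosonization)
  obtain h where h: "h \<in> alg_hom bosonization T"
    "h (bos_gen_class Bos_x) = t \<one>\<^bsub>As\<^esub> J.gx" "h (bos_gen_class Bos_y) = t \<one>\<^bsub>As\<^esub> J.gy"
    "h (bos_gen_class Bos_g) = t C' J.sj.d" "h (bos_gen_class Bos_gi) = t B.b.C d'"
    by (rule bosonization_lift[OF bos_quad_tensor])
  \<comment> \<open>The element \<open>bos_s\<close> goes to 1 \<otimes> s, a unit because
    \<open>s\<close> is one in \<open>Js\<close>.\<close>
  have "h bos_s = t \<one>\<^bsub>As\<^esub> J.sj.s"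
    using sj_pair_hom(2)[OF q.sj_pair_axioms T.k_algebra_axioms h(1)]
      sj_pair_hom(2)[OF J.sj.sj_pair_axioms T.k_algebra_axioms right]
    by (simp add: bos_s_eq h(2,3))
  then have "h bos_s \<in> Units T"
    using alg_hom_Units(1)[OF J.L.k_algebra_axioms T.k_algebra_axioms right J.sj.s_Units] by simp
  then obtain G where "G \<in> alg_hom As T" "\<And>r. r \<in> carrier bosonization \<Longrightarrow> G (\<kappa> r) = h r"
    using B.lift[OF T.k_algebra_axioms h(1)] by blast
  with that h(2-) show thesis by simp
qed

text \<open>Centrality of \<open>K\<close> makes c \<otimes> z \<mapsto> c j(z) a homomorphism
  \<open>F\<close>. One composite with \<open>G\<close> is checked on the four generators, the other
  on the two tensor factors separately.\<close>

lemma splitting: "As \<cong>\<^sub>a T"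
proof -
  note right = right_hom[simplified]
  obtain j where j: "j \<in> alg_hom Js As"
    and jX: "j J.gx = \<kappa> (bos_gen_class Bos_x)" and jY: "j J.gy = \<kappa> (bos_gen_class Bos_y)"
    by (rule super_jordan_to_bosonization)
  note jD = alg_homD[OF j]
  have jd: "j J.sj.d = B.b.d"
    using sj_pair_hom(3)[OF J.sj.sj_pair_axioms B.L.k_algebra_axioms j] by (simp add: jX jY)
  have jd': "j d' = inv\<^bsub>As\<^esub> B.b.d"
    using alg_hom_Units(2)[OF J.L.k_algebra_axioms B.L.k_algebra_axioms j d_Units] by (simp add: jd)
  obtain F where F: "F \<in> alg_hom T As"
    and Ft: "\<And>c z. \<lbrakk>c \<in> carrier K; z \<in> carrier Js\<rbrakk> \<Longrightarrow> F (t c z) = c \<otimes>\<^bsub>As\<^esub> j z"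
    by (rule lift[OF B.L.k_algebra_axioms inclusion_hom j]) (auto intro: B.laurent_central jD(1))
  obtain G where G: "G \<in> alg_hom As T"
    and Gx: "G (\<kappa> (bos_gen_class Bos_x)) = t \<one>\<^bsub>As\<^esub> J.gx"
    and Gy: "G (\<kappa> (bos_gen_class Bos_y)) = t \<one>\<^bsub>As\<^esub> J.gy"
    and Gg: "G (\<kappa> (bos_gen_class Bos_g)) = t C' J.sj.d"
    and Ggi: "G (\<kappa> (bos_gen_class Bos_gi)) = t B.b.C d'"
    by (rule bosonization_to_tensor)
  note GD = alg_homD[OF G]
  have dU: "B.b.d \<in> Units As" by (rule B.b.d_Units[OF B.s_Units])
  have FG: "F (G z) = z" if "z \<in> carrier As" for z
  proof (rule B.hom_eqI[OF B.L.k_algebra_axioms alg_hom_comp[OF G F] alg_hom_id _ that])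
    fix r :: "(bos_gen list \<Rightarrow>\<^sub>0 'k) set" assume r: "r \<in> carrier bosonization"
    have "\<kappa> ` carrier bosonization \<subseteq> {z \<in> carrier As. F (G z) = z}"
    proof (rule B.bosonization_subset[OF is_subalgebra_equalizer[OF B.L.k_algebra_axioms
            B.L.k_algebra_axioms alg_hom_comp[OF G F] alg_hom_id]])
      \<comment> \<open>C^(-1) d = C^(-1) C g = g.\<close>
      have "F (t C' J.sj.d) = C' \<otimes>\<^bsub>As\<^esub> (B.b.C \<otimes>\<^bsub>As\<^esub> \<kappa> (bos_gen_class Bos_g))"
        using B.C_laurent by (simp add: Ft jd B.b.C_g)
      then show "\<kappa> (bos_gen_class Bos_g) \<in> {z \<in> carrier As. F (G z) = z}"
        by (simp add: Gg B.L.m_assoc[symmetric])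
      \<comment> \<open>C d^(-1) = d^(-1) C by centrality, and d^(-1) C = d^(-1) d g^(-1) by
        definition of \<open>C\<close>.\<close>
      have "F (t B.b.C d') = B.b.C \<otimes>\<^bsub>As\<^esub> inv\<^bsub>As\<^esub> B.b.d"
        using B.C_laurent by (simp add: Ft jd')
      also have "\<dots> = inv\<^bsub>As\<^esub> B.b.d \<otimes>\<^bsub>As\<^esub> B.b.C"
        using B.C_laurent(1) dU by (intro B.laurent_central) auto
      also have "\<dots> = \<kappa> (bos_gen_class Bos_gi)"
        using dU by (simp add: B.b.C_def B.L.m_assoc[symmetric])
      finally show "\<kappa> (bos_gen_class Bos_gi) \<in> {z \<in> carrier As. F (G z) = z}"
        by (simp add: Ggi)
    qed (use one_K in \<open>simp_all add: Gx Gy Ft jX jY\<close>)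
    with r show "F (G (\<kappa> r)) = \<kappa> r" by auto
  qed
  \<comment> \<open>(1 \<otimes> d)(C \<otimes> d^(-1)) = C \<otimes> 1: the second tensor factor
    disappears, so \<open>G\<close> maps \<open>K\<close> into K \<otimes> 1.\<close>
  have GC: "G B.b.C = t B.b.C \<one>\<^bsub>Js\<^esub>"
  proof -
    have "G B.b.d = t \<one>\<^bsub>As\<^esub> J.sj.d"
      using sj_pair_hom(3)[OF B.b.sj_pair_axioms T.k_algebra_axioms G]
        sj_pair_hom(3)[OF J.sj.sj_pair_axioms T.k_algebra_axioms right] by (simp add: Gx Gy)
    moreover have "G B.b.C = G B.b.d \<otimes>\<^bsub>T\<^esub> G (\<kappa> (bos_gen_class Bos_gi))"
      unfolding B.b.C_def by (simp add: GD(2))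
    ultimately show ?thesis
      using one_K B.C_laurent by (simp add: Ggi t_mult')
  qed
  have GC': "G C' = t C' \<one>\<^bsub>Js\<^esub>"
    unfolding alg_hom_Units(2)[OF B.L.k_algebra_axioms T.k_algebra_axioms G B.C_Units] GC
    by (rule T.inv_char) (use B.C_laurent t_one in \<open>simp_all add: t_mult'\<close>)
  have GK: "G c = t c \<one>\<^bsub>Js\<^esub>" if "c \<in> carrier K" for c
  proof -
    have G_K: "G \<in> alg_hom K T" using alg_hom_comp[OF inclusion_hom G] by simp
    \<comment> \<open>The equalizer of \<open>G\<close> and c \<mapsto> c \<otimes> 1 lives in
      \<open>K\<close>; it is viewed inside \<open>As\<close>, where \<open>K\<close> is the
      smallest subalgebra containing \<open>C\<close> and its inverse.\<close>
    have "K = As\<lparr>carrier := carrier K\<rparr>" by (simp add: B.laurent_eq generated_subalgebra_def)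
    then have "is_subalgebra As {c \<in> carrier K. G c = t c \<one>\<^bsub>Js\<^esub>}"
      using is_subalgebra_trans[OF B.L.k_algebra_axioms B.is_subalgebra_laurent]
        is_subalgebra_equalizer[OF A.k_algebra_axioms T.k_algebra_axioms G_K left_hom] by metis
    then have "carrier K \<subseteq> {c \<in> carrier K. G c = t c \<one>\<^bsub>Js\<^esub>}"
      unfolding B.laurent_eq
      by (rule B.L.generated_least) (use B.C_laurent GC GC' in \<open>auto simp: B.laurent_eq\<close>)
    with that show ?thesis by blast
  qed
  have Gj: "G (j z) = t \<one>\<^bsub>As\<^esub> z" if "z \<in> carrier Js" for z
  proof (rule J.hom_eqI[OF T.k_algebra_axioms alg_hom_comp[OF j G] right _ that])
    fix r :: "(sj_gen list \<Rightarrow>\<^sub>0 'k) set" assume r: "r \<in> carrier super_jordan"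
    have "carrier super_jordan \<subseteq> {r \<in> carrier super_jordan. G (j (\<iota> r)) = t \<one>\<^bsub>As\<^esub> (\<iota> r)}"
      by (intro super_jordan_generators is_subalgebra_equalizer[OF J.R.k_algebra_axioms
            T.k_algebra_axioms alg_hom_comp[OF alg_hom_comp[OF J.\<iota> j] G] alg_hom_comp[OF J.\<iota> right]])
         (simp_all add: jX jY Gx Gy)
    with r show "G (j (\<iota> r)) = t \<one>\<^bsub>As\<^esub> (\<iota> r)" by auto
  qed
  show ?thesis
  proof (rule alg_isoI[OF G F FG])
    fix z assume z: "z \<in> carrier T"
    show "G (F z) = z"
    proof (rule hom_eqI[OF T.k_algebra_axioms alg_hom_comp[OF F G] alg_hom_id _ z])
      fix c w assume c: "c \<in> carrier K" and w: "w \<in> carrier Js"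
      then show "G (F (t c w)) = t c w"
        using one_K alg_homD(1)[OF inclusion_hom c]
        by (simp add: Ft GD(2) jD(1) GK Gj t_mult')
    qed
  qed
qed

end

theorem lemma2p3:
  fixes Js :: "('k::field, 'b) module"
    and As :: "('k, 'c) module"
    and \<iota> :: "(sj_gen list \<Rightarrow>\<^sub>0 'k) set \<Rightarrow> 'b"
    and \<kappa> :: "(bos_gen list \<Rightarrow>\<^sub>0 'k) set \<Rightarrow> 'c"
  assumes "CHAR('k) \<noteq> 2"
    and "is_localization super_jordan (powers super_jordan sj_s) Js \<iota>"
    and "is_localization bosonization (powers bosonization bos_s) As \<kappa>"
  shows "As \<cong>\<^sub>a laurent_C As \<kappa> \<otimes>\<^sub>a Js
    \<and> laurent_C As \<kappa> \<otimes>\<^sub>a Js \<cong>\<^sub>a laurent_C As \<kappa> \<otimes>\<^sub>a M2 (localized_weyl Js \<iota>)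
    \<and> laurent_C As \<kappa> \<otimes>\<^sub>a M2 (localized_weyl Js \<iota>)
        \<cong>\<^sub>a M2 (laurent_C As \<kappa> \<otimes>\<^sub>a localized_weyl Js \<iota>)"
proof -
  interpret j: sj_pair super_jordan "sj_gen_class SJ_x" "sj_gen_class SJ_y"
    by (rule sj_pair_super_jordan)
  interpret b: sj_pair bosonization "bos_gen_class Bos_x" "bos_gen_class Bos_y"
    by (rule bos_quad.axioms(1)[OF bos_quad_bosonization])
  interpret localized_pair Js \<iota> As \<kappa>
  proof (intro localized_pair.intro localized_super_jordan.intro localized_bosonization.intro
      localization.intro localization_axioms.intro)
    show "k_algebra Js" "k_algebra As" using assms(2,3) by (auto simp: is_localization_def)
    show "sj_s \<in> carrier super_jordan" by (simp add: sj_s_eq)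
    show "bos_s \<in> carrier bosonization" by (simp add: bos_s_eq)
  qed (fact assms(2,3) j.k_algebra_axioms b.k_algebra_axioms)+
  interpret W: k_algebra "localized_weyl Js \<iota>" by (rule J.k_algebra_weyl)
  interpret KW: tensor_pair K "localized_weyl Js \<iota>"
    by (intro tensor_pair.intro A.k_algebra_axioms W.k_algebra_axioms)
  \<comment> \<open>\<open>matrix_iso\<close> goes from matrices to \<open>Js\<close>, so it is
    inverted before being tensored with \<open>K\<close>.\<close>
  show ?thesis
    using splitting KW.tensor_M2
      tensor_iso_right[OF alg_iso_sym[OF J.matrix_iso W.k_algebra_M2] W.k_algebra_M2]
    by blast
qed

end
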